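(* Let $n\ge 2$ and $2\le k\le n$ be integers. The poset $\tilde\Pi_{\le n}^k$ of ordered partial partitions of $[n]$ with exactly $k$ parts has the homotopy type of a wedge of spheres of dimension $n-k$. The number of spheres is $$\beta_{k,n-1}=\sum_{i=0}^{k}(-1)^{i+k+1}\binom{k}{i+1}\, i^{\,n},$$ and the Euler characteristic of $\tilde\Pi_{\le n}^k$ is $\chi_{k,n-1}$, the Euler characteristic of $D_k(\Delta^{n-1})$.
   Context: An ordered partial partition of $[n]=\{1,\dots,n\}$ with exactly $k$ parts is a $k$-tuple $(S_1,\dots,S_k)$ of pairwise disjoint nonempty subsets of $[n]$ (their union need not be all of $[n]$). The set $\tilde\Pi_{\le n}^k$ of all of these is partially ordered by $(S_1,\dots,S_k)\le(T_1,\dots,T_k)$ iff $S_i\subseteq T_i$ for each $i$. No top or bottom element is adjoined. The homotopy type and Euler characteristic of a poset are those of (the geometric realization of) its order complex, the simplicial complex of finite nonempty chains. $\Delta^{n-1}$ is the full simplicial complex (simplex) on the vertex set $[n]$. The discretized configuration space $D_k(\Delta^{n-1})\subset(\Delta^{n-1})^k$ is the union of the products $\sigma_1\times\cdots\times\sigma_k$ over all $k$-tuples of open cells (interiors of nonempty faces) of $\Delta^{n-1}$ whose closures are pairwise disjoint, and $\chi_{k,n-1}$ denotes its (unreduced) Euler characteristic. A wedge of $m$ spheres of dimension $0$ is a discrete space with $m+1$ points. *)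

theory Defs
  imports "HOL-Analysis.Analysis" "HOL-Homology.Homology"
begin

section \<open>Posets, order complexes and geometric realizations\<close>

text \<open>An ordered partial partition \<open>(S\<^sub>1, \<dots>, S\<^sub>k)\<close> is a list of length \<open>k\<close>, so
  the part \<open>S\<^sub>i\<close> is the list entry with index \<open>i - 1\<close>.\<close>

definition ordered_partial_partitions :: "nat \<Rightarrow> nat \<Rightarrow> nat set list set" where
  "ordered_partial_partitions n k =
     {S. length S = k \<and> (\<forall>i<k. S ! i \<noteq> {} \<and> S ! i \<subseteq> {1..n}) \<and>
         (\<forall>i<k. \<forall>j<k. i \<noteq> j \<longrightarrow> S ! i \<inter> S ! j = {})}"

definition opp_le :: "nat set list \<Rightarrow> nat set list \<Rightarrow> bool" where
  "opp_le S T \<longleftrightarrow> list_all2 (\<subseteq>) S T"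

text \<open>Simplicial complexes are given by their sets of nonempty finite faces.\<close>

definition order_complex :: "'a set \<Rightarrow> ('a \<Rightarrow> 'a \<Rightarrow> bool) \<Rightarrow> 'a set set" where
  "order_complex P leq =
     {C. finite C \<and> C \<noteq> {} \<and> C \<subseteq> P \<and> (\<forall>x\<in>C. \<forall>y\<in>C. leq x y \<or> leq y x)}"

definition full_simplex :: "'a set \<Rightarrow> 'a set set" where
  "full_simplex V = {\<sigma>. finite \<sigma> \<and> \<sigma> \<noteq> {} \<and> \<sigma> \<subseteq> V}"

text \<open>Points are given by barycentric coordinates. The product topology is the usual
  topology of the realization for finite complexes (the only ones used here), but not for
  infinite ones in general.\<close>

definition realization :: "'a set set \<Rightarrow> ('a \<Rightarrow> real) topology" where
  "realization K =
     subtopology (powertop_real UNIV)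
       {x. (\<forall>v. 0 \<le> x v) \<and> {v. x v \<noteq> 0} \<in> K \<and> (\<Sum>v | x v \<noteq> 0. x v) = 1}"

definition open_cell :: "'a set set \<Rightarrow> 'a set \<Rightarrow> ('a \<Rightarrow> real) set" where
  "open_cell K \<sigma> = {x \<in> topspace (realization K). {v. x v \<noteq> 0} = \<sigma>}"

text \<open>The discretized configuration space of \<open>k\<close> points in a complex \<open>K\<close>, as a subspace of the
  \<open>k\<close>-fold power of the realization of \<open>K\<close>; the factors are indexed by \<open>0, \<dots>, k - 1\<close>.\<close>

definition discretized_configuration_space ::
    "nat \<Rightarrow> 'a set set \<Rightarrow> (nat \<Rightarrow> 'a \<Rightarrow> real) topology" where
  "discretized_configuration_space k K =
     subtopology (product_topology (\<lambda>_. realization K) {..<k})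
       (\<Union>\<sigma> \<in> {\<sigma>. (\<forall>i<k. \<sigma> i \<in> K) \<and>
                   (\<forall>i<k. \<forall>j<k. i \<noteq> j \<longrightarrow>
                      (realization K closure_of open_cell K (\<sigma> i)) \<inter>
                      (realization K closure_of open_cell K (\<sigma> j)) = {})}.
          \<Pi>\<^sub>E i\<in>{..<k}. open_cell K (\<sigma> i))"

section \<open>Euler characteristic\<close>

definition int_independent :: "('a, 'b) monoid_scheme \<Rightarrow> 'a set \<Rightarrow> bool" where
  "int_independent G S \<longleftrightarrow> finite S \<and> S \<subseteq> carrier G \<and>
     (\<forall>c :: 'a \<Rightarrow> int. finprod G (\<lambda>x. x [^]\<^bsub>G\<^esub> c x) S = \<one>\<^bsub>G\<^esub> \<longrightarrow> (\<forall>x\<in>S. c x = 0))"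

text \<open>Meaningful for abelian groups (written multiplicatively) of finite rank.\<close>

definition abelian_rank :: "('a, 'b) monoid_scheme \<Rightarrow> nat" where
  "abelian_rank G = Sup {card S | S. int_independent G S}"

definition betti_number :: "nat \<Rightarrow> 'a topology \<Rightarrow> nat" where
  "betti_number p X = abelian_rank (homology_group (int p) X)"

text \<open>Meaningful for spaces with finitely generated total singular homology, such as
  finite cell complexes.\<close>

definition euler_characteristic :: "'a topology \<Rightarrow> int" where
  "euler_characteristic X = (\<Sum>p | betti_number p X \<noteq> 0. (-1) ^ p * int (betti_number p X))"

section \<open>Wedges of spheres\<close>

text \<open>The wedge of \<open>m\<close> copies of \<open>(X, b)\<close>, embedded in the \<open>m\<close>-fold power of \<open>X\<close> as the set of
  points with at most one coordinate different from \<open>b\<close>; it is a single point for \<open>m = 0\<close>.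
  The lemmas \<open>quotient_map_wedge\<close> and \<open>wedge_inclusion_eq_iff\<close> identify it with the quotient of
  the disjoint union by the set of base points.\<close>

definition wedge_of_copies :: "nat \<Rightarrow> 'a topology \<Rightarrow> 'a \<Rightarrow> (nat \<Rightarrow> 'a) topology" where
  "wedge_of_copies m X b =
     subtopology (product_topology (\<lambda>_. X) {..<m})
       {f. \<forall>i<m. \<forall>j<m. f i \<noteq> b \<and> f j \<noteq> b \<longrightarrow> i = j}"

definition wedge_inclusion :: "nat \<Rightarrow> 'a \<Rightarrow> nat \<times> 'a \<Rightarrow> nat \<Rightarrow> 'a" where
  "wedge_inclusion m b = (\<lambda>(i, y). \<lambda>j\<in>{..<m}. if j = i then y else b)"

lemma wedge_inclusion_eq_iff:
  assumes "i < m" "j < m"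
  shows "wedge_inclusion m b (i, x) = wedge_inclusion m b (j, y) \<longleftrightarrow>
           (i, x) = (j, y) \<or> x = b \<and> y = b"
  using assms by (auto simp: wedge_inclusion_def fun_eq_iff restrict_def split: if_splits)

lemma quotient_map_wedge:
  assumes X: "compact_space X" "Hausdorff_space X" and b: "b \<in> topspace X" and m: "m > 0"
  shows "quotient_map (sum_topology (\<lambda>_. X) {..<m}) (wedge_of_copies m X b) (wedge_inclusion m b)"
    (is "quotient_map ?S ?W ?q")
proof (rule continuous_closed_imp_quotient_map)
  have comp: "continuous_map X ?W (\<lambda>y. ?q (i, y))" if "i < m" for i
    using that b unfolding wedge_of_copies_def wedge_inclusion_def continuous_map_in_subtopology
    by (auto simp: continuous_map_componentwise PiE_iff extensional_def restrict_def)
  show cont: "continuous_map ?S ?W ?q"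
    unfolding continuous_map_def
  proof (intro conjI allI impI)
    show "?q \<in> topspace ?S \<rightarrow> topspace ?W"
      using comp by (fastforce simp: continuous_map_def)
    fix U assume "openin ?W U"
    then show "openin ?S {p \<in> topspace ?S. ?q p \<in> U}"
      using openin_continuous_map_preimage[OF comp] by (auto simp: openin_sum_topology)
  qed
  have "Hausdorff_space ?W"
    unfolding wedge_of_copies_def
    by (intro Hausdorff_space_subtopology) (simp add: Hausdorff_space_product_topology X)
  moreover have "compact_space ?S"
  proof -
    have "topspace ?S = (\<Union>i<m. Pair i ` topspace X)" by auto
    moreover have "compactin ?S (Pair i ` topspace X)" if "i < m" for i
      using that X
      by (intro image_compactin[OF _ continuous_map_component_injection])
        (auto simp: compact_space_def)
    ultimately show ?thesis
      by (auto simp: compact_space_def intro!: compactin_Union)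
  qed
  ultimately show "closed_map ?S ?W ?q"
    by (intro continuous_imp_closed_map_gen cont Hausdorff_imp_kc_space)
  show "?q ` topspace ?S = topspace ?W"
  proof
    show "?q ` topspace ?S \<subseteq> topspace ?W"
      using cont by (rule continuous_map_image_subset_topspace)
    show "topspace ?W \<subseteq> ?q ` topspace ?S"
    proof
      fix f assume f: "f \<in> topspace ?W"
      then have ext: "f \<in> extensional {..<m}" and fX: "\<And>i. i < m \<Longrightarrow> f i \<in> topspace X"
        and one: "\<And>i j. \<lbrakk>i < m; j < m; f i \<noteq> b; f j \<noteq> b\<rbrakk> \<Longrightarrow> i = j"
        by (auto simp: wedge_of_copies_def PiE_iff)
      obtain i where i: "i < m" "\<And>j. \<lbrakk>j < m; j \<noteq> i\<rbrakk> \<Longrightarrow> f j = b"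
        using one m by metis
      have "f = ?q (i, f i)"
        using ext i by (auto simp: wedge_inclusion_def fun_eq_iff extensional_def restrict_def)
      then show "f \<in> ?q ` topspace ?S"
        using i fX by (auto intro!: image_eqI[where x = "(i, f i)"])
    qed
  qed
qed

text \<open>The library's \<open>nsphere d\<close> is the unit sphere in the first \<open>d + 1\<close> coordinates.\<close>

definition wedge_of_spheres :: "nat \<Rightarrow> nat \<Rightarrow> (nat \<Rightarrow> nat \<Rightarrow> real) topology" where
  "wedge_of_spheres m d = wedge_of_copies m (nsphere d) (\<lambda>i. if i = 0 then 1 else 0)"

end

theory Submission
  imports Defs
begin

text \<open>Write \<open>X(n, k)\<close> for the order complex. By induction on \<open>n\<close> there is a contractible subposet
  whose complement consists of \<open>\<beta>(n, k)\<close> partitions exhausting \<open>{1..n}\<close>, that is, of top-dimensional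
  cells: as a cell complex, \<open>X(n + 1, k)\<close> is the union of the mapping cylinders of the \<open>k\<close> maps
  \<open>X(n, k) \<rightarrow> X(n, k - 1)\<close> forgetting one part, glued along \<open>X(n, k)\<close>. These maps land in the
  contractible part of \<open>X(n, k - 1)\<close> for dimension reasons, so restricting the targets to it, and
  all but one of the sources to the contractible part of \<open>X(n, k)\<close>, leaves a union of contractible
  cylinders. This removes \<open>k \<beta>(n, k - 1) + (k - 1) \<beta>(n, k)\<close> cells, and the alternating sum obeys
  the same recursion. Collapsing the contractible subcomplex gives a wedge of spheres. Finally,
  \<open>X(n, k)\<close> is the barycentric subdivision of the discretized configuration space.\<close>

section \<open>Realizations of order complexes\<close>

text \<open>The induction carries exhaustiveness of the complement because exhaustive partitions are
  maximal, and this acts in three places. A partition that misses an element of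
  \<open>{1..n}\<close>, as happens whenever a part with such an element is forgotten, must lie in
  the contractible part. A partition outside the contractible part has nothing above it, which rules
  out comparabilities between different cylinders. A chain contains at most one removed partition,
  so the removed open cells are disjoint and become separate spheres. One cylinder may keep the full
  base because a mapping cylinder retracts to its target whatever its source is; each further
  cylinder then meets the union in a contractible set. The recursion starts at \<open>k = 1\<close>,
  where the poset has a top, and at \<open>k = n\<close>, where it consists of \<open>fact n\<close>
  isolated points. Deformations come from order-preserving maps comparable with the identity and are
  explicit in barycentric coordinates; compactness supplies the quotient maps.\<close>

abbreviation order_space :: "'a set \<Rightarrow> ('a \<Rightarrow> 'a \<Rightarrow> bool) \<Rightarrow> ('a \<Rightarrow> real) topology" where
  "order_space P leq \<equiv> realization (order_complex P leq)"

section \<open>Points and topology of the realization over a finite vertex set\<close>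

lemma topspace_order_space:
  assumes "finite P"
  shows "x \<in> topspace (order_space P leq) \<longleftrightarrow>
    (\<forall>v. 0 \<le> x v) \<and> (\<forall>v. v \<notin> P \<longrightarrow> x v = 0) \<and> sum x P = 1 \<and>
    (\<forall>u v. x u \<noteq> 0 \<longrightarrow> x v \<noteq> 0 \<longrightarrow> leq u v \<or> leq v u)"
proof (cases "\<forall>v. v \<notin> P \<longrightarrow> x v = 0")
  case True
  have sub: "{v. x v \<noteq> 0} \<subseteq> P" using True by auto
  have "sum x {v. x v \<noteq> 0} = sum x P"
    by (rule sum.mono_neutral_left) (use sub assms in auto)
  moreover have "finite {v. x v \<noteq> 0}" using sub assms finite_subset by blast
  moreover have "sum x P = 1 \<Longrightarrow> \<exists>v. x v \<noteq> 0"
    by (metis sum.neutral zero_neq_one)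
  ultimately show ?thesis using sub
    by (auto simp: realization_def order_complex_def)
next
  case False
  then show ?thesis by (auto simp: realization_def order_complex_def)
qed

lemma
  assumes "x \<in> topspace (order_space P leq)" "finite P"
  shows order_space_nonneg: "0 \<le> x v"
    and order_space_outside: "v \<notin> P \<Longrightarrow> x v = 0"
    and order_space_sum: "sum x P = 1"
    and order_space_chain: "x u \<noteq> 0 \<Longrightarrow> x v \<noteq> 0 \<Longrightarrow> leq u v \<or> leq v u"
  using assms by (auto simp: topspace_order_space)

lemma order_space_subset:
  assumes "finite P" "Q \<subseteq> P"
  shows "topspace (order_space Q leq) = {x \<in> topspace (order_space P leq). \<forall>v\<in>P - Q. x v = 0}"
proof -
  have fin: "finite Q" using assms finite_subset by blast
  have "sum x P = sum x Q" if "\<forall>v\<in>P - Q. x v = 0" for x :: "'a \<Rightarrow> real"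
    by (rule sum.mono_neutral_right) (use assms that in auto)
  note sum = this
  show ?thesis
  proof (intro equalityI subsetI CollectI conjI ballI)
    fix x assume x: "x \<in> topspace (order_space Q leq)"
    then have "\<And>v. v \<notin> P \<Longrightarrow> x v = 0" using assms(2) order_space_outside[OF x fin] by blast
    then show "x \<in> topspace (order_space P leq)"
      using x sum[of x] unfolding topspace_order_space[OF fin] topspace_order_space[OF assms(1)]
      by auto
    show "x v = 0" if "v \<in> P - Q" for v
      using that order_space_outside[OF x fin] by blast
  next
    fix x assume x: "x \<in> {x \<in> topspace (order_space P leq). \<forall>v\<in>P - Q. x v = 0}"
    then show "x \<in> topspace (order_space Q leq)"
      using sum[of x] unfolding topspace_order_space[OF fin] topspace_order_space[OF assms(1)]
      by auto
  qed
qed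

lemma continuous_map_into_order_space:
  "continuous_map X (order_space P leq) f \<longleftrightarrow>
     (\<forall>v. continuous_map X euclideanreal (\<lambda>x. f x v)) \<and>
     f \<in> topspace X \<rightarrow> topspace (order_space P leq)"
proof -
  have "order_space P leq = subtopology (powertop_real UNIV) (topspace (order_space P leq))"
    unfolding realization_def by (simp add: subtopology_subtopology)
  then show ?thesis
    by (metis continuous_map_in_subtopology continuous_map_componentwise_UNIV image_subset_iff_funcset)
qed

lemma continuous_map_order_space_coordinate [continuous_intros]:
  "continuous_map (order_space P leq) euclideanreal (\<lambda>x. x v)"
  unfolding realization_def
  by (intro continuous_map_from_subtopology continuous_map_product_projection) auto

lemma order_space_mono:
  assumes "finite P" "Q \<subseteq> P"
  shows "topspace (order_space Q leq) \<subseteq> topspace (order_space P leq)"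
  using order_space_subset[OF assms] by blast

lemma Hausdorff_order_space: "Hausdorff_space (order_space P leq)"
  unfolding realization_def
  by (intro Hausdorff_space_subtopology) (simp add: Hausdorff_space_product_topology)

text \<open>Each \<open>face C\<close> is closed in the power of the real line, there are finitely
  many of them, and their union lies in a compact cube.\<close>

lemma compact_order_space:
  assumes fin: "finite P"
  shows "compact_space (order_space P leq)"
proof -
  let ?pt = "powertop_real (UNIV :: 'a set)"
  define face where "face C = {x :: 'a \<Rightarrow> real. (\<forall>v. 0 \<le> x v) \<and> (\<forall>v. v \<notin> C \<longrightarrow> x v = 0) \<and> sum x C = 1}" for C
  have coord: "continuous_map ?pt euclideanreal (\<lambda>x. x v)" for v :: 'a
    by (rule continuous_map_product_projection) auto
  have "closedin ?pt (face C)" if "finite C" for C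
  proof -
    have "face C = (\<Inter>v. {x \<in> topspace ?pt. x v \<in> {0..}}) \<inter> (\<Inter>v. {x \<in> topspace ?pt. x v \<in> (if v \<in> C then UNIV else {0})})
       \<inter> {x \<in> topspace ?pt. sum x C \<in> {1}}"
      by (auto simp: face_def split: if_splits)
    moreover have "closedin ?pt {x \<in> topspace ?pt. x v \<in> {0..}}" for v :: 'a
      by (rule closedin_continuous_map_preimage[OF coord]) auto
    moreover have "closedin ?pt {x \<in> topspace ?pt. x v \<in> (if v \<in> C then UNIV else {0})}" for v :: 'a
      by (rule closedin_continuous_map_preimage[OF coord]) auto
    moreover have "closedin ?pt {x \<in> topspace ?pt. sum x C \<in> {1}}"
      by (rule closedin_continuous_map_preimage[where Y = euclideanreal])
        (auto intro!: continuous_map_sum coord that)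
    ultimately show ?thesis
      by (auto intro!: closedin_Int closedin_Inter)
  qed
  then have clo: "closedin ?pt (\<Union>C\<in>order_complex P leq. face C)"
    using fin by (intro closedin_Union) (auto simp: order_complex_def intro: finite_subset[of _ "Pow P"])
  have "(\<Union>C\<in>order_complex P leq. face C) = topspace (order_space P leq)"
  proof (intro equalityI subsetI)
    fix x assume "x \<in> (\<Union>C\<in>order_complex P leq. face C)"
    then obtain C where C: "C \<in> order_complex P leq" "x \<in> face C" by blast
    moreover have "sum x P = sum x C"
      by (rule sum.mono_neutral_right) (use fin C in \<open>auto simp: face_def order_complex_def\<close>)
    moreover have "C \<subseteq> P" "\<forall>u\<in>C. \<forall>v\<in>C. leq u v \<or> leq v u"
      using C by (auto simp: order_complex_def)
    ultimately show "x \<in> topspace (order_space P leq)"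
      unfolding topspace_order_space[OF fin] face_def mem_Collect_eq by (metis subsetD)
  next
    fix x assume "x \<in> topspace (order_space P leq)"
    then show "x \<in> (\<Union>C\<in>order_complex P leq. face C)"
      by (auto simp: realization_def face_def)
  qed
  moreover have "topspace (order_space P leq) \<subseteq> (\<Pi>\<^sub>E v\<in>UNIV. {0..1})"
  proof
    fix x assume x: "x \<in> topspace (order_space P leq)"
    have "x v \<le> 1" for v
    proof (cases "v \<in> P")
      case True
      then have "x v \<le> sum x P"
        using fin order_space_nonneg[OF x fin] by (intro member_le_sum) auto
      then show ?thesis using order_space_sum[OF x fin] by simp
    next
      case False
      then show ?thesis using order_space_outside[OF x fin] by simp
    qed
    then show "x \<in> (\<Pi>\<^sub>E v\<in>UNIV. {0..1})"
      using order_space_nonneg[OF x fin] by auto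
  qed
  moreover have "compactin ?pt (\<Pi>\<^sub>E v\<in>UNIV. {0..1})"
    by (simp add: compactin_PiE)
  ultimately have "compactin ?pt (topspace (order_space P leq))"
    using closed_compactin clo by metis
  then show ?thesis
    unfolding realization_def
    by (auto simp: compact_space_def compactin_subtopology)
qed

subsection \<open>Homotopy extension\<close>

lemma homotopic_with_true_iff:
  "homotopic_with (\<lambda>h. True) X Y p q \<longleftrightarrow>
    (\<exists>h. continuous_map (prod_topology (top_of_set {0..1::real}) X) Y h \<and>
       (\<forall>x \<in> topspace X. h (0, x) = p x) \<and> (\<forall>x \<in> topspace X. h (1, x) = q x))"
  by (subst homotopic_with) auto

text \<open>The cylinder over \<open>Q\<close> is retracted to its bottom together with the cylinder
  over \<open>R\<close>. The weight \<open>s\<close> outside \<open>R\<close> serves as a distance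
  from the subcomplex: weights outside \<open>R\<close> are truncated and the result is renormalised
  until \<open>R\<close> is reached, and the time that remains is spent on \<open>h\<close>.\<close>

lemma order_space_homotopy_extension:
  fixes f :: "('a \<Rightarrow> real) \<Rightarrow> 'b"
  assumes fin: "finite Q" and RQ: "R \<subseteq> Q"
    and f: "continuous_map (order_space Q leq) Y f"
    and h: "continuous_map (prod_topology (top_of_set {0..1::real}) (order_space R leq)) Y h"
    and hf: "\<And>x. x \<in> topspace (order_space R leq) \<Longrightarrow> h (0, x) = f x"
  obtains H where "continuous_map (prod_topology (top_of_set {0..1::real}) (order_space Q leq)) Y H"
    "\<And>x. x \<in> topspace (order_space Q leq) \<Longrightarrow> H (0, x) = f x"
    "\<And>x t. x \<in> topspace (order_space R leq) \<Longrightarrow> t \<in> {0..1} \<Longrightarrow> H (t, x) = h (t, x)"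
proof -
  define N where "N = real (card Q)"
  \<comment> \<open>The truncation amount never exceeds \<open>1 / c\<close>, so at most
    \<open>N / c < 1\<close> of the mass is lost and the renormalising denominator stays
    positive.\<close>
  define c where "c = N + 1"
  have N0: "N \<ge> 0" by (simp add: N_def)
  have c0: "c > 0" using N0 by (simp add: c_def)
  let ?QI = "prod_topology (top_of_set {0..1::real}) (order_space Q leq)"
  define s where "s x = sum x (Q - R)" for x :: "'a \<Rightarrow> real"
  define \<tau> where "\<tau> p = min (s (snd p)) (fst p / c)" for p :: "real \<times> ('a \<Rightarrow> real)"
  \<comment> \<open>Truncating by a common amount, rather than scaling by a factor, avoids a
    division by \<open>s\<close>, which vanishes on the subcomplex.\<close>
  define tr where "tr p v = (if v \<in> R then snd p v else max 0 (snd p v - \<tau> p))" for p v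
  define P where "P p = (\<lambda>v. tr p v / sum (tr p) Q)" for p
  have contx: "continuous_map ?QI euclideanreal (\<lambda>p. snd p v)" for v
    using continuous_map_compose[OF continuous_map_snd continuous_map_order_space_coordinate]
    by (simp add: o_def)
  have contt: "continuous_map ?QI euclideanreal fst"
    using continuous_map_fst continuous_map_in_subtopology by blast
  have conts: "continuous_map ?QI euclideanreal (\<lambda>p. s (snd p))"
    unfolding s_def using fin by (intro continuous_intros contx) auto
  have cont\<tau>: "continuous_map ?QI euclideanreal \<tau>"
    unfolding \<tau>_def using c0 by (intro continuous_intros conts contt) auto
  have conttr: "continuous_map ?QI euclideanreal (\<lambda>p. tr p v)" for v
    unfolding tr_def using contx cont\<tau> by (cases "v \<in> R") (auto intro!: continuous_intros)
  have s_nonneg: "0 \<le> s x" if "x \<in> topspace (order_space Q leq)" for x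
    unfolding s_def using order_space_nonneg[OF that fin] by (intro sum_nonneg) auto
  have total: "sum (tr p) Q > 0" and tau: "0 \<le> \<tau> p" if "p \<in> topspace ?QI" for p
  proof -
    have x: "snd p \<in> topspace (order_space Q leq)" and t: "fst p \<in> {0..1}" using that by auto
    show tau0: "0 \<le> \<tau> p" using s_nonneg[OF x] t c0 by (simp add: \<tau>_def)
    have "\<tau> p \<le> 1 / c" using t c0 by (auto simp: \<tau>_def min_le_iff_disj divide_right_mono)
    then have "N * \<tau> p \<le> N * (1 / c)" using N0 by (rule mult_left_mono)
    also have "\<dots> < 1" using c0 by (simp add: c_def field_simps)
    finally have "N * \<tau> p < 1" .
    moreover have "(\<Sum>v\<in>Q. snd p v - \<tau> p) \<le> sum (tr p) Q"
      using tau0 by (intro sum_mono) (auto simp: tr_def)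
    ultimately show "sum (tr p) Q > 0"
      using order_space_sum[OF x fin] by (simp add: sum_subtractf N_def)
  qed
  have trnn: "0 \<le> tr p v" if "p \<in> topspace ?QI" for p v
    using that order_space_nonneg[OF _ fin] by (auto simp: tr_def)
  have tr0: "tr p v = 0" if "p \<in> topspace ?QI" "snd p v = 0" for p v
    using that tau by (auto simp: tr_def)
  have Pin: "P p \<in> topspace (order_space Q leq)" if p: "p \<in> topspace ?QI" for p
    unfolding topspace_order_space[OF fin]
  proof (intro conjI allI impI)
    have x: "snd p \<in> topspace (order_space Q leq)" using p by auto
    show "0 \<le> P p v" for v using trnn[OF p] total[OF p] by (simp add: P_def)
    show "P p v = 0" if "v \<notin> Q" for v
      using tr0[OF p] order_space_outside[OF x fin that] by (simp add: P_def)
    show "sum (P p) Q = 1"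
      using total[OF p] by (simp add: P_def flip: sum_divide_distrib)
    show "leq u v \<or> leq v u" if "P p u \<noteq> 0" "P p v \<noteq> 0" for u v
    proof -
      have "snd p u \<noteq> 0" "snd p v \<noteq> 0" using that tr0[OF p] by (auto simp: P_def)
      then show ?thesis by (rule order_space_chain[OF x fin])
    qed
  qed
  have contP: "continuous_map ?QI (order_space Q leq) P"
    unfolding continuous_map_into_order_space
  proof (intro conjI allI)
    fix v
    show "continuous_map ?QI euclideanreal (\<lambda>p. P p v)"
      unfolding P_def using total fin
      by (intro continuous_intros conttr) (auto simp: less_le)
  qed (use Pin in auto)
  have PR: "P p \<in> topspace (order_space R leq)" if p: "p \<in> topspace ?QI" and le: "c * s (snd p) \<le> fst p" for p
  proof -
    have x: "snd p \<in> topspace (order_space Q leq)" using p by auto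
    have "\<tau> p = s (snd p)" using le c0 by (simp add: \<tau>_def field_simps min_def)
    moreover have "snd p v \<le> s (snd p)" if "v \<in> Q - R" for v
      unfolding s_def using that fin order_space_nonneg[OF x fin] by (intro member_le_sum) auto
    ultimately have "tr p v = 0" if "v \<in> Q - R" for v
      using that by (force simp: tr_def max_def)
    then have "\<forall>v\<in>Q - R. P p v = 0" by (simp add: P_def)
    then show ?thesis using Pin[OF p] order_space_subset[OF fin RQ] by blast
  qed
  have P0: "P p = snd p" if p: "p \<in> topspace ?QI" and "\<tau> p = 0" for p
  proof -
    have x: "snd p \<in> topspace (order_space Q leq)" using p by auto
    have "tr p = snd p" using that order_space_nonneg[OF x fin] by (auto simp: tr_def fun_eq_iff max_def)
    then show ?thesis using order_space_sum[OF x fin] by (simp add: P_def)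
  qed
  \<comment> \<open>The branches meet where the time equals \<open>c * s\<close>: the clock of
    \<open>h\<close> then shows 0, and \<open>h\<close> agrees with \<open>f\<close> at time
    0.\<close>
  define H where "H p = (if c * s (snd p) \<le> fst p then (h \<circ> (\<lambda>p. (fst p - c * s (snd p), P p))) p else (f \<circ> P) p)" for p
  show ?thesis
  proof
    show "continuous_map ?QI Y H"
      unfolding H_def
    proof (rule continuous_map_cases_le)
      show "continuous_map ?QI euclideanreal (\<lambda>p. c * s (snd p))"
        by (intro continuous_intros conts)
      show "continuous_map ?QI euclideanreal fst" by (rule contt)
      let ?S = "{x \<in> topspace ?QI. c * s (snd x) \<le> fst x}"
      have "continuous_map (subtopology ?QI ?S) (order_space R leq) P"
        using contP PR by (auto simp: continuous_map_into_order_space intro!: continuous_map_from_subtopology)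
      moreover have "continuous_map (subtopology ?QI ?S) (top_of_set {0..1}) (\<lambda>p. fst p - c * s (snd p))"
      proof -
        have "continuous_map (subtopology ?QI ?S) euclideanreal (\<lambda>p. fst p - c * s (snd p))"
          by (intro continuous_intros continuous_map_from_subtopology conts contt)
        moreover have "fst p - c * s (snd p) \<in> {0..1}" if "p \<in> ?S \<inter> topspace ?QI" for p
        proof -
          have "0 \<le> c * s (snd p)" using that s_nonneg c0 by auto
          then show ?thesis using that by auto
        qed
        ultimately show ?thesis
          unfolding continuous_map_in_subtopology by auto
      qed
      ultimately show "continuous_map (subtopology ?QI ?S) Y (h \<circ> (\<lambda>p. (fst p - c * s (snd p), P p)))"
        by (intro continuous_map_compose[OF _ h] continuous_map_pairedI)
      show "continuous_map (subtopology ?QI {x \<in> topspace ?QI. fst x \<le> c * s (snd x)}) Y (f \<circ> P)"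
        by (intro continuous_map_from_subtopology continuous_map_compose[OF contP f])
      show "(h \<circ> (\<lambda>p. (fst p - c * s (snd p), P p))) p = (f \<circ> P) p"
        if "p \<in> topspace ?QI" "c * s (snd p) = fst p" for p
        using hf[OF PR] that by simp
    qed
    show "H (0, x) = f x" if x: "x \<in> topspace (order_space Q leq)" for x
    proof -
      have p: "(0, x) \<in> topspace ?QI" using x by auto
      have P: "P (0, x) = x" using P0[OF p] s_nonneg[OF x] c0 by (simp add: \<tau>_def)
      have s: "s x = 0" if "c * s x \<le> 0"
        using that s_nonneg[OF x] c0 by (smt (verit) mult_pos_pos)
      have "x \<in> topspace (order_space R leq)" if "c * s x \<le> 0"
        using PR[OF p] P that by simp
      then show ?thesis using P hf[of x] s by (auto simp: H_def)
    qed
    show "H (t, x) = h (t, x)" if xR: "x \<in> topspace (order_space R leq)" and t: "t \<in> {0..1}" for x t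
    proof -
      have x: "x \<in> topspace (order_space Q leq)" and s: "s x = 0"
        using xR order_space_subset[OF fin RQ] by (auto simp: s_def)
      have p: "(t, x) \<in> topspace ?QI" using x t by auto
      have "\<tau> (t, x) = 0" using s t c0 by (simp add: \<tau>_def)
      then show ?thesis using P0[OF p] s t by (simp add: H_def)
    qed
  qed
qed

subsection \<open>Order-preserving maps\<close>

text \<open>The simplicial map induced by \<open>f\<close>, written in barycentric
  coordinates.\<close>

definition push :: "'a set \<Rightarrow> ('a \<Rightarrow> 'b) \<Rightarrow> ('a \<Rightarrow> real) \<Rightarrow> 'b \<Rightarrow> real" where
  "push P f x = (\<lambda>w. \<Sum>v | v \<in> P \<and> f v = w. x v)"

lemma sum_push:
  assumes "finite P" "finite Q" "f ` P \<subseteq> Q"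
  shows "sum (push P f x) Q = sum x P"
proof -
  have "(\<Sum>w\<in>Q. \<Sum>v | v \<in> P \<and> f v = w. x v) = sum x P"
    by (rule sum.group) (use assms in auto)
  then show ?thesis by (simp add: push_def)
qed

lemma push_nonzeroE:
  assumes "push P f x w \<noteq> 0"
  obtains v where "v \<in> P" "f v = w" "x v \<noteq> 0"
  using assms unfolding push_def by (metis (mono_tags, lifting) mem_Collect_eq sum.neutral)

lemma continuous_map_push:
  assumes P: "finite P" and Q: "finite Q" and f: "f ` P \<subseteq> Q"
    and mono: "\<And>u v. u \<in> P \<Longrightarrow> v \<in> P \<Longrightarrow> leq u v \<Longrightarrow> leq' (f u) (f v)"
  shows "continuous_map (order_space P leq) (order_space Q leq') (push P f)"
  unfolding continuous_map_into_order_space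
proof (intro conjI allI Pi_I)
  fix w
  show "continuous_map (order_space P leq) euclideanreal (\<lambda>x. push P f x w)"
    unfolding push_def using P by (intro continuous_intros) auto
next
  fix x assume x: "x \<in> topspace (order_space P leq)"
  show "push P f x \<in> topspace (order_space Q leq')"
    unfolding topspace_order_space[OF Q]
  proof (intro conjI allI impI)
    show "0 \<le> push P f x w" for w
      unfolding push_def using order_space_nonneg[OF x P] by (intro sum_nonneg) auto
    show "push P f x w = 0" if "w \<notin> Q" for w
      by (rule ccontr) (use f that in \<open>auto elim!: push_nonzeroE\<close>)
    show "sum (push P f x) Q = 1"
      using sum_push[OF P Q f] order_space_sum[OF x P] by simp
    show "leq' u v \<or> leq' v u" if "push P f x u \<noteq> 0" "push P f x v \<noteq> 0" for u v
    proof -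
      obtain u' where u': "u' \<in> P" "f u' = u" "x u' \<noteq> 0"
        using push_nonzeroE[OF \<open>push P f x u \<noteq> 0\<close>] by metis
      obtain v' where v': "v' \<in> P" "f v' = v" "x v' \<noteq> 0"
        using push_nonzeroE[OF \<open>push P f x v \<noteq> 0\<close>] by metis

      with u' show ?thesis using order_space_chain[OF x P, of u' v'] mono by blast
    qed
  qed
qed

lemma push_comp:
  assumes "finite P" "finite Q" "f ` P \<subseteq> Q"
  shows "push Q g (push P f x) = push P (g \<circ> f) x"
proof
  fix w
  have "(\<Sum>u\<in>{u \<in> Q. g u = w}. \<Sum>v | v \<in> {v \<in> P. g (f v) = w} \<and> f v = u. x v)
      = sum x {v \<in> P. g (f v) = w}"
    by (rule sum.group) (use assms in auto)
  moreover have "{v. v \<in> {v \<in> P. g (f v) = w} \<and> f v = u} = {v \<in> P. f v = u}" if "g u = w" for u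
    using that by auto
  ultimately show "push Q g (push P f x) w = push P (g \<circ> f) x w"
    by (simp add: push_def)
qed

text \<open>The linear homotopy between \<open>x\<close> and its image would leave the order complex. Instead, at
  time \<open>t\<close> the topmost part of the chain carrying mass \<open>t\<close> has been moved by \<open>f\<close>.\<close>

lemma push_homotopic_id:
  assumes P: "finite P" and f: "f ` P \<subseteq> P"
    and mono: "\<And>u v. u \<in> P \<Longrightarrow> v \<in> P \<Longrightarrow> leq u v \<Longrightarrow> leq (f u) (f v)"
    and infl: "\<And>v. v \<in> P \<Longrightarrow> leq v (f v)"
    and refl: "\<And>v. leq v v"
    and trans: "\<And>u v w. leq u v \<Longrightarrow> leq v w \<Longrightarrow> leq u w"
    and antisym: "\<And>u v. leq u v \<Longrightarrow> leq v u \<Longrightarrow> u = v"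
  shows "homotopic_with (\<lambda>h. True) (order_space P leq) (order_space P leq) id (push P f)"
proof -
  let ?PI = "prod_topology (top_of_set {0..1::real}) (order_space P leq)"
  \<comment> \<open>\<open>c x v\<close> is the mass strictly above \<open>v\<close>. Thus
    \<open>v\<close> begins to move at time \<open>c x v\<close> and has moved completely once its
    own weight has passed as well, which is the formula for \<open>mv\<close>.\<close>
  define c where "c x v = (\<Sum>u | u \<in> P \<and> leq v u \<and> u \<noteq> v. x u)" for x :: "'a \<Rightarrow> real" and v
  define mv where "mv p v = min (snd p v) (max 0 (fst p - c (snd p) v))" for p :: "real \<times> ('a \<Rightarrow> real)" and v
  define h where "h p = (\<lambda>w. snd p w - mv p w + push P f (mv p) w)" for p
  have contx: "continuous_map ?PI euclideanreal (\<lambda>p. snd p v)" for v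
    using continuous_map_compose[OF continuous_map_snd continuous_map_order_space_coordinate]
    by (simp add: o_def)
  have contt: "continuous_map ?PI euclideanreal fst"
    using continuous_map_fst continuous_map_in_subtopology by blast
  have contmv: "continuous_map ?PI euclideanreal (\<lambda>p. mv p v)" for v
    unfolding mv_def c_def using P by (intro continuous_intros contx contt) auto
  have conth: "continuous_map ?PI euclideanreal (\<lambda>p. h p w)" for w
    unfolding h_def push_def using P by (intro continuous_intros contx contmv) auto
  have hin: "h (t, x) \<in> topspace (order_space P leq)"
    if t: "t \<in> {0..1}" and x: "x \<in> topspace (order_space P leq)" for t x
    unfolding topspace_order_space[OF P]
  proof (intro conjI allI impI)
    note nn = order_space_nonneg[OF x P]
    have mv: "0 \<le> mv (t, x) v" "mv (t, x) v \<le> x v" for v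
      using nn[of v] by (auto simp: mv_def)
    have push_nn: "0 \<le> push P f (mv (t, x)) w" for w
      unfolding push_def using mv by (intro sum_nonneg) auto
    show "0 \<le> h (t, x) w" for w
      using mv[of w] push_nn[of w] by (simp add: h_def)
    show "h (t, x) w = 0" if "w \<notin> P" for w
    proof -
      have "push P f (mv (t, x)) w = 0"
        by (rule ccontr) (use f that in \<open>auto elim!: push_nonzeroE\<close>)
      then show ?thesis using mv[of w] order_space_outside[OF x P that] by (simp add: h_def)
    qed
    show "sum (h (t, x)) P = 1"
      using sum_push[OF P P f, of "mv (t, x)"] order_space_sum[OF x P]
      by (simp add: h_def sum.distrib sum_subtractf)
    show "leq u v \<or> leq v u" if "h (t, x) u \<noteq> 0" "h (t, x) v \<noteq> 0" for u v
    proof -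
      have cases: "x w \<noteq> 0 \<and> mv (t, x) w < x w \<or> (\<exists>w'\<in>P. f w' = w \<and> mv (t, x) w' \<noteq> 0)"
        if "h (t, x) w \<noteq> 0" for w
      proof (cases "push P f (mv (t, x)) w = 0")
        case True
        then show ?thesis using that mv[of w] by (auto simp: h_def)
      next
        case False
        then show ?thesis by (auto elim!: push_nonzeroE)
      qed
      have inP: "w \<in> P" if "x w \<noteq> 0" for w using that order_space_outside[OF x P] by blast
      have xmv: "x w \<noteq> 0" if "mv (t, x) w \<noteq> 0" for w
        using that mv[of w] by auto
      \<comment> \<open>If \<open>w\<close> still has unmoved mass while \<open>w'\<close> has begun
        to move, then \<open>w\<close> lies below \<open>w'\<close>. Otherwise all mass at or above
        the vertex \<open>w\<close> is strictly above \<open>w'\<close>, and the clock has already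
        consumed the whole weight of \<open>w\<close>.\<close>
      have below: "leq w w'"
        if w: "x w \<noteq> 0" "mv (t, x) w < x w" and w': "mv (t, x) w' \<noteq> 0" for w w'
      proof (rule ccontr)
        assume nle: "\<not> leq w w'"
        then have le: "leq w' w" using order_space_chain[OF x P w(1) xmv[OF w']] by blast
        have "c x w + x w = sum x (insert w {u \<in> P. leq w u \<and> u \<noteq> w})"
          using P by (subst sum.insert) (auto simp: c_def)
        also have "\<dots> \<le> c x w'"
          unfolding c_def
        proof (rule sum_mono2)
          show "insert w {u \<in> P. leq w u \<and> u \<noteq> w} \<subseteq> {u \<in> P. leq w' u \<and> u \<noteq> w'}"
            using le nle inP[OF w(1)] trans antisym refl by blast
        qed (use P nn in auto)
        also have "c x w' < t" using w' nn[of w'] by (auto simp: mv_def max_def split: if_splits)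
        finally show False using w nn[of w] by (auto simp: mv_def)
      qed
      have pair: "leq w (f w')"
        if "x w \<noteq> 0" "mv (t, x) w < x w" "mv (t, x) w' \<noteq> 0" for w w'
        using below[OF that] infl[OF inP[OF xmv[OF that(3)]]] trans by blast
      have ff: "leq (f w) (f w') \<or> leq (f w') (f w)"
        if "mv (t, x) w \<noteq> 0" "mv (t, x) w' \<noteq> 0" for w w'
        using order_space_chain[OF x P xmv xmv, OF that] mono inP xmv that by blast
      show ?thesis
        using cases[OF that(1)] cases[OF that(2)] pair ff order_space_chain[OF x P] by blast
    qed
  qed
  have h0: "h (0, x) = id x" if x: "x \<in> topspace (order_space P leq)" for x
  proof -
    have "mv (0, x) v = 0" for v
    proof -
      have "0 \<le> c x v" unfolding c_def using order_space_nonneg[OF x P] by (intro sum_nonneg) auto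
      then show ?thesis using order_space_nonneg[OF x P, of v] by (simp add: mv_def)
    qed
    then show ?thesis by (simp add: h_def push_def)
  qed
  have h1: "h (1, x) = push P f x" if x: "x \<in> topspace (order_space P leq)" for x
  proof -
    have "mv (1, x) v = x v" for v
    proof (cases "v \<in> P")
      case True
      have "c x v + x v = sum x (insert v {u \<in> P. leq v u \<and> u \<noteq> v})"
        using P by (subst sum.insert) (auto simp: c_def)
      also have "\<dots> \<le> sum x P"
        using P True order_space_nonneg[OF x P] by (intro sum_mono2) auto
      finally show ?thesis using order_space_sum[OF x P] order_space_nonneg[OF x P, of v]
        by (simp add: mv_def)
    next
      case False
      then show ?thesis using order_space_outside[OF x P] by (simp add: mv_def)
    qed
    then have "mv (1, x) = x" by blast
    then show ?thesis by (simp add: h_def)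
  qed
  have "continuous_map ?PI (order_space P leq) h"
    unfolding continuous_map_into_order_space using conth hin by auto
  then show ?thesis
    unfolding homotopic_with_true_iff using h0 h1 by blast
qed

text \<open>The map induced by \<open>g \<circ> f\<close> is homotopic to the identity by inflation,
  and it factors through the contractible complex of \<open>Q\<close>.\<close>

lemma contractible_order_space_transfer_up:
  assumes P: "finite P" and Q: "finite Q" and f: "f ` P \<subseteq> Q" and g: "g ` Q \<subseteq> P"
    and mono_f: "\<And>u v. u \<in> P \<Longrightarrow> v \<in> P \<Longrightarrow> leq u v \<Longrightarrow> leq' (f u) (f v)"
    and mono_g: "\<And>u v. u \<in> Q \<Longrightarrow> v \<in> Q \<Longrightarrow> leq' u v \<Longrightarrow> leq (g u) (g v)"
    and infl: "\<And>v. v \<in> P \<Longrightarrow> leq v (g (f v))"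
    and refl: "\<And>v. leq v v"
    and trans: "\<And>u v w. leq u v \<Longrightarrow> leq v w \<Longrightarrow> leq u w"
    and antisym: "\<And>u v. leq u v \<Longrightarrow> leq v u \<Longrightarrow> u = v"
    and contr: "contractible_space (order_space Q leq')"
  shows "contractible_space (order_space P leq)"
proof -
  have "homotopic_with (\<lambda>h. True) (order_space P leq) (order_space P leq) id (push P (g \<circ> f))"
    by (rule push_homotopic_id[OF P _ _ _ refl trans antisym])
      (use f g mono_f mono_g infl in \<open>auto simp: image_subset_iff\<close>)
  moreover have "push P (g \<circ> f) = push Q g \<circ> push P f"
    by (rule ext) (simp add: push_comp[OF P Q f])
  moreover obtain c where "homotopic_with (\<lambda>h. True) (order_space P leq) (order_space P leq)
      (push Q g \<circ> push P f) (\<lambda>x. c)"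
    by (rule nullhomotopic_through_contractible_space[OF
          continuous_map_push[OF P Q f, where leq = leq and leq' = leq']
          continuous_map_push[OF Q P g, where leq = leq' and leq' = leq] contr])
      (use mono_f mono_g in blast)+
  ultimately show ?thesis
    unfolding contractible_space_def using homotopic_with_trans by fastforce
qed

lemma order_complex_dual: "order_complex P (\<lambda>u v. leq v u) = order_complex P leq"
  unfolding order_complex_def by blast

text \<open>Chains do not see the direction of the order, so reversing both relations turns the
  deflation into an inflation.\<close>

lemma contractible_order_space_transfer_down:
  assumes P: "finite P" and Q: "finite Q" and f: "f ` P \<subseteq> Q" and g: "g ` Q \<subseteq> P"
    and mono_f: "\<And>u v. u \<in> P \<Longrightarrow> v \<in> P \<Longrightarrow> leq u v \<Longrightarrow> leq' (f u) (f v)"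
    and mono_g: "\<And>u v. u \<in> Q \<Longrightarrow> v \<in> Q \<Longrightarrow> leq' u v \<Longrightarrow> leq (g u) (g v)"
    and defl: "\<And>v. v \<in> P \<Longrightarrow> leq (g (f v)) v"
    and refl: "\<And>v. leq v v"
    and trans: "\<And>u v w. leq u v \<Longrightarrow> leq v w \<Longrightarrow> leq u w"
    and antisym: "\<And>u v. leq u v \<Longrightarrow> leq v u \<Longrightarrow> u = v"
    and contr: "contractible_space (order_space Q leq')"
  shows "contractible_space (order_space P leq)"
proof -
  have "contractible_space (order_space P (\<lambda>u v. leq v u))"
  proof (rule contractible_order_space_transfer_up[OF P Q f g, where leq' = "\<lambda>u v. leq' v u"])
    show "contractible_space (order_space Q (\<lambda>u v. leq' v u))"
      using contr by (simp only: order_complex_dual[of Q leq'])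
  qed (use mono_f mono_g defl refl trans antisym in blast)+
  then show ?thesis by (simp only: order_complex_dual[of P leq])
qed

text \<open>The constant map to \<open>a\<close> is inflationary, and the complex of
  \<open>{a}\<close> is a point.\<close>

lemma contractible_order_space_top:
  assumes P: "finite P" and "a \<in> P" and top: "\<And>v. v \<in> P \<Longrightarrow> leq v a"
    and refl: "\<And>v. leq v v"
    and trans: "\<And>u v w. leq u v \<Longrightarrow> leq v w \<Longrightarrow> leq u w"
    and antisym: "\<And>u v. leq u v \<Longrightarrow> leq v u \<Longrightarrow> u = v"
  shows "contractible_space (order_space P leq)"
proof (rule contractible_order_space_transfer_up[where Q = "{a}" and f = "\<lambda>_. a" and g = id and leq' = leq])
  have "x = (\<lambda>v. if v = a then 1 else 0)" if "x \<in> topspace (order_space {a} leq)" for x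
    using that by (auto simp: topspace_order_space)
  then have "topspace (order_space {a} leq) \<subseteq> {\<lambda>v. if v = a then 1 else 0}" by blast
  then show "contractible_space (order_space {a} leq)"
    by (rule contractible_space_subset_singleton)
qed (use assms in auto)

subsection \<open>Gluing\<close>

text \<open>Incomparability puts every chain inside \<open>Q1\<close> or inside \<open>Q2\<close>,
  so the space is a union of \<open>U\<close> and \<open>V\<close> meeting in \<open>A\<close>. The
  contraction of \<open>U\<close> is extended to the whole space, after which \<open>U\<close> has
  become the point \<open>u0\<close>. It remains to shrink \<open>V\<close>, and the obstacle is
  that a contraction of \<open>V\<close> need not keep \<open>A\<close> together. Therefore
  \<open>A\<close> is shrunk to \<open>a\<close> inside \<open>V\<close> beforehand, and the track
  of \<open>a\<close> alone describes the motion of \<open>U\<close>.\<close>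

lemma contractible_order_space_union:
  assumes fin: "finite Q1" "finite Q2" and ne: "Q1 \<inter> Q2 \<noteq> {}"
    and refl: "\<And>v. leq v v"
    and incomp: "\<And>u v. u \<in> Q1 - Q2 \<Longrightarrow> v \<in> Q2 - Q1 \<Longrightarrow> \<not> leq u v \<and> \<not> leq v u"
    and contr: "contractible_space (order_space Q1 leq)" "contractible_space (order_space Q2 leq)"
      "contractible_space (order_space (Q1 \<inter> Q2) leq)"
  shows "contractible_space (order_space (Q1 \<union> Q2) leq)"
proof -
  let ?I = "top_of_set {0..1::real}"
  let ?X = "order_space (Q1 \<union> Q2) leq" and ?U = "order_space Q1 leq"
    and ?V = "order_space Q2 leq" and ?A = "order_space (Q1 \<inter> Q2) leq"
  have fins: "finite (Q1 \<union> Q2)" "finite (Q1 \<inter> Q2)" using fin by auto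
  have UX: "topspace ?U \<subseteq> topspace ?X" and VX: "topspace ?V \<subseteq> topspace ?X"
    and AU: "topspace ?A \<subseteq> topspace ?U" and AV: "topspace ?A \<subseteq> topspace ?V"
    by (intro order_space_mono fins fin; blast)+
  have UV: "x \<in> topspace ?A" if "x \<in> topspace ?U" "x \<in> topspace ?V" for x
    using that order_space_outside[OF that(2) fin(2)]
    by (auto simp: order_space_subset[OF fin(1), of "Q1 \<inter> Q2"])
  have cover: "x \<in> topspace ?U \<or> x \<in> topspace ?V" if x: "x \<in> topspace ?X" for x
  proof (rule ccontr)
    assume "\<not> ?thesis"
    then obtain u v where "u \<in> Q1 \<union> Q2" "u \<notin> Q1" "x u \<noteq> 0" "v \<in> Q1 \<union> Q2" "v \<notin> Q2" "x v \<noteq> 0"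
      using x order_space_subset[OF fins(1), of Q1] order_space_subset[OF fins(1), of Q2] by blast
    then show False
      using incomp[of v u] order_space_chain[OF x fins(1), of u v] by blast
  qed
  obtain a where a: "a \<in> topspace ?A"
  proof -
    obtain v where "v \<in> Q1 \<inter> Q2" using ne by blast
    then have "(\<lambda>w. if w = v then 1 else 0) \<in> topspace ?A"
      using fins by (auto simp: topspace_order_space refl)
    then show thesis using that by blast
  qed
  obtain cu u0 where cu: "continuous_map (prod_topology ?I ?U) ?U cu"
    "\<And>x. x \<in> topspace ?U \<Longrightarrow> cu (0, x) = x" "\<And>x. x \<in> topspace ?U \<Longrightarrow> cu (1, x) = u0"
    using contr(1) unfolding contractible_space_def homotopic_with_true_iff by auto
  obtain cv v0 where cv: "continuous_map (prod_topology ?I ?V) ?V cv"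
    "\<And>x. x \<in> topspace ?V \<Longrightarrow> cv (0, x) = x" "\<And>x. x \<in> topspace ?V \<Longrightarrow> cv (1, x) = v0"
    using contr(2) unfolding contractible_space_def homotopic_with_true_iff by auto
  obtain ca where ca: "continuous_map (prod_topology ?I ?A) ?A ca"
    "\<And>x. x \<in> topspace ?A \<Longrightarrow> ca (0, x) = x" "\<And>x. x \<in> topspace ?A \<Longrightarrow> ca (1, x) = a"
    using contr(3) a unfolding contractible_space_alt homotopic_with_true_iff by auto
  have subX: "continuous_map X ?X h" if "continuous_map X ?U h \<or> continuous_map X ?V h" for X :: "'c topology" and h
    using that UX VX by (auto simp: continuous_map_into_order_space)
  have subV: "continuous_map X ?V h" if "continuous_map X ?A h" for X :: "'c topology" and h
    using that AV by (auto simp: continuous_map_into_order_space)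
  obtain H where H: "continuous_map (prod_topology ?I ?X) ?X H"
    "\<And>x. x \<in> topspace ?X \<Longrightarrow> H (0, x) = x"
    "\<And>x t. x \<in> topspace ?U \<Longrightarrow> t \<in> {0..1} \<Longrightarrow> H (t, x) = cu (t, x)"
    by (rule order_space_homotopy_extension[OF fins(1), where R = Q1 and f = "\<lambda>x. x" and h = cu and Y = ?X])
      (use cu in \<open>auto intro: subX continuous_map_id[unfolded id_def]\<close>)
  obtain E where E: "continuous_map (prod_topology ?I ?V) ?V E"
    "\<And>x. x \<in> topspace ?V \<Longrightarrow> E (0, x) = x"
    "\<And>x t. x \<in> topspace ?A \<Longrightarrow> t \<in> {0..1} \<Longrightarrow> E (t, x) = ca (t, x)"
    by (rule order_space_homotopy_extension[OF fin(2), where R = "Q1 \<inter> Q2" and f = "\<lambda>x. x" and h = ca and Y = ?V])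
      (use ca in \<open>auto intro: subV continuous_map_id[unfolded id_def]\<close>)
  have H1U: "H (1, x) = u0" if "x \<in> topspace ?U" for x
    using H(3)[OF that, of 1] cu(3)[OF that] by simp
  have caA: "ca (t, x) \<in> topspace ?A" if "t \<in> {0..1}" "x \<in> topspace ?A" for t x
    using ca(1) that by (auto simp: continuous_map_def Pi_iff)
  have EV: "E (t, x) \<in> topspace ?V" if "t \<in> {0..1}" "x \<in> topspace ?V" for t x
    using E(1) that by (auto simp: continuous_map_def Pi_iff)
  have cvV: "cv (t, x) \<in> topspace ?V" if "t \<in> {0..1}" "x \<in> topspace ?V" for t x
    using cv(1) that by (auto simp: continuous_map_def Pi_iff)
  \<comment> \<open>A homotopy on \<open>V\<close> is pasted with a path that moves all of
    \<open>U\<close> at once, given agreement on \<open>A\<close>. One of the weights on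
    \<open>Q2 - Q1\<close> and on \<open>Q1 - Q2\<close> is always 0, so comparing the two tells in
    which piece a point lies.\<close>
  have glue: "\<exists>Z. continuous_map (prod_topology ?I ?X) ?X Z \<and>
      (\<forall>t\<in>{0..1}. \<forall>x\<in>topspace ?U. Z (t, x) = \<gamma> t) \<and> (\<forall>t\<in>{0..1}. \<forall>x\<in>topspace ?V. Z (t, x) = z (t, x))"
    if z: "continuous_map (prod_topology ?I ?V) ?X z" and \<gamma>: "continuous_map ?I ?X \<gamma>"
      and eq: "\<And>t x. t \<in> {0..1} \<Longrightarrow> x \<in> topspace ?A \<Longrightarrow> z (t, x) = \<gamma> t" for z \<gamma>
  proof -
    let ?XI = "prod_topology ?I ?X"
    let ?s = "\<lambda>p. \<Sum>v\<in>Q2 - Q1. snd p v" and ?r = "\<lambda>p. \<Sum>v\<in>Q1 - Q2. snd p v"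
    have contx: "continuous_map ?XI euclideanreal (\<lambda>p. snd p v)" for v
      using continuous_map_compose[OF continuous_map_snd continuous_map_order_space_coordinate]
      by (simp add: o_def)
    have inU: "x \<in> topspace ?U" if "x \<in> topspace ?X" "sum x (Q2 - Q1) \<le> 0" for x
    proof -
      have "sum x (Q2 - Q1) = 0"
        using that(2) order_space_nonneg[OF that(1) fins(1)] by (intro order_antisym sum_nonneg) auto
      then have "\<forall>v\<in>Q2 - Q1. x v = 0"
        using fin order_space_nonneg[OF that(1) fins(1)] by (subst (asm) sum_nonneg_eq_0_iff) auto
      then show ?thesis using that(1) order_space_subset[OF fins(1), of Q1] by auto
    qed
    have inV: "x \<in> topspace ?V" if "x \<in> topspace ?X" "sum x (Q1 - Q2) \<le> 0" for x
    proof -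
      have "sum x (Q1 - Q2) = 0"
        using that(2) order_space_nonneg[OF that(1) fins(1)] by (intro order_antisym sum_nonneg) auto
      then have "\<forall>v\<in>Q1 - Q2. x v = 0"
        using fin order_space_nonneg[OF that(1) fins(1)] by (subst (asm) sum_nonneg_eq_0_iff) auto
      then show ?thesis using that(1) order_space_subset[OF fins(1), of Q2] by auto
    qed
    have snn: "0 \<le> sum x (Q2 - Q1)" "0 \<le> sum x (Q1 - Q2)" if "x \<in> topspace ?X" for x
      using order_space_nonneg[OF that fins(1)] by (auto intro: sum_nonneg)
    have s0U: "sum x (Q2 - Q1) = 0" if "x \<in> topspace ?U" for x
      using order_space_outside[OF that fin(1)] by auto
    have s0V: "sum x (Q1 - Q2) = 0" if "x \<in> topspace ?V" for x
      using order_space_outside[OF that fin(2)] by auto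

    have leU: "x \<in> topspace ?U" if "x \<in> topspace ?X" "sum x (Q2 - Q1) \<le> sum x (Q1 - Q2)" for x
      using cover[OF that(1)] that(2) s0V[of x] inU[OF that(1)] by metis
    have leV: "x \<in> topspace ?V" if "x \<in> topspace ?X" "sum x (Q1 - Q2) \<le> sum x (Q2 - Q1)" for x
      using cover[OF that(1)] that(2) s0U[of x] inV[OF that(1)] by metis
    have bothA: "x \<in> topspace ?A" if "x \<in> topspace ?X" "sum x (Q2 - Q1) = sum x (Q1 - Q2)" for x
      using UV leU leV that by simp
    define Z where "Z p = (if ?s p \<le> ?r p then (\<gamma> \<circ> fst) p else z p)" for p
    have "continuous_map ?XI ?X Z"
      unfolding Z_def
    proof (rule continuous_map_cases_le)
      show "continuous_map ?XI euclideanreal ?s" "continuous_map ?XI euclideanreal ?r"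
        using fin by (auto intro!: continuous_map_sum contx)
      show "continuous_map (subtopology ?XI {p \<in> topspace ?XI. ?s p \<le> ?r p}) ?X (\<gamma> \<circ> fst)"
        by (intro continuous_map_from_subtopology continuous_map_compose[OF continuous_map_fst \<gamma>])
      let ?S = "{p \<in> topspace ?XI. ?r p \<le> ?s p}"
      have "continuous_map (subtopology ?XI ?S) ?V snd"
        unfolding continuous_map_into_order_space
        using leV by (auto intro!: continuous_map_from_subtopology contx)
      then have "continuous_map (subtopology ?XI ?S) (prod_topology ?I ?V) (\<lambda>p. (fst p, snd p))"
        by (intro continuous_map_pairedI continuous_map_from_subtopology[OF continuous_map_fst])
      then have "continuous_map (subtopology ?XI ?S) ?X (z \<circ> (\<lambda>p. (fst p, snd p)))"
        by (rule continuous_map_compose[OF _ z])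
      then show "continuous_map (subtopology ?XI ?S) ?X z" by (simp add: o_def)
      show "(\<gamma> \<circ> fst) p = z p" if "p \<in> topspace ?XI" "?s p = ?r p" for p
        using that eq[of "fst p" "snd p"] bothA[of "snd p"] by (auto simp: mem_Times_iff)
    qed
    moreover have "Z (t, x) = \<gamma> t" if "t \<in> {0..1}" "x \<in> topspace ?U" for t x
      using s0U[OF that(2)] snn[of x] that UX by (auto simp: Z_def)
    moreover have "Z (t, x) = z (t, x)" if "t \<in> {0..1}" "x \<in> topspace ?V" for t x
    proof -
      have x: "x \<in> topspace ?X" using that VX by blast
      show ?thesis
        using s0V[OF that(2)] snn[OF x] that eq[OF that(1), of x] bothA[OF x] by (auto simp: Z_def)
    qed
    ultimately show ?thesis by blast
  qed
  have H1: "continuous_map ?X ?X (\<lambda>x. H (1, x))"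
    by (rule continuous_map_compose[where f = "\<lambda>x. (1, x)", OF _ H(1), unfolded o_def])
      (auto intro!: continuous_map_pairedI continuous_map_id[unfolded id_def])
  have pair1: "continuous_map (prod_topology ?I ?V) (prod_topology ?I ?V) (\<lambda>p. (fst p, g (snd p)))"
    if "continuous_map ?V ?V g" for g
    by (intro continuous_map_pairedI continuous_map_fst
        continuous_map_compose[OF continuous_map_snd that, unfolded o_def])
  have E1: "continuous_map ?V ?V (\<lambda>x. E (1, x))"
    by (rule continuous_map_compose[where f = "\<lambda>x. (1, x)", OF _ E(1), unfolded o_def])
      (auto intro!: continuous_map_pairedI continuous_map_id[unfolded id_def])
  have VXc: "continuous_map ?V ?X (\<lambda>x. x)"
    by (rule subX) (simp add: continuous_map_id[unfolded id_def])
  have u0: "u0 \<in> topspace ?X"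
    using H1 H1U a AU UX unfolding continuous_map_def Pi_iff by (metis subsetD)
  \<comment> \<open>\<open>E\<close> keeps \<open>A\<close> inside \<open>A\<close>, where the end
    of \<open>H\<close> is constantly \<open>u0\<close>, so the image of \<open>U\<close> can stand
    still.\<close>
  obtain Z1 where Z1: "continuous_map (prod_topology ?I ?X) ?X Z1"
    "\<And>t x. t \<in> {0..1} \<Longrightarrow> x \<in> topspace ?U \<Longrightarrow> Z1 (t, x) = u0"
    "\<And>t x. t \<in> {0..1} \<Longrightarrow> x \<in> topspace ?V \<Longrightarrow> Z1 (t, x) = H (1, E (t, x))"
  proof -
    have "continuous_map (prod_topology ?I ?V) ?X (\<lambda>p. H (1, E p))"
      using continuous_map_compose[OF continuous_map_compose[OF E(1) VXc] H1] by (simp add: o_def)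
    moreover have "continuous_map ?I ?X (\<lambda>t. u0)" using u0 by simp
    moreover have "H (1, E (t, x)) = u0" if "t \<in> {0..1}" "x \<in> topspace ?A" for t x
      using E(3)[OF that(2,1)] caA[OF that] H1U AU by auto
    ultimately show thesis using glue[of "\<lambda>p. H (1, E p)" "\<lambda>t. u0"] that by blast
  qed
  \<comment> \<open>After \<open>E\<close> all of \<open>A\<close> sits at \<open>a\<close>, so the
    contraction of \<open>V\<close> carries it along the single path of \<open>a\<close>.\<close>
  obtain Z2 where Z2: "continuous_map (prod_topology ?I ?X) ?X Z2"
    "\<And>t x. t \<in> {0..1} \<Longrightarrow> x \<in> topspace ?U \<Longrightarrow> Z2 (t, x) = H (1, cv (t, a))"
    "\<And>t x. t \<in> {0..1} \<Longrightarrow> x \<in> topspace ?V \<Longrightarrow> Z2 (t, x) = H (1, cv (t, E (1, x)))"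
  proof -
    have "continuous_map (prod_topology ?I ?V) ?X (\<lambda>p. H (1, cv (fst p, E (1, snd p))))"
      using continuous_map_compose[OF continuous_map_compose[OF continuous_map_compose[OF pair1[OF E1] cv(1)] VXc] H1]
      by (simp add: o_def)
    moreover have "continuous_map ?I ?X (\<lambda>t. H (1, cv (t, a)))"
    proof -
      have "continuous_map ?I (prod_topology ?I ?V) (\<lambda>t. (t, a))"
        using a AV by (intro continuous_map_pairedI) (auto simp: continuous_map_id[unfolded id_def])
      from continuous_map_compose[OF continuous_map_compose[OF continuous_map_compose[OF this cv(1)] VXc] H1]
      show ?thesis by (simp add: o_def)
    qed
    moreover have "H (1, cv (t, E (1, x))) = H (1, cv (t, a))" if "t \<in> {0..1}" "x \<in> topspace ?A" for t x
      using E(3)[OF that(2), of 1] ca(3)[OF that(2)] by simp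
    ultimately show thesis
      using glue[of "\<lambda>p. H (1, cv (fst p, E (1, snd p)))" "\<lambda>t. H (1, cv (t, a))"] that by auto
  qed
  have h1: "homotopic_with (\<lambda>h. True) ?X ?X id (\<lambda>x. H (1, x))"
    unfolding homotopic_with_true_iff using H by (intro exI[of _ H]) auto
  have h2: "homotopic_with (\<lambda>h. True) ?X ?X (\<lambda>x. H (1, x)) (\<lambda>x. Z1 (1, x))"
  proof -
    have "Z1 (0, x) = H (1, x)" if "x \<in> topspace ?X" for x
      using cover[OF that] Z1(2)[of 0 x] Z1(3)[of 0 x] H1U[of x] E(2)[of x] by auto
    then show ?thesis unfolding homotopic_with_true_iff using Z1(1) by (intro exI[of _ Z1]) auto
  qed
  have h3: "homotopic_with (\<lambda>h. True) ?X ?X (\<lambda>x. Z1 (1, x)) (\<lambda>x. H (1, v0))"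
  proof -
    have "H (1, cv (0, a)) = u0" using cv(2) H1U a AU AV by (metis subsetD)
    then have "Z2 (0, x) = Z1 (1, x)" if "x \<in> topspace ?X" for x
      using cover[OF that] Z1(2)[of 1 x] Z1(3)[of 1 x] Z2(2)[of 0 x] Z2(3)[of 0 x] cv(2) EV[of 1 x] by auto
    moreover have "cv (1, a) = v0" using cv(3) a AV by blast
    then have "Z2 (1, x) = H (1, v0)" if "x \<in> topspace ?X" for x
      using cover[OF that] Z2(2)[of 1 x] Z2(3)[of 1 x] cv(3) EV[of 1 x] by auto
    ultimately show ?thesis unfolding homotopic_with_true_iff using Z2(1) by (intro exI[of _ Z2]) auto
  qed
  show ?thesis
    unfolding contractible_space_def
    using homotopic_with_trans[OF homotopic_with_trans[OF h1 h2] h3] by blast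
qed

section \<open>The number of spheres\<close>

definition sphere_count :: "nat \<Rightarrow> nat \<Rightarrow> int" where
  "sphere_count n k = (\<Sum>i = 0..k. (-1) ^ (i + k + 1) * int (k choose (i + 1)) * int i ^ n)"

text \<open>One factor \<open>i\<close> of the power is absorbed: since \<open>(k - i) * (Suc k
  choose (i + 1)) = Suc k * (k choose (i + 1))\<close>, the product of \<open>i\<close> with the
  binomial splits into a multiple of the same binomial and a multiple of the one for
  \<open>k\<close>, whose sign is opposite.\<close>

lemma sphere_count_Suc:
  "sphere_count (Suc n) (Suc k) = int k * sphere_count n (Suc k) + int (Suc k) * sphere_count n k"
proof -
  have eq: "int i * int (Suc k choose (i + 1)) = int k * int (Suc k choose (i + 1)) - int (Suc k) * int (k choose (i + 1))"
    if "i \<le> Suc k" for i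
  proof (cases "i \<le> k")
    case True
    have "(Suc k - (i + 1)) * (Suc k choose (i + 1)) = Suc k * (k choose (i + 1))"
      using binomial_absorb_comp[of "Suc k" "i + 1"] by simp
    then have "int (Suc k - (i + 1)) * int (Suc k choose (i + 1)) = int (Suc k) * int (k choose (i + 1))"
      by (metis of_nat_mult)
    moreover have "int (Suc k - (i + 1)) = int k - int i" using True by simp
    ultimately show ?thesis by (simp add: algebra_simps)
  next
    case False
    then have "i = Suc k" using that by simp
    then show ?thesis by (simp add: binomial_eq_0 del: binomial_Suc_Suc)
  qed
  have "sphere_count (Suc n) (Suc k) =
      (\<Sum>i = 0..Suc k. (-1) ^ (i + Suc k + 1) * (int i * int (Suc k choose (i + 1))) * int i ^ n)"
    unfolding sphere_count_def by (intro sum.cong) (auto simp: mult_ac)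
  also have "\<dots> = (\<Sum>i = 0..Suc k. int k * ((-1) ^ (i + Suc k + 1) * int (Suc k choose (i + 1)) * int i ^ n)
      + int (Suc k) * ((-1) ^ (i + k + 1) * int (k choose (i + 1)) * int i ^ n))"
    by (rule sum.cong) (simp_all only: eq atLeastAtMost_iff, simp_all add: algebra_simps)
  also have "\<dots> = int k * sphere_count n (Suc k) +
      int (Suc k) * (\<Sum>i = 0..Suc k. (-1) ^ (i + k + 1) * int (k choose (i + 1)) * int i ^ n)"
    unfolding sphere_count_def by (simp only: sum.distrib flip: sum_distrib_left)
  also have "(\<Sum>i = 0..Suc k. (-1) ^ (i + k + 1) * int (k choose (i + 1)) * int i ^ n) = sphere_count n k"
    unfolding sphere_count_def by simp
  finally show ?thesis .
qed

lemma sphere_count_one: "n > 0 \<Longrightarrow> sphere_count n 1 = 0"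
  by (simp add: sphere_count_def)

text \<open>No partition exists in this range, and the value is a formal one: the empty complex has
  reduced Euler characteristic -1, here taken with the sign of the dimension \<open>n - k\<close>.
  It yields the boundary value \<open>sphere_count k (Suc k) = 1\<close> for the diagonal.\<close>

lemma sphere_count_less:
  assumes "n < k"
  shows "sphere_count n k = (-1) ^ (n + k + 1)"
  using assms
proof (induction n arbitrary: k)
  \<comment> \<open>Every power is 1, including \<open>0 ^ 0\<close>, so the sum is an alternating
    binomial sum without its first term.\<close>
  case 0
  have "(\<Sum>i\<le>k. (-1) ^ i * int (k choose i)) = 0"
    using choose_alternating_sum[of k, where 'a = int] 0 by simp
  moreover have "(\<Sum>i\<le>Suc k. (-1) ^ i * int (k choose i)) = (\<Sum>i\<le>k. (-1) ^ i * int (k choose i))"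
    by simp
  moreover have "(\<Sum>i\<le>Suc k. (-1) ^ i * int (k choose i)) = 1 + (\<Sum>i\<le>k. (-1) ^ Suc i * int (k choose Suc i))"
    by (simp only: sum.atMost_Suc_shift) simp
  ultimately have s: "(\<Sum>i\<le>k. (-1) ^ Suc i * int (k choose Suc i)) = -1" by linarith
  have "sphere_count 0 k = (\<Sum>i\<le>k. (-1) ^ k * ((-1) ^ Suc i * int (k choose Suc i)))"
    unfolding sphere_count_def by (intro sum.cong) (auto simp: power_add)
  also have "\<dots> = (-1) ^ k * (\<Sum>i\<le>k. (-1) ^ Suc i * int (k choose Suc i))"
    by (simp only: sum_distrib_left)
  finally show ?case using s by simp
next
  case (Suc n)
  then obtain k' where k: "k = Suc k'" and "n < k'" by (metis Suc_lessE)
  then have "sphere_count n k = (-1) ^ (n + k + 1)" "sphere_count n k' = (-1) ^ (n + k' + 1)"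
    using Suc.IH by auto
  then show ?case using k by (simp add: sphere_count_Suc algebra_simps)
qed

text \<open>In the recursion the off-diagonal value 1 contributes \<open>k\<close>, just enough to
  turn \<open>Suc k * (fact k - 1)\<close> into \<open>fact (Suc k) - 1\<close>. This is the number
  of 0-spheres in a wedge with \<open>fact (Suc k)\<close> points.\<close>

lemma sphere_count_self: "k > 0 \<Longrightarrow> sphere_count k k = fact k - 1"
proof (induction k)
  case (Suc k)
  show ?case
  proof (cases "k = 0")
    case True
    then show ?thesis using sphere_count_one[of 1] by simp
  next
    case False
    then have a: "sphere_count k k = fact k - 1" using Suc.IH by simp
    have b: "sphere_count k (Suc k) = 1" using sphere_count_less[of k "Suc k"] by simp
    show ?thesis by (simp add: sphere_count_Suc a b algebra_simps)
  qed
qed simp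

section \<open>Ordered partial partitions\<close>

abbreviation "opp \<equiv> ordered_partial_partitions"

lemma opp_le_iff: "opp_le S T \<longleftrightarrow> length S = length T \<and> (\<forall>i<length S. S ! i \<subseteq> T ! i)"
  by (simp add: opp_le_def list_all2_conv_all_nth)

lemma opp_le_refl: "opp_le S S"
  and opp_le_trans: "opp_le S T \<Longrightarrow> opp_le T U \<Longrightarrow> opp_le S U"
  and opp_le_antisym: "opp_le S T \<Longrightarrow> opp_le T S \<Longrightarrow> S = T"
proof -
  show "opp_le S T \<Longrightarrow> opp_le T S \<Longrightarrow> S = T"
    by (rule nth_equalityI) (auto simp: opp_le_iff)
qed (auto simp: opp_le_iff, blast)

lemmas opp_le_order = opp_le_refl opp_le_trans opp_le_antisym

lemma oppI:
  assumes "length S = k" "\<And>i. i < k \<Longrightarrow> S ! i \<noteq> {}" "\<And>i. i < k \<Longrightarrow> S ! i \<subseteq> {1..n}"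
    "\<And>i j x. i < k \<Longrightarrow> j < k \<Longrightarrow> x \<in> S ! i \<Longrightarrow> x \<in> S ! j \<Longrightarrow> i = j"
  shows "S \<in> opp n k"
  using assms unfolding ordered_partial_partitions_def by blast

lemma
  assumes "S \<in> opp n k"
  shows opp_length: "length S = k"
    and opp_nonempty: "i < k \<Longrightarrow> S ! i \<noteq> {}"
    and opp_subset: "i < k \<Longrightarrow> S ! i \<subseteq> {1..n}"
    and opp_disjoint: "i < k \<Longrightarrow> j < k \<Longrightarrow> x \<in> S ! i \<Longrightarrow> x \<in> S ! j \<Longrightarrow> i = j"
  using assms unfolding ordered_partial_partitions_def by blast+

lemma finite_opp: "finite (opp n k)"
proof (rule finite_subset)
  show "opp n k \<subseteq> {S. set S \<subseteq> Pow {1..n} \<and> length S = k}"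
    using opp_subset by (fastforce simp: in_set_conv_nth opp_length)
qed (rule finite_lists_length_eq, simp)

definition exhaustive :: "nat \<Rightarrow> nat \<Rightarrow> nat set list \<Rightarrow> bool" where
  "exhaustive n k S \<longleftrightarrow> (\<forall>x\<in>{1..n}. \<exists>i<k. x \<in> S ! i)"

text \<open>An element added to a part is already in some part of \<open>S\<close>, hence in that
  part of \<open>T\<close>, and disjointness of the parts of \<open>T\<close> makes it the same
  part.\<close>

lemma exhaustive_maximal:
  assumes "exhaustive n k S" "S \<in> opp n k" "T \<in> opp n k" "opp_le S T"
  shows "T = S"
proof (rule opp_le_antisym)
  show "opp_le T S"
    unfolding opp_le_iff
  proof (intro conjI allI impI subsetI)
    fix i x assume i: "i < length T" and x: "x \<in> T ! i"
    then have ik: "i < k" using opp_length[OF assms(3)] by simp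
    obtain j where j: "j < k" "x \<in> S ! j"
      using x opp_subset[OF assms(3) ik] assms(1) by (auto simp: exhaustive_def)
    then have "x \<in> T ! j" using assms(4) opp_length[OF assms(2)] by (auto simp: opp_le_iff)
    then show "x \<in> S ! i" using opp_disjoint[OF assms(3) ik j(1) x] j by simp
  qed (use assms(4) in \<open>simp add: opp_le_iff\<close>)
qed (rule assms(4))

section \<open>Forgetting a part, inserting a singleton part, adding and removing the element
  \<open>n + 1\<close>\<close>

definition delete_at :: "nat \<Rightarrow> 'a list \<Rightarrow> 'a list" where
  "delete_at i xs = map (\<lambda>j. xs ! (if j < i then j else Suc j)) [0..<length xs - 1]"

definition insert_at :: "nat \<Rightarrow> 'a \<Rightarrow> 'a list \<Rightarrow> 'a list" where
  "insert_at i a xs = map (\<lambda>j. if j < i then xs ! j else if j = i then a else xs ! (j - 1)) [0..<Suc (length xs)]"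

lemma length_delete_at: "length (delete_at i xs) = length xs - 1"
  by (simp add: delete_at_def)

lemma nth_delete_at: "j < length xs - 1 \<Longrightarrow> delete_at i xs ! j = xs ! (if j < i then j else Suc j)"
  by (simp add: delete_at_def)

lemma length_insert_at: "length (insert_at i a xs) = Suc (length xs)"
  by (simp add: insert_at_def)

lemma nth_insert_at: "j < Suc (length xs) \<Longrightarrow>
    insert_at i a xs ! j = (if j < i then xs ! j else if j = i then a else xs ! (j - 1))"
  unfolding insert_at_def by (simp del: upt_Suc)

lemma delete_insert_at: "delete_at i (insert_at i a xs) = xs"
  by (rule nth_equalityI) (auto simp: length_delete_at length_insert_at nth_delete_at nth_insert_at)

lemma insert_delete_at: "i < length xs \<Longrightarrow> insert_at i a (delete_at i xs) = xs[i := a]"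
  by (rule nth_equalityI)
    (auto simp: length_delete_at length_insert_at nth_delete_at nth_insert_at nth_list_update)

text \<open>The bound passes from \<open>m\<close> to \<open>n\<close> because, in the applications,
  the forgotten part is the only one that may contain an element beyond \<open>n\<close>.\<close>

lemma delete_at_in_opp:
  assumes S: "S \<in> opp m (Suc k)" and i: "i < Suc k" and sub: "\<And>j. j < Suc k \<Longrightarrow> j \<noteq> i \<Longrightarrow> S ! j \<subseteq> {1..n}"
  shows "delete_at i S \<in> opp n k"
proof (rule oppI)
  note len = opp_length[OF S]
  show "length (delete_at i S) = k" using len by (simp add: length_delete_at)
  fix j assume j: "j < k"
  have nth: "delete_at i S ! j = S ! (if j < i then j else Suc j)" if "j < k" for j
    using that len by (simp add: nth_delete_at)
  show "delete_at i S ! j \<noteq> {}" using j nth opp_nonempty[OF S] by auto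
  show "delete_at i S ! j \<subseteq> {1..n}" using j nth[OF j] sub[of j] sub[of "Suc j"] by auto
  show "j = l" if "l < k" "x \<in> delete_at i S ! j" "x \<in> delete_at i S ! l" for l x
  proof -
    have "(if j < i then j else Suc j) = (if l < i then l else Suc l)"
      by (rule opp_disjoint[OF S, of _ _ x]) (use that j nth in auto)
    then show ?thesis by (auto split: if_splits)
  qed
qed

lemma insert_at_in_opp:
  assumes T: "T \<in> opp n k" and i: "i < Suc k"
  shows "insert_at i {Suc n} T \<in> opp (Suc n) (Suc k)"
proof (rule oppI)
  note len = opp_length[OF T]
  show "length (insert_at i {Suc n} T) = Suc k" using len by (simp add: length_insert_at)
  fix j assume j: "j < Suc k"
  have nth: "insert_at i {Suc n} T ! j = (if j < i then T ! j else if j = i then {Suc n} else T ! (j - 1))"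
    if "j < Suc k" for j
    using that len by (simp add: nth_insert_at)
  have sub: "T ! j \<subseteq> {1..n}" if "j < k" for j using opp_subset[OF T that] .
  show "insert_at i {Suc n} T ! j \<noteq> {}" using j i nth opp_nonempty[OF T] by auto
  show "insert_at i {Suc n} T ! j \<subseteq> {1..Suc n}"
    using j i nth[OF j] sub[of j] sub[of "j - 1"] by (auto split: if_splits) fastforce+
  show "j = l" if "l < Suc k" "x \<in> insert_at i {Suc n} T ! j" "x \<in> insert_at i {Suc n} T ! l" for l x
  proof (cases "x = Suc n")
    case True
    have "l = i" if "l < Suc k" "Suc n \<in> insert_at i {Suc n} T ! l" for l
      using that nth[OF that(1)] sub[of l] sub[of "l - 1"] i by (auto split: if_splits) fastforce+
    then show ?thesis using that j True by blast
  next
    case False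
    have "j \<noteq> i" "l \<noteq> i" using that nth j False by (auto split: if_splits)
    then have "(if j < i then j else j - 1) = (if l < i then l else l - 1)"
      by (intro opp_disjoint[OF T, of _ _ x]) (use that j i nth in \<open>auto split: if_splits\<close>)
    then show ?thesis using \<open>j \<noteq> i\<close> \<open>l \<noteq> i\<close> by (auto split: if_splits)
  qed
qed

lemma opp_mono: "opp n k \<subseteq> opp (Suc n) k"
proof
  fix S assume S: "S \<in> opp n k"
  show "S \<in> opp (Suc n) k"
    using opp_length[OF S] opp_nonempty[OF S] opp_subset[OF S] opp_disjoint[OF S]
    by (intro oppI) fastforce+
qed

lemma add_in_opp:
  assumes S: "S \<in> opp (Suc n) k" and i: "i < k" and "\<And>j. j < k \<Longrightarrow> j \<noteq> i \<Longrightarrow> Suc n \<notin> S ! j"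
  shows "S[i := insert (Suc n) (S ! i)] \<in> opp (Suc n) k"
proof (rule oppI)
  note len = opp_length[OF S]
  show "length (S[i := insert (Suc n) (S ! i)]) = k" using len by simp
  fix j assume j: "j < k"
  have nth: "S[i := insert (Suc n) (S ! i)] ! j = (if j = i then insert (Suc n) (S ! i) else S ! j)" if "j < k" for j
    using that len by (simp add: nth_list_update)
  show "S[i := insert (Suc n) (S ! i)] ! j \<noteq> {}" using nth[OF j] opp_nonempty[OF S j] by auto
  show "S[i := insert (Suc n) (S ! i)] ! j \<subseteq> {1..Suc n}" using nth[OF j] opp_subset[OF S j] by auto
  show "j = l" if "l < k" "x \<in> S[i := insert (Suc n) (S ! i)] ! j" "x \<in> S[i := insert (Suc n) (S ! i)] ! l" for l x
    using that nth[OF j] nth[OF that(1)] assms(3) j opp_disjoint[OF S] by (metis insertE)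
qed

lemma remove_in_opp:
  assumes S: "S \<in> opp (Suc n) k" and i: "i < k" and "\<And>j. j < k \<Longrightarrow> j \<noteq> i \<Longrightarrow> Suc n \<notin> S ! j"
    and ne: "S ! i \<noteq> {Suc n}"
  shows "S[i := S ! i - {Suc n}] \<in> opp n k"
proof (rule oppI)
  note len = opp_length[OF S]
  show "length (S[i := S ! i - {Suc n}]) = k" using len by simp
  fix j assume j: "j < k"
  have nth: "S[i := S ! i - {Suc n}] ! j = (if j = i then S ! i - {Suc n} else S ! j)" if "j < k" for j
    using that len by (simp add: nth_list_update)
  show "S[i := S ! i - {Suc n}] ! j \<noteq> {}" using nth[OF j] opp_nonempty[OF S] ne j i by auto
  show "S[i := S ! i - {Suc n}] ! j \<subseteq> {1..n}"
  proof
    fix x assume "x \<in> S[i := S ! i - {Suc n}] ! j"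
    then have "x \<in> S ! j" "x \<noteq> Suc n" using nth[OF j] assms(3)[OF j] by (auto split: if_splits)
    then show "x \<in> {1..n}" using opp_subset[OF S j] by auto
  qed
  show "j = l" if "l < k" "x \<in> S[i := S ! i - {Suc n}] ! j" "x \<in> S[i := S ! i - {Suc n}] ! l" for l x
    using that nth[OF j] nth[OF that(1)] j opp_disjoint[OF S] by (metis DiffD1)
qed

lemma opp_notin: "S \<in> opp n k \<Longrightarrow> i < k \<Longrightarrow> Suc n \<notin> S ! i"
  using opp_subset by fastforce

subsection \<open>A contractible subposet\<close>

text \<open>The geometric realization of \<open>cylinder n k i B C\<close> is the mapping cylinder of the map from
  \<open>B\<close> to \<open>C\<close> that forgets the part with index \<open>i\<close>: the cylinder coordinate is the weight of the
  new vertex \<open>n + 1\<close> in the \<open>i\<close>-th factor.\<close>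

definition cylinder ::
    "nat \<Rightarrow> nat \<Rightarrow> nat \<Rightarrow> nat set list set \<Rightarrow> nat set list set \<Rightarrow> nat set list set" where
  "cylinder n k i B C = {S \<in> opp (Suc n) (Suc k). (\<forall>j<Suc k. j \<noteq> i \<longrightarrow> Suc n \<notin> S ! j) \<and>
     (if S ! i = {Suc n} then delete_at i S \<in> C else S[i := S ! i - {Suc n}] \<in> B)}"

text \<open>A mapping cylinder retracts to its target. Adding \<open>n + 1\<close> to the part with
  index \<open>i\<close> inflates the cylinder to the subposet \<open>E\<close> of partitions with
  \<open>n + 1\<close> in that part; shrinking this part to \<open>{Suc n}\<close> deflates
  \<open>E\<close> to a copy of \<open>C\<close>. The argument holds for any base, which is what
  permits a full one.\<close>

lemma contractible_cylinder:
  assumes i: "i < Suc k" and B: "B \<subseteq> opp n (Suc k)" and C: "C \<subseteq> opp n k"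
    and full: "\<And>T. T \<in> opp n k - C \<Longrightarrow> exhaustive n k T"
    and contr: "contractible_space (order_space C opp_le)"
  shows "contractible_space (order_space (cylinder n k i B C) opp_le)"
proof -
  let ?Z = "cylinder n k i B C"
  let ?e = "Suc n"
  let ?P = "opp (Suc n) (Suc k)"
  define E where "E = {S \<in> ?Z. ?e \<in> S ! i}"
  have fin: "finite ?Z" "finite E" "finite C"
    using finite_opp C unfolding E_def cylinder_def by (auto intro: finite_subset)
  have ZP: "S \<in> ?P" and Zj: "\<And>j. j < Suc k \<Longrightarrow> j \<noteq> i \<Longrightarrow> ?e \<notin> S ! j" if "S \<in> ?Z" for S
    using that by (auto simp: cylinder_def)
  have len: "length S = Suc k" if "S \<in> ?Z" for S using opp_length[OF ZP[OF that]] .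
  have lenC: "length T = k" if "T \<in> C" for T using that C opp_length by blast
  have "contractible_space (order_space E opp_le)"
  proof (rule contractible_order_space_transfer_down[OF fin(2,3), where f = "delete_at i" and
        g = "insert_at i {?e}" and leq' = opp_le])
    show "delete_at i ` E \<subseteq> C"
    proof (intro image_subsetI)
      fix S assume S: "S \<in> E"
      then have SZ: "S \<in> ?Z" and eS: "?e \<in> S ! i" by (auto simp: E_def)
      note SP = ZP[OF SZ]
      show "delete_at i S \<in> C"
      proof (cases "S ! i = {?e}")
        case True
        then show ?thesis using SZ by (auto simp: cylinder_def)
      next
        case False
        then obtain x where x: "x \<in> S ! i" "x \<noteq> ?e" using eS by blast
        have xn: "x \<in> {1..n}" using x opp_subset[OF SP i] by auto
        have sub: "S ! j \<subseteq> {1..n}" if "j < Suc k" "j \<noteq> i" for j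
        proof
          fix y assume y: "y \<in> S ! j"
          then have "y \<noteq> ?e" using Zj[OF SZ that] by blast
          then show "y \<in> {1..n}" using opp_subset[OF SP that(1)] y by auto
        qed
        \<comment> \<open>The forgotten part held an element \<open>x\<close> of
          \<open>{1..n}\<close> that no other part contains. By \<open>full\<close>, a partition
          missing \<open>x\<close> cannot be absent from \<open>C\<close>.\<close>
        have "\<not> exhaustive n k (delete_at i S)"
        proof
          assume "exhaustive n k (delete_at i S)"
          then obtain j where j: "j < k" "x \<in> delete_at i S ! j" using xn unfolding exhaustive_def by blast
          then have "x \<in> S ! (if j < i then j else Suc j)" using len[OF SZ] by (simp add: nth_delete_at)
          then have "i = (if j < i then j else Suc j)"
            by (intro opp_disjoint[OF SP i _ x(1)]) (use j in auto)
          then show False by (auto split: if_splits)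
        qed
        then show ?thesis using full delete_at_in_opp[OF SP i sub] by blast
      qed
    qed
    show "insert_at i {?e} ` C \<subseteq> E"
    proof (intro image_subsetI)
      fix T assume T: "T \<in> C"
      then have TP: "T \<in> opp n k" using C by blast
      have nth: "insert_at i {?e} T ! j = (if j < i then T ! j else if j = i then {?e} else T ! (j - 1))"
        if "j < Suc k" for j using that lenC[OF T] by (simp add: nth_insert_at)
      have "?e \<notin> insert_at i {?e} T ! j" if "j < Suc k" "j \<noteq> i" for j
        using nth[OF that(1)] that i opp_notin[OF TP, of j] opp_notin[OF TP, of "j - 1"] by auto
      then show "insert_at i {?e} T \<in> E"
        using insert_at_in_opp[OF TP i] nth[OF i] T by (simp add: E_def cylinder_def delete_insert_at)
    qed
    show "opp_le (delete_at i S) (delete_at i T)" if "S \<in> E" "T \<in> E" "opp_le S T" for S T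
      using that len by (auto simp: E_def opp_le_iff length_delete_at nth_delete_at)
    show "opp_le (insert_at i {?e} S) (insert_at i {?e} T)" if "S \<in> C" "T \<in> C" "opp_le S T" for S T
      using that lenC i by (auto simp: opp_le_iff length_insert_at nth_insert_at)
    show "opp_le (insert_at i {?e} (delete_at i S)) S" if "S \<in> E" for S
      using that len[of S] i by (auto simp: E_def insert_delete_at opp_le_iff nth_list_update)
  qed (use opp_le_order contr in blast)+
  then show ?thesis
  proof (rule contractible_order_space_transfer_up[OF fin(1,2), where f = "\<lambda>S. S[i := insert ?e (S ! i)]"
        and g = id and leq = opp_le and leq' = opp_le, rotated -1])
    show "(\<lambda>S. S[i := insert ?e (S ! i)]) ` ?Z \<subseteq> E"
    proof (intro image_subsetI)
      fix S assume S: "S \<in> ?Z"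
      let ?T = "S[i := insert ?e (S ! i)]"
      have TP: "?T \<in> ?P" using add_in_opp[OF ZP[OF S] i Zj[OF S]] .
      have nth: "?T ! j = (if j = i then insert ?e (S ! i) else S ! j)" if "j < Suc k" for j
        using that len[OF S] by (simp add: nth_list_update)
      show "?T \<in> E"
      proof (cases "S ! i = {?e}")
        case True
        then have "?T = S" by (metis insertI1 insert_absorb list_update_id)
        then show ?thesis using S True by (simp add: E_def)
      next
        case False
        then have "?T ! i \<noteq> {?e}" using opp_nonempty[OF ZP[OF S] i] nth[OF i] by auto
        moreover have "?T[i := ?T ! i - {?e}] = S[i := S ! i - {?e}]"
          using nth[OF i] by simp
        moreover have "S[i := S ! i - {?e}] \<in> B" using False S by (auto simp: cylinder_def)
        moreover have "?e \<notin> ?T ! j" if "j < Suc k" "j \<noteq> i" for j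
          using nth[OF that(1)] Zj[OF S that] that by simp
        ultimately show ?thesis using TP nth[OF i] by (auto simp: E_def cylinder_def)
      qed
    qed
    show "opp_le (S[i := insert ?e (S ! i)]) (T[i := insert ?e (T ! i)])"
      if "S \<in> ?Z" "T \<in> ?Z" "opp_le S T" for S T
      using that len i by (auto simp: opp_le_iff nth_list_update)
    show "opp_le S (id (S[i := insert ?e (S ! i)]))" if "S \<in> ?Z" for S
      using len[OF that] i by (auto simp: opp_le_iff nth_list_update)
  qed (use opp_le_order in \<open>auto simp: E_def\<close>)
qed

lemma subset_cylinder:
  assumes "i < Suc k" "B \<subseteq> opp n (Suc k)"
  shows "B \<subseteq> cylinder n k i B C"
proof
  fix S assume S: "S \<in> B"
  then have SP: "S \<in> opp n (Suc k)" using assms by blast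
  have "S[i := S ! i - {Suc n}] = S" using opp_notin[OF SP assms(1)] by simp
  moreover have "S ! i \<noteq> {Suc n}" using opp_notin[OF SP assms(1)] by auto
  ultimately show "S \<in> cylinder n k i B C"
    using S SP opp_notin[OF SP] opp_mono by (auto simp: cylinder_def)
qed

lemma cylinder_mono: "B \<subseteq> B' \<Longrightarrow> cylinder n k i B C \<subseteq> cylinder n k i B' C"
  by (auto simp: cylinder_def split: if_splits)

lemma mem_cylinder_base:
  assumes S: "S \<in> cylinder n k i B C" and i: "i < Suc k" and "Suc n \<notin> S ! i"
  shows "S \<in> B"
  using assms by (auto simp: cylinder_def split: if_splits)

text \<open>The space for \<open>n + 1\<close> and \<open>k + 1\<close> is the union of \<open>k + 1\<close> mapping cylinders along their
  common base. Retaining the full base only in the first of them makes the union contractible.\<close>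

definition next_core :: "nat \<Rightarrow> nat \<Rightarrow> nat \<Rightarrow> nat set list set \<Rightarrow> nat set list set \<Rightarrow> nat set list set" where
  "next_core n k m B C = cylinder n k 0 (opp n (Suc k)) C \<union> (\<Union>i\<in>{1..<m}. cylinder n k i B C)"

text \<open>Cylinders are attached one at a time. Since \<open>n + 1\<close> occurs in at most one
  part, a new cylinder meets the earlier ones only in \<open>B\<close>, which is contractible, so
  the gluing lemma applies once comparabilities across are excluded.\<close>

lemma contractible_next_core:
  assumes m: "0 < m" "m \<le> Suc k" and B: "B \<subseteq> opp n (Suc k)" "B \<noteq> {}" and C: "C \<subseteq> opp n k"
    and fullB: "\<And>T. T \<in> opp n (Suc k) - B \<Longrightarrow> exhaustive n (Suc k) T"
    and fullC: "\<And>T. T \<in> opp n k - C \<Longrightarrow> exhaustive n k T"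
    and contr: "contractible_space (order_space B opp_le)" "contractible_space (order_space C opp_le)"
  shows "contractible_space (order_space (next_core n k m B C) opp_le)"
  using m
proof (induction m rule: nat_induct_non_zero)
  case 1
  then show ?case
    using contractible_cylinder[OF _ order.refl C fullC contr(2), of 0] by (simp add: next_core_def)
next
  case (Suc m)
  let ?Q1 = "next_core n k m B C" and ?Q2 = "cylinder n k m B C"
  let ?P = "opp (Suc n) (Suc k)"
  have mk: "m < Suc k" and m0: "0 < m" using Suc by auto
  have dest: "\<exists>i X. i < Suc k \<and> i \<noteq> m \<and> (X = opp n (Suc k) \<or> X = B) \<and> S \<in> cylinder n k i X C"
    if S: "S \<in> ?Q1" for S
  proof (cases "S \<in> cylinder n k 0 (opp n (Suc k)) C")
    case True
    then show ?thesis using m0 by blast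
  next
    case False
    then obtain i where "i \<in> {1..<m}" "S \<in> cylinder n k i B C" using S unfolding next_core_def by blast
    then show ?thesis using mk by (intro exI[of _ i] exI[of _ B]) auto
  qed
  have Q1m: "Suc n \<notin> S ! m" if "S \<in> ?Q1" for S
    using dest[OF that] mk by (auto simp: cylinder_def)
  have cylP: "cylinder n k i X C \<subseteq> ?P" for i X by (auto simp: cylinder_def)
  have Q1P: "?Q1 \<subseteq> ?P" using cylP by (auto simp: next_core_def)
  have BQ1: "B \<subseteq> ?Q1"
    using subset_cylinder[of 0 k "opp n (Suc k)" n C] B(1) by (auto simp: next_core_def)
  have BQ2: "B \<subseteq> ?Q2" by (rule subset_cylinder[OF mk B(1)])
  have inter: "?Q1 \<inter> ?Q2 = B"
    using BQ1 BQ2 mem_cylinder_base[OF _ mk] Q1m by blast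
  have "contractible_space (order_space (?Q1 \<union> ?Q2) opp_le)"
  proof (rule contractible_order_space_union)
    show "finite ?Q1" "finite ?Q2" using Q1P cylP finite_opp finite_subset by metis+
    show "?Q1 \<inter> ?Q2 \<noteq> {}" using inter B(2) by simp
    show "contractible_space (order_space ?Q1 opp_le)" using Suc by simp
    show "contractible_space (order_space ?Q2 opp_le)"
      by (rule contractible_cylinder[OF mk B(1) C fullC contr(2)])
    show "contractible_space (order_space (?Q1 \<inter> ?Q2) opp_le)"
      using contr(1) inter by simp
    show "\<not> opp_le u v \<and> \<not> opp_le v u" if u: "u \<in> ?Q1 - ?Q2" and v: "v \<in> ?Q2 - ?Q1" for u v
    proof -
      have uP: "u \<in> ?P" and vP: "v \<in> ?P" using u v Q1P cylP by blast+
      have lens: "length u = Suc k" "length v = Suc k" using opp_length uP vP by auto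
      have ev: "Suc n \<in> v ! m" using mem_cylinder_base[OF _ mk] v BQ1 by blast
      have eu: "Suc n \<notin> u ! m" using Q1m u by blast
      \<comment> \<open>Below \<open>v\<close>, the partition \<open>u\<close> cannot contain
        \<open>n + 1\<close> at all, so it lies in the full base but not in \<open>B\<close> and is
        exhaustive. Dropping \<open>n + 1\<close> from \<open>v\<close> gives an element of
        \<open>B\<close> above \<open>u\<close>, which by maximality is \<open>u\<close>
        itself.\<close>
      have "\<not> opp_le u v"
      proof
        assume uv: "opp_le u v"
        have "Suc n \<notin> u ! j" if "j < Suc k" for j
          using that uv lens opp_disjoint[OF vP that mk _ ev] eu by (auto simp: opp_le_iff)
        then have "u \<in> opp n (Suc k)" using dest[of u] u mem_cylinder_base B(1) by blast
        moreover have "u \<notin> B" using u BQ2 by blast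
        ultimately have uP': "u \<in> opp n (Suc k)" and ufull: "exhaustive n (Suc k) u"
          using fullB by auto
        define w where "w = v[m := v ! m - {Suc n}]"
        have "u ! m \<subseteq> v ! m" using uv lens mk unfolding opp_le_iff by simp
        moreover have "\<not> u ! m \<subseteq> {Suc n}"
          using eu opp_nonempty[OF uP mk] by (simp add: subset_singleton_iff) auto
        ultimately have "v ! m \<noteq> {Suc n}" by metis
        then have wB: "w \<in> B" using v by (auto simp: cylinder_def w_def)
        have "opp_le u w"
          using uv eu lens mk unfolding opp_le_iff w_def by (auto simp: nth_list_update)
        then have "w = u" using exhaustive_maximal[OF ufull uP'] wB B(1) by blast
        then show False using wB \<open>u \<notin> B\<close> by simp
      qed
      moreover have "\<not> opp_le v u" using ev eu mk lens by (auto simp: opp_le_iff)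
      ultimately show ?thesis by blast
    qed
  qed (rule opp_le_refl)
  moreover have "next_core n k (Suc m) B C = ?Q1 \<union> ?Q2"
    using m0 by (auto simp: next_core_def less_Suc_eq)
  ultimately show ?case by simp
qed

text \<open>A missing partition has \<open>n + 1\<close> in exactly one part \<open>i\<close>,
  because without \<open>n + 1\<close> it would lie in the full base of the cylinder with index 0.
  If this part is larger than \<open>{Suc n}\<close>, removing \<open>n + 1\<close> gives an element
  outside \<open>B\<close>; otherwise forgetting it gives one outside \<open>C\<close>. The index 0
  is absent from the first family because its cylinder has the full base; hence the factor
  \<open>k\<close> against \<open>Suc k\<close> in the recursion.\<close>

lemma next_core_complement:
  assumes B: "B \<subseteq> opp n (Suc k)" and C: "C \<subseteq> opp n k"
  shows "opp (Suc n) (Suc k) - next_core n k (Suc k) B C =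
    (\<lambda>(i, S). S[i := insert (Suc n) (S ! i)]) ` ({1..<Suc k} \<times> (opp n (Suc k) - B)) \<union>
    (\<lambda>(i, T). insert_at i {Suc n} T) ` ({..<Suc k} \<times> (opp n k - C))"
    (is "?P - ?Q = ?A \<union> ?D")
proof (intro equalityI subsetI)
  let ?e = "Suc n"
  fix S assume S: "S \<in> ?P - ?Q"
  then have SP: "S \<in> ?P" and SQ: "S \<notin> ?Q" by auto
  note len = opp_length[OF SP]
  have "\<exists>i<Suc k. ?e \<in> S ! i"
  proof (rule ccontr)
    assume none: "\<not> ?thesis"
    then have "S ! 0 \<noteq> {?e}" by auto
    then have "S[0 := S ! 0 - {?e}] \<in> opp n (Suc k)"
      using remove_in_opp[OF SP, of 0] none by auto
    then show False using SQ SP none \<open>S ! 0 \<noteq> {?e}\<close> by (auto simp: next_core_def cylinder_def)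
  qed
  then obtain i where i: "i < Suc k" "?e \<in> S ! i" by blast
  have j: "?e \<notin> S ! j" if "j < Suc k" "j \<noteq> i" for j using opp_disjoint[OF SP _ i(1) _ i(2)] that by blast
  have cyl: "S \<notin> cylinder n k i X C" if "X = B \<or> i = 0 \<and> X = opp n (Suc k)" for X
    using SQ i that cylinder_mono[OF B, of n k 0 C] by (cases "i = 0") (auto simp: next_core_def)
  show "S \<in> ?A \<union> ?D"
  proof (cases "S ! i = {?e}")
    case True
    have "S ! j \<subseteq> {1..n}" if "j < Suc k" "j \<noteq> i" for j
    proof
      fix x assume "x \<in> S ! j"
      then show "x \<in> {1..n}" using opp_subset[OF SP that(1)] j[OF that] by (cases "x = ?e") auto
    qed
    then have "delete_at i S \<in> opp n k" by (rule delete_at_in_opp[OF SP i(1)])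
    moreover have "delete_at i S \<notin> C" using cyl[of B] SP j True by (auto simp: cylinder_def)
    moreover have "S = insert_at i {?e} (delete_at i S)"
      using insert_delete_at[of i S "{?e}"] len i True by (metis list_update_id)
    ultimately show ?thesis using i by (intro UnI2 image_eqI[of _ _ "(i, delete_at i S)"]) auto
  next
    case False
    let ?w = "S[i := S ! i - {?e}]"
    have w: "?w \<in> opp n (Suc k)" by (rule remove_in_opp[OF SP i(1) j False])
    then have "i \<noteq> 0" using cyl[of "opp n (Suc k)"] SP j False by (auto simp: cylinder_def)
    moreover have "?w \<notin> B" using cyl[of B] SP j False by (auto simp: cylinder_def)
    moreover have "S = ?w[i := insert ?e (?w ! i)]"
      using i len by (simp add: insert_absorb)
    ultimately show ?thesis using i w by (intro UnI1 image_eqI[of _ _ "(i, ?w)"]) auto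
  qed
next
  let ?e = "Suc n"
  have notin: "S \<notin> ?Q" if "i < Suc k" "?e \<in> S ! i"
    "\<And>X. X = B \<or> i = 0 \<and> X = opp n (Suc k) \<Longrightarrow> S \<notin> cylinder n k i X C" for i S
  proof
    assume "S \<in> ?Q"
    then consider "S \<in> cylinder n k 0 (opp n (Suc k)) C" | l where "l \<in> {1..<Suc k}" "S \<in> cylinder n k l B C"
      by (auto simp: next_core_def)
    then show False
    proof cases
      case 1
      then have "i = 0" using that(1,2) by (auto simp: cylinder_def)
      then show False using 1 that(3) by blast
    next
      case 2
      then have "i = l" using that(1,2) by (auto simp: cylinder_def)
      then show False using 2 that(3) by blast
    qed
  qed
  fix S assume "S \<in> ?A \<union> ?D"
  then show "S \<in> ?P - ?Q"
  proof
    assume "S \<in> ?A"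
    then obtain i w where i: "i \<in> {1..<Suc k}" and w: "w \<in> opp n (Suc k)" "w \<notin> B"
      and S: "S = w[i := insert ?e (w ! i)]" by auto
    have ik: "i < Suc k" using i by auto
    have nth: "S ! i = insert ?e (w ! i)" using S opp_length[OF w(1)] ik by simp
    have "w ! i - {?e} = w ! i" using opp_notin[OF w(1) ik] by simp
    then have "S[i := S ! i - {?e}] = w" using nth S by simp
    moreover have "\<not> w ! i \<subseteq> {?e}"
      using opp_nonempty[OF w(1) ik] opp_notin[OF w(1) ik] by (simp add: subset_singleton_iff) auto
    then have "S ! i \<noteq> {?e}" using nth by (metis subset_insertI)
    ultimately have "S \<notin> cylinder n k i B C" using w(2) \<open>S ! i \<noteq> {?e}\<close> by (auto simp: cylinder_def)
    moreover have "S \<in> ?P"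
      unfolding S by (rule add_in_opp) (use w opp_mono ik opp_notin[OF w(1)] in blast)+
    ultimately show ?thesis using notin[OF ik, of S] nth i by auto
  next
    assume "S \<in> ?D"
    then obtain i T where i: "i < Suc k" and T: "T \<in> opp n k" "T \<notin> C"
      and S: "S = insert_at i {?e} T" by auto
    have "S ! i = {?e}" using S opp_length[OF T(1)] i by (simp add: nth_insert_at)
    moreover have "delete_at i S = T" using S by (simp add: delete_insert_at)
    ultimately show ?thesis
      using notin[OF i, of S] insert_at_in_opp[OF T(1) i] T(2) S by (auto simp: cylinder_def)
  qed
qed

text \<open>The index is recovered as the place of \<open>n + 1\<close>, the rest by removing it or
  by forgetting its part; whether \<open>n + 1\<close> stands alone separates the two
  families.\<close>

lemma card_next_core_complement:
  assumes B: "B \<subseteq> opp n (Suc k)" and C: "C \<subseteq> opp n k"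
  shows "card (opp (Suc n) (Suc k) - next_core n k (Suc k) B C) =
    k * card (opp n (Suc k) - B) + Suc k * card (opp n k - C)"
proof -
  let ?e = "Suc n"
  let ?f = "\<lambda>(i, S). S[i := insert ?e (S ! i)]" and ?g = "\<lambda>(i, T). insert_at i {?e} T"
  let ?M = "{1..<Suc k} \<times> (opp n (Suc k) - B)" and ?N = "{..<Suc k} \<times> (opp n k - C)"
  have f: "?e \<in> S ! i \<and> S ! i \<noteq> {?e} \<and> S[i := S ! i - {?e}] = w \<and> (\<forall>j<Suc k. j \<noteq> i \<longrightarrow> ?e \<notin> S ! j)"
    if "i < Suc k" "w \<in> opp n (Suc k)" "S = w[i := insert ?e (w ! i)]" for i w S
  proof -
    have "S ! i = insert ?e (w ! i)" using that opp_length[OF that(2)] by simp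
    moreover have "w ! i - {?e} = w ! i" using opp_notin[OF that(2,1)] by simp
    ultimately show ?thesis
      using that opp_notin[OF that(2)] opp_nonempty[OF that(2,1)] opp_length[OF that(2)]
      by (auto simp: nth_list_update)
  qed
  have g: "S ! i = {?e} \<and> delete_at i S = T \<and> (\<forall>j<Suc k. j \<noteq> i \<longrightarrow> ?e \<notin> S ! j)"
    if "i < Suc k" "T \<in> opp n k" "S = insert_at i {?e} T" for i T S
    using that opp_length[OF that(2)] opp_notin[OF that(2)]
    by (auto simp: delete_insert_at nth_insert_at)
  have "inj_on ?f ?M"
  proof (rule inj_onI, clarsimp)
    fix i w j w' assume a: "Suc 0 \<le> i" "i < Suc k" "w \<in> opp n (Suc k)" "Suc 0 \<le> j" "j < Suc k"
      "w' \<in> opp n (Suc k)" "w[i := insert ?e (w ! i)] = w'[j := insert ?e (w' ! j)]"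
    show "i = j \<and> w = w'"
      using f[OF a(2,3) refl] f[OF a(5,6) a(7)] a(2) by metis
  qed
  moreover have "inj_on ?g ?N"
  proof (rule inj_onI, clarsimp)
    fix i w j w' assume a: "i < Suc k" "w \<in> opp n k" "j < Suc k"
      "w' \<in> opp n k" "insert_at i {?e} w = insert_at j {?e} w'"
    show "i = j \<and> w = w'"
      using g[OF a(1,2) refl] g[OF a(3,4) a(5)] a(1) by (metis insertI1)
  qed
  moreover have "?f ` ?M \<inter> ?g ` ?N = {}"
  proof (rule ccontr)
    assume "?f ` ?M \<inter> ?g ` ?N \<noteq> {}"
    then obtain S where S: "S \<in> ?f ` ?M" "S \<in> ?g ` ?N" by blast
    obtain i w where a: "i < Suc k" "w \<in> opp n (Suc k)" "S = w[i := insert ?e (w ! i)]" using S(1) by auto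
    obtain j T where b: "j < Suc k" "T \<in> opp n k" "S = insert_at j {?e} T" using S(2) by auto
    show False using f[OF a] g[OF b] a(1) by metis
  qed
  moreover have "finite ?M" "finite ?N" using finite_opp by auto
  ultimately show ?thesis
    unfolding next_core_complement[OF B C]
    by (subst card_Un_disjoint) (auto simp: card_image card_cartesian_product)
qed

section \<open>As many parts as elements: permutations\<close>

lemma opp_diagonal:
  assumes "S \<in> opp n n"
  obtains xs where "length xs = n" "distinct xs" "set xs = {1..n}" "S = map (\<lambda>x. {x}) xs"
proof -
  define xs where "xs = map (\<lambda>A. SOME a. a \<in> A) S"
  note len = opp_length[OF assms]
  have nth: "xs ! i \<in> S ! i" if "i < n" for i
    using opp_nonempty[OF assms that] that len by (auto simp: xs_def some_in_eq)
  have lx: "length xs = n" using len by (simp add: xs_def)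
  have dist: "distinct xs"
    unfolding distinct_conv_nth lx using nth opp_disjoint[OF assms] by metis
  have "set xs \<subseteq> {1..n}" using nth opp_subset[OF assms] lx by (fastforce simp: in_set_conv_nth)
  moreover have "card (set xs) = n" using dist lx by (simp add: distinct_card)
  ultimately have set: "set xs = {1..n}" by (intro card_subset_eq) auto
  \<comment> \<open>The representatives use up all of \<open>{1..n}\<close>, so a second element of
    a part would already represent another part.\<close>
  have "S ! i = {xs ! i}" if i: "i < n" for i
  proof -
    have "x = xs ! i" if x: "x \<in> S ! i" for x
    proof -
      have "x \<in> set xs" using set x opp_subset[OF assms i] by blast
      then obtain j where "j < n" "x = xs ! j" using lx by (auto simp: in_set_conv_nth)
      then show ?thesis using opp_disjoint[OF assms i _ x] nth by blast
    qed
    then show ?thesis using nth[OF i] by blast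
  qed
  then have "S = map (\<lambda>x. {x}) xs" by (intro nth_equalityI) (auto simp: len lx)
  then show thesis using that lx dist set by blast
qed

lemma exhaustive_diagonal:
  assumes "S \<in> opp n n"
  shows "exhaustive n n S"
proof -
  obtain xs where xs: "length xs = n" "set xs = {1..n}" "S = map (\<lambda>x. {x}) xs"
    using opp_diagonal[OF assms] by metis
  show ?thesis
    unfolding exhaustive_def
  proof
    fix x assume "x \<in> {1..n}"
    then show "\<exists>i<n. x \<in> S ! i" using xs by (metis in_set_conv_nth nth_map singletonI)
  qed
qed

lemma card_opp_diagonal: "card (opp n n) = fact n"
proof -
  have "opp n n = map (\<lambda>x. {x}) ` {xs. length xs = n \<and> distinct xs \<and> set xs \<subseteq> {1..n}}"
  proof (intro equalityI subsetI)
    fix S assume "S \<in> opp n n"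
    then obtain xs where "length xs = n" "distinct xs" "set xs = {1..n}" "S = map (\<lambda>x. {x}) xs"
      by (rule opp_diagonal)
    then show "S \<in> map (\<lambda>x. {x}) ` {xs. length xs = n \<and> distinct xs \<and> set xs \<subseteq> {1..n}}" by blast
  next
    fix S assume "S \<in> map (\<lambda>x. {x}) ` {xs. length xs = n \<and> distinct xs \<and> set xs \<subseteq> {1..n}}"
    then obtain xs where xs: "length xs = n" "distinct xs" "set xs \<subseteq> {1..n}" "S = map (\<lambda>x. {x}) xs" by blast
    show "S \<in> opp n n"
    proof (rule oppI)
      show "S ! i \<subseteq> {1..n}" if "i < n" for i
      proof -
        have "xs ! i \<in> {1..n}" using xs that nth_mem by blast
        then show ?thesis using xs that by simp
      qed
      show "i = j" if "i < n" "j < n" "x \<in> S ! i" "x \<in> S ! j" for i j x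
        using xs that by (auto simp: nth_eq_iff_index_eq)
    qed (use xs in auto)
  qed
  moreover have "inj_on (map (\<lambda>x. {x})) {xs :: nat list. length xs = n \<and> distinct xs \<and> set xs \<subseteq> {1..n}}"
    by (rule inj_onI) (auto simp: inj_on_def intro!: map_inj_on[of "\<lambda>x. {x}"])
  moreover have "card {xs :: nat list. length xs = n \<and> distinct xs \<and> set xs \<subseteq> {1..n}} = fact n"
    using card_lists_distinct_length_eq[of "{1..n}" n] by (simp add: fact_prod)
  ultimately show ?thesis by (simp add: card_image)
qed

text \<open>The recursion needs both \<open>k\<close> and \<open>k - 1\<close> in the range of the
  induction hypothesis, which leaves two boundary cases. For \<open>k = 1\<close> the whole poset
  has a top and nothing is removed; on the diagonal all but one of the isolated points are removed.
  Nonemptiness is carried along because gluing needs a point in the intersection.\<close>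

lemma contractible_core_exists:
  assumes "1 \<le> k" "k \<le> n"
  shows "\<exists>Q. Q \<subseteq> opp n k \<and> Q \<noteq> {} \<and> contractible_space (order_space Q opp_le) \<and>
    (\<forall>S\<in>opp n k - Q. exhaustive n k S) \<and> int (card (opp n k - Q)) = sphere_count n k"
  using assms
proof (induction n arbitrary: k)
  case 0
  then show ?case by simp
next
  case (Suc n)
  consider "k = 1" | "k = Suc n" | k' where "k = Suc k'" "1 \<le> k'" "k \<le> n"
    using Suc.prems by (metis One_nat_def Suc_le_D le_SucE le_zero_eq not_less_eq_eq)
  then show ?case
  proof cases
    case 1
    have "contractible_space (order_space (opp (Suc n) 1) opp_le)"
    proof (rule contractible_order_space_top[OF finite_opp])
      show "[{1..Suc n}] \<in> opp (Suc n) 1" by (rule oppI) auto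
      show "opp_le S [{1..Suc n}]" if "S \<in> opp (Suc n) 1" for S
        using opp_length[OF that] opp_subset[OF that, of 0] by (simp add: opp_le_iff)
    qed (use opp_le_order in blast)+
    moreover have "[{1..Suc n}] \<in> opp (Suc n) 1" by (rule oppI) auto
    ultimately show ?thesis using 1 sphere_count_one[of "Suc n"]
      by (intro exI[of _ "opp (Suc n) 1"]) auto
  next
    case 2
    have "card (opp (Suc n) (Suc n)) \<noteq> 0" by (simp add: card_opp_diagonal del: fact_Suc)
    then obtain S where S: "S \<in> opp (Suc n) (Suc n)" by fastforce
    have "contractible_space (order_space {S} opp_le)"
      by (rule contractible_order_space_top[where a = S]) (use opp_le_order in blast)+
    moreover have "int (card (opp (Suc n) (Suc n) - {S})) = sphere_count (Suc n) (Suc n)"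
    proof -
      have "card (opp (Suc n) (Suc n) - {S}) = fact (Suc n) - 1"
        using S finite_opp by (simp add: card_Diff_singleton card_opp_diagonal del: fact_Suc)
      then show ?thesis using sphere_count_self[of "Suc n"] by (simp add: of_nat_diff del: fact_Suc)
    qed
    ultimately show ?thesis using 2 S exhaustive_diagonal
      by (intro exI[of _ "{S}"]) blast
  next
    case 3
    then have "k' \<le> n" "1 \<le> k" by auto
    obtain B where B: "B \<subseteq> opp n (Suc k')" "B \<noteq> {}" "contractible_space (order_space B opp_le)"
      "\<And>S. S \<in> opp n (Suc k') - B \<Longrightarrow> exhaustive n (Suc k') S"
      "int (card (opp n (Suc k') - B)) = sphere_count n (Suc k')"
      using Suc.IH[OF \<open>1 \<le> k\<close> 3(3)] 3(1) by blast
    obtain C where C: "C \<subseteq> opp n k'" "C \<noteq> {}" "contractible_space (order_space C opp_le)"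
      "\<And>S. S \<in> opp n k' - C \<Longrightarrow> exhaustive n k' S"
      "int (card (opp n k' - C)) = sphere_count n k'"
      using Suc.IH[OF 3(2) \<open>k' \<le> n\<close>] by blast
    let ?Q = "next_core n k' (Suc k') B C"
    have sub: "?Q \<subseteq> opp (Suc n) k"
      unfolding next_core_def cylinder_def 3(1) by blast
    have "B \<subseteq> ?Q"
      using subset_cylinder[of 0 k' "opp n (Suc k')" n C] B(1) by (auto simp: next_core_def)
    then have ne: "?Q \<noteq> {}" using B(2) by blast
    have contr: "contractible_space (order_space ?Q opp_le)"
      by (rule contractible_next_core[OF _ _ B(1,2) C(1) B(4) C(4) B(3) C(3)]) auto
    have ex: "exhaustive (Suc n) k S" if "S \<in> opp (Suc n) k - ?Q" for S
    proof -
      have "(\<exists>i w. i < k \<and> w \<in> opp n k - B \<and> S = w[i := insert (Suc n) (w ! i)]) \<or>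
        (\<exists>i T. i < k \<and> T \<in> opp n k' - C \<and> S = insert_at i {Suc n} T)"
        using that unfolding 3(1) next_core_complement[OF B(1) C(1)] by (elim UnE) auto
      then consider i w where "i < k" "w \<in> opp n k - B" "S = w[i := insert (Suc n) (w ! i)]"
        | i T where "i < k" "T \<in> opp n k' - C" "S = insert_at i {Suc n} T"
        by blast
      then show ?thesis
      proof cases
        case (1 i w)
        then have len: "length w = k" and w: "exhaustive n k w" using B(4) opp_length 3(1) by auto
        show ?thesis
          unfolding exhaustive_def
        proof
          fix x assume "x \<in> {1..Suc n}"
          then consider "x = Suc n" | "x \<in> {1..n}" by fastforce
          then show "\<exists>j<k. x \<in> S ! j"
          proof cases
            case 2
            then obtain j where "j < k" "x \<in> w ! j" using w unfolding exhaustive_def by blast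
            then show ?thesis using 1 len by (intro exI[of _ j]) (auto simp: nth_list_update)
          qed (use 1 len in auto)
        qed
      next
        case (2 i T)
        then have len: "length T = k'" and T: "exhaustive n k' T" using C(4) opp_length by auto
        have nth: "S ! j = (if j < i then T ! j else if j = i then {Suc n} else T ! (j - 1))" if "j < k" for j
          using that 2 len 3(1) by (simp add: nth_insert_at)
        show ?thesis
          unfolding exhaustive_def
        proof
          fix x assume "x \<in> {1..Suc n}"
          then consider "x = Suc n" | "x \<in> {1..n}" by fastforce
          then show "\<exists>j<k. x \<in> S ! j"
          proof cases
            case 1
            then show ?thesis using 2 nth[of i] by auto
          next
            assume "x \<in> {1..n}"
            then obtain j where j: "j < k'" "x \<in> T ! j" using T unfolding exhaustive_def by blast
            then show ?thesis using nth[of j] nth[of "Suc j"] 3(1)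
              by (cases "j < i") (auto intro: exI[of _ j] exI[of _ "Suc j"])
          qed
        qed
      qed
    qed
    have "int (card (opp (Suc n) k - ?Q)) = sphere_count (Suc n) k"
      unfolding 3(1) card_next_core_complement[OF B(1) C(1)] sphere_count_Suc
      using B(5) C(5) by (simp add: algebra_simps)
    then show ?thesis using sub ne contr ex by blast
  qed
qed

section \<open>Euler characteristic\<close>

lemma hom_finprod_comm_group:
  assumes G: "comm_group G" and H: "comm_group H" and h: "h \<in> hom G H"
    and "finite S" "f \<in> S \<rightarrow> carrier G"
  shows "h (finprod G f S) = finprod H (\<lambda>x. h (f x)) S"
  using assms(4,5)
proof (induction S rule: finite_induct)
  case empty
  interpret G: comm_group G by (rule G)
  interpret H: comm_group H by (rule H)
  show ?case using hom_one[OF h G.group_axioms H.group_axioms] by simp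
next
  case (insert a S)
  interpret G: comm_group G by (rule G)
  interpret H: comm_group H by (rule H)
  have "(\<lambda>x. h (f x)) \<in> S \<rightarrow> carrier H" "h (f a) \<in> carrier H"
    using insert.prems hom_in_carrier[OF h] by auto
  then show ?case using insert by (simp add: hom_mult[OF h])
qed

text \<open>A relation with coefficients \<open>c\<close> among the images pulls back to a relation
  with coefficients \<open>c \<circ> h\<close>.\<close>

lemma int_independent_iso_image:
  assumes G: "comm_group G" and H: "comm_group H" and h: "h \<in> iso G H" and S: "int_independent G S"
  shows "int_independent H (h ` S)" "card (h ` S) = card S"
proof -
  interpret G: comm_group G by (rule G)
  interpret H: comm_group H by (rule H)
  have hom: "h \<in> hom G H" and bij: "bij_betw h (carrier G) (carrier H)"
    using h by (auto simp: iso_def)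
  have fin: "finite S" and sub: "S \<subseteq> carrier G" using S by (auto simp: int_independent_def)
  have inj: "inj_on h S" using bij sub by (meson bij_betw_def inj_on_subset)
  then show "card (h ` S) = card S" by (rule card_image)
  have hS: "h ` S \<subseteq> carrier H" using bij sub by (auto simp: bij_betw_def)
  show "int_independent H (h ` S)"
    unfolding int_independent_def
  proof (intro conjI allI impI)
    fix c :: "'c \<Rightarrow> int"
    assume one: "finprod H (\<lambda>y. y [^]\<^bsub>H\<^esub> c y) (h ` S) = \<one>\<^bsub>H\<^esub>"
    have "h (finprod G (\<lambda>x. x [^]\<^bsub>G\<^esub> c (h x)) S) = finprod H (\<lambda>x. h (x [^]\<^bsub>G\<^esub> c (h x))) S"
      using sub by (intro hom_finprod_comm_group[OF G H hom fin]) auto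
    also have "\<dots> = finprod H (\<lambda>x. h x [^]\<^bsub>H\<^esub> c (h x)) S"
      using sub hom_int_pow[OF hom _ G.group_axioms H.group_axioms] hS
      by (intro H.finprod_cong') auto
    also have "\<dots> = finprod H (\<lambda>y. y [^]\<^bsub>H\<^esub> c y) (h ` S)"
      using hS by (intro H.finprod_reindex[symmetric] inj) auto
    finally have "h (finprod G (\<lambda>x. x [^]\<^bsub>G\<^esub> c (h x)) S) = h \<one>\<^bsub>G\<^esub>"
      using one hom_one[OF hom G.group_axioms H.group_axioms] by simp
    moreover have "finprod G (\<lambda>x. x [^]\<^bsub>G\<^esub> c (h x)) S \<in> carrier G"
      using sub by (intro G.finprod_closed) auto
    ultimately have "finprod G (\<lambda>x. x [^]\<^bsub>G\<^esub> c (h x)) S = \<one>\<^bsub>G\<^esub>"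
      using bij by (auto simp: bij_betw_def inj_on_def)
    then show "\<forall>y\<in>h ` S. c y = 0"
      using S unfolding int_independent_def by (auto dest: spec[of _ "\<lambda>x. c (h x)"])
  qed (use fin hS in auto)
qed

lemma abelian_rank_iso:
  assumes G: "comm_group G" and H: "comm_group H" and "G \<cong> H"
  shows "abelian_rank G = abelian_rank H"
proof -
  obtain h where h: "h \<in> iso G H" using assms by (auto simp: is_iso_def)
  interpret G: comm_group G by (rule G)
  obtain g where g: "g \<in> iso H G" using G.iso_set_sym[OF h] by blast
  have "{card S | S. int_independent G S} = {card S | S. int_independent H S}"
    using int_independent_iso_image[OF G H h] int_independent_iso_image[OF H G g] by (safe; metis)
  then show ?thesis by (simp add: abelian_rank_def)
qed

lemma euler_characteristic_homotopy_invariant: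
  assumes "X homotopy_equivalent_space Y"
  shows "euler_characteristic X = euler_characteristic Y"
proof -
  have "betti_number p X = betti_number p Y" for p
    unfolding betti_number_def
    by (rule abelian_rank_iso[OF abelian_homology_group abelian_homology_group
          homotopy_equivalent_space_imp_isomorphic_homology_groups[OF assms]])
  then show ?thesis by (simp add: euler_characteristic_def)
qed

section \<open>The discretized configuration space of a simplex\<close>

text \<open>With all vertices declared comparable every finite set is a chain, so the results on
  \<open>order_space\<close> apply to the simplex.\<close>

lemma full_simplex_eq: "full_simplex V = order_complex V (\<lambda>_ _. True)"
  by (auto simp: full_simplex_def order_complex_def)

lemma topspace_full_simplex:
  assumes "finite V"
  shows "x \<in> topspace (realization (full_simplex V)) \<longleftrightarrow>
    (\<forall>v. 0 \<le> x v) \<and> (\<forall>v. v \<notin> V \<longrightarrow> x v = 0) \<and> sum x V = 1"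
  using topspace_order_space[OF assms, of x "\<lambda>_ _. True"] by (simp add: full_simplex_eq)

lemma continuous_map_into_full_simplex:
  "continuous_map X (realization (full_simplex V)) f \<longleftrightarrow>
     (\<forall>v. continuous_map X euclideanreal (\<lambda>x. f x v)) \<and>
     f \<in> topspace X \<rightarrow> topspace (realization (full_simplex V))"
  using continuous_map_into_order_space[of X V "\<lambda>_ _. True" f] by (simp add: full_simplex_eq)

text \<open>On the segment from the vertex \<open>v\<close> to the barycentre of the face, every
  point except the start has full support \<open>\<sigma>\<close>.\<close>

lemma vertex_in_closure_open_cell:
  assumes fin: "finite V" and s: "\<sigma> \<in> full_simplex V" and v: "v \<in> \<sigma>"
  shows "(\<lambda>w. if w = v then 1 else 0) \<in> realization (full_simplex V) closure_of open_cell (full_simplex V) \<sigma>"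
proof -
  let ?X = "realization (full_simplex V)"
  define b :: "'a \<Rightarrow> real" where "b = (\<lambda>w. if w \<in> \<sigma> then 1 / card \<sigma> else 0)"
  define e :: "'a \<Rightarrow> real" where "e = (\<lambda>w. if w = v then 1 else 0)"
  define \<gamma> where "\<gamma> t = (\<lambda>w. (1 - t) * e w + t * b w)" for t
  have \<sigma>: "finite \<sigma>" "\<sigma> \<subseteq> V" "\<sigma> \<noteq> {}" using s by (auto simp: full_simplex_def)
  have "sum b V = (\<Sum>w\<in>\<sigma>. 1 / card \<sigma>)"
    unfolding b_def using \<sigma> fin by (subst sum.inter_restrict[symmetric]) (auto intro: sum.cong simp: Int_absorb1)
  then have sb: "sum b V = 1" using \<sigma> by simp
  have se: "sum e V = 1" using v \<sigma> fin by (auto simp: e_def)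
  have e0: "e w = 0" if "w \<notin> \<sigma>" for w using that v by (auto simp: e_def)
  have b0: "b w = 0" if "w \<notin> \<sigma>" for w using that by (simp add: b_def)
  have bp: "b w > 0" if "w \<in> \<sigma>" for w using that \<sigma> by (simp add: b_def card_gt_0_iff)
  have en: "0 \<le> e w" for w by (simp add: e_def)
  have bn: "0 \<le> b w" for w by (simp add: b_def)
  have \<gamma>X: "\<gamma> t \<in> topspace ?X" if "t \<in> {0..1}" for t
    unfolding topspace_full_simplex[OF fin] \<gamma>_def
  proof (intro conjI allI impI)
    show "0 \<le> (1 - t) * e w + t * b w" for w using that en bn by simp
    show "(1 - t) * e w + t * b w = 0" if "w \<notin> V" for w
    proof -
      have "w \<notin> \<sigma>" using that \<sigma> by blast
      then show ?thesis using e0 b0 by simp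
    qed
    show "(\<Sum>w\<in>V. (1 - t) * e w + t * b w) = 1"
      using sb se by (simp add: sum.distrib flip: sum_distrib_left)
  qed
  have cont: "continuous_map (top_of_set {0..1}) ?X \<gamma>"
    unfolding continuous_map_into_full_simplex
  proof (intro conjI allI)
    show "continuous_map (top_of_set {0..1}) euclideanreal (\<lambda>t. \<gamma> t w)" for w
      unfolding \<gamma>_def by (auto intro!: continuous_intros)
  qed (use \<gamma>X in auto)
  have "\<gamma> t \<in> open_cell (full_simplex V) \<sigma>" if t: "t \<in> {0<..1}" for t
  proof -
    have "\<gamma> t w \<noteq> 0" if "w \<in> \<sigma>" for w
    proof -
      have "0 \<le> (1 - t) * e w" using t en by simp
      moreover have "0 < t * b w" using t bp[OF that] by simp
      ultimately show ?thesis by (simp add: \<gamma>_def)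
    qed
    moreover have "\<gamma> t w = 0" if "w \<notin> \<sigma>" for w using e0[OF that] b0[OF that] by (simp add: \<gamma>_def)
    ultimately have "{w. \<gamma> t w \<noteq> 0} = \<sigma>" by blast
    then show ?thesis using \<gamma>X t by (simp add: open_cell_def)
  qed
  then have sub: "?X closure_of \<gamma> ` {0<..1} \<subseteq> ?X closure_of open_cell (full_simplex V) \<sigma>"
    by (intro closure_of_mono) blast
  have "(0::real) \<in> top_of_set {0..1} closure_of {0<..1}"
    by (simp add: closure_of_subtopology Int_absorb1 greaterThanAtMost_subseteq_atLeastAtMost_iff)
  then have "\<gamma> 0 \<in> ?X closure_of \<gamma> ` {0<..1}"
    using continuous_map_image_closure_subset[OF cont, of "{0<..1}"] by blast
  moreover have "\<gamma> 0 = (\<lambda>w. if w = v then 1 else 0)" by (simp add: \<gamma>_def e_def)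
  ultimately show ?thesis using sub by auto
qed

text \<open>Vanishing of the coordinate \<open>v\<close> is a closed condition.\<close>

lemma closure_open_cell_subset:
  assumes "x \<in> realization (full_simplex V) closure_of open_cell (full_simplex V) \<sigma>" and fin: "finite V"
    and v: "x v \<noteq> 0"
  shows "v \<in> \<sigma>"
proof (rule ccontr)
  let ?X = "realization (full_simplex V)"
  assume "v \<notin> \<sigma>"
  have "continuous_map ?X euclideanreal (\<lambda>x. x v)"
    unfolding full_simplex_eq by (rule continuous_map_order_space_coordinate)
  then have "closedin ?X {x \<in> topspace ?X. x v \<in> {0}}"
    by (rule closedin_continuous_map_preimage) auto
  moreover have "open_cell (full_simplex V) \<sigma> \<subseteq> {x \<in> topspace ?X. x v \<in> {0}}"
    using \<open>v \<notin> \<sigma>\<close> by (auto simp: open_cell_def)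
  ultimately have "?X closure_of open_cell (full_simplex V) \<sigma> \<subseteq> {x \<in> topspace ?X. x v \<in> {0}}"
    by (rule closure_of_minimal[rotated])
  then show False using assms by auto
qed

text \<open>A common vertex lies in both closures, and a common point of the closures has its
  support in both faces.\<close>

lemma closure_open_cell_disjoint_iff:
  assumes fin: "finite V" and "\<sigma> \<in> full_simplex V" "\<tau> \<in> full_simplex V"
  shows "(realization (full_simplex V) closure_of open_cell (full_simplex V) \<sigma>) \<inter>
      (realization (full_simplex V) closure_of open_cell (full_simplex V) \<tau>) = {} \<longleftrightarrow> \<sigma> \<inter> \<tau> = {}"
    (is "?A \<inter> ?B = {} \<longleftrightarrow> _")
proof
  assume "?A \<inter> ?B = {}"
  then show "\<sigma> \<inter> \<tau> = {}"
    using vertex_in_closure_open_cell[OF fin assms(2)] vertex_in_closure_open_cell[OF fin assms(3)] by blast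
next
  assume disj: "\<sigma> \<inter> \<tau> = {}"
  show "?A \<inter> ?B = {}"
  proof (rule ccontr)
    assume "?A \<inter> ?B \<noteq> {}"
    then obtain x where x: "x \<in> ?A" "x \<in> ?B" by blast
    then have "x \<in> topspace (realization (full_simplex V))" using in_closure_of by metis
    then have "sum x V = 1" using topspace_full_simplex[OF fin] by blast
    then obtain v where "x v \<noteq> 0" by (metis sum.neutral zero_neq_one)
    then show False
      using closure_open_cell_subset[OF x(1) fin] closure_open_cell_subset[OF x(2) fin] disj by blast
  qed
qed

text \<open>A point determines its cells: \<open>\<sigma> i\<close> must be the support of
  \<open>y i\<close>. Disjointness of closures thereby becomes disjointness of supports.\<close>

lemma topspace_discretized_configuration_space:
  assumes fin: "finite V"
  shows "y \<in> topspace (discretized_configuration_space k (full_simplex V)) \<longleftrightarrow>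
    y \<in> extensional {..<k} \<and> (\<forall>i<k. y i \<in> topspace (realization (full_simplex V))) \<and>
    (\<forall>i<k. \<forall>j<k. \<forall>v. y i v \<noteq> 0 \<longrightarrow> y j v \<noteq> 0 \<longrightarrow> i = j)" (is "?L \<longleftrightarrow> ?R")
proof
  let ?K = "full_simplex V"
  assume ?L
  let ?F = "{\<sigma>. (\<forall>i<k. \<sigma> i \<in> ?K) \<and> (\<forall>i<k. \<forall>j<k. i \<noteq> j \<longrightarrow>
      (realization ?K closure_of open_cell ?K (\<sigma> i)) \<inter> (realization ?K closure_of open_cell ?K (\<sigma> j)) = {})}"
  from \<open>?L\<close> have yP: "y \<in> (\<Pi>\<^sub>E i\<in>{..<k}. topspace (realization ?K))"
    and yU: "y \<in> (\<Union>\<sigma>\<in>?F. \<Pi>\<^sub>E i\<in>{..<k}. open_cell ?K (\<sigma> i))"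
    unfolding discretized_configuration_space_def topspace_subtopology topspace_product_topology
    by simp_all
  obtain \<sigma> where F: "\<sigma> \<in> ?F" and yc: "y \<in> (\<Pi>\<^sub>E i\<in>{..<k}. open_cell ?K (\<sigma> i))"
    using yU by (rule UN_E)
  have y: "y \<in> extensional {..<k}" "\<And>i. i < k \<Longrightarrow> y i \<in> topspace (realization ?K)"
    using yP by (auto simp: PiE_iff)
  have \<sigma>: "\<And>i. i < k \<Longrightarrow> \<sigma> i \<in> ?K"
    and disj: "\<And>i j. i < k \<Longrightarrow> j < k \<Longrightarrow> i \<noteq> j \<Longrightarrow>
      (realization ?K closure_of open_cell ?K (\<sigma> i)) \<inter> (realization ?K closure_of open_cell ?K (\<sigma> j)) = {}"
    using F by simp_all
  have cell: "\<And>i. i < k \<Longrightarrow> y i \<in> open_cell ?K (\<sigma> i)"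
    using yc by (auto simp: PiE_iff)
  have "i = j" if "i < k" "j < k" "y i v \<noteq> 0" "y j v \<noteq> 0" for i j v
  proof (rule ccontr)
    assume "i \<noteq> j"
    then have "\<sigma> i \<inter> \<sigma> j = {}"
      using disj[OF that(1,2)] closure_open_cell_disjoint_iff[OF fin \<sigma> \<sigma>, OF that(1,2)] by simp
    moreover have "v \<in> \<sigma> i" "v \<in> \<sigma> j" using cell that by (auto simp: open_cell_def)
    ultimately show False by blast
  qed
  then show ?R using y by blast
next
  let ?K = "full_simplex V"
  assume R: ?R
  define \<sigma> where "\<sigma> i = {v. y i v \<noteq> 0}" for i
  have cell: "y i \<in> open_cell ?K (\<sigma> i)" if "i < k" for i
    using R that by (simp add: open_cell_def \<sigma>_def)
  have K: "\<sigma> i \<in> ?K" if "i < k" for i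
  proof -
    have "\<sigma> i \<subseteq> V" "sum (y i) V = 1" using R that by (auto simp: topspace_full_simplex[OF fin] \<sigma>_def)
    moreover from this have "\<exists>v. y i v \<noteq> 0" by (metis sum.neutral zero_neq_one)
    ultimately show ?thesis using fin by (auto simp: full_simplex_def \<sigma>_def intro: finite_subset)
  qed
  have "(realization ?K closure_of open_cell ?K (\<sigma> i)) \<inter> (realization ?K closure_of open_cell ?K (\<sigma> j)) = {}"
    if "i < k" "j < k" "i \<noteq> j" for i j
    unfolding closure_open_cell_disjoint_iff[OF fin K K, OF that(1,2)]
    using R that by (auto simp: \<sigma>_def)
  then have "\<exists>\<sigma>. ((\<forall>i<k. \<sigma> i \<in> ?K) \<and> (\<forall>i<k. \<forall>j<k. i \<noteq> j \<longrightarrow>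
      (realization ?K closure_of open_cell ?K (\<sigma> i)) \<inter> (realization ?K closure_of open_cell ?K (\<sigma> j)) = {})) \<and>
      y \<in> (\<Pi>\<^sub>E i\<in>{..<k}. open_cell ?K (\<sigma> i))"
    using K cell R by (intro exI[of _ \<sigma>]) (auto simp: PiE_iff)
  moreover have "y \<in> topspace (product_topology (\<lambda>_. realization ?K) {..<k})"
    using R by (auto simp: PiE_iff)
  ultimately show ?L
    unfolding discretized_configuration_space_def topspace_subtopology by blast
qed

section \<open>Barycentric subdivision of the discretized configuration space\<close>

lemma finite_chain_top:
  assumes "finite A" "A \<noteq> {}" and "\<And>x y. x \<in> A \<Longrightarrow> y \<in> A \<Longrightarrow> opp_le x y \<or> opp_le y x"
  shows "\<exists>x\<in>A. \<forall>y\<in>A. opp_le y x"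
  using assms
proof (induction A rule: finite_ne_induct)
  case (singleton x)
  then show ?case using opp_le_refl by blast
next
  case (insert a A)
  then obtain x where "x \<in> A" "\<And>y. y \<in> A \<Longrightarrow> opp_le y x" by (metis insertI2)
  moreover have "opp_le a x \<or> opp_le x a" using insert.prems \<open>x \<in> A\<close> by blast
  ultimately show ?case using opp_le_refl opp_le_trans by (metis insertE insertI1 insertI2)
qed

section \<open>The subdivision map and its inverse\<close>

definition barycentre :: "nat set list \<Rightarrow> nat \<Rightarrow> nat \<Rightarrow> real" where
  "barycentre T i v = (if v \<in> T ! i then 1 / real (card (T ! i)) else 0)"

text \<open>The affine extension of the map that sends a vertex \<open>T\<close> of the order
  complex to the barycentre of the product cell with factors spanned by
  \<open>T ! i\<close>.\<close>

definition geometric_point :: "nat \<Rightarrow> nat \<Rightarrow> (nat set list \<Rightarrow> real) \<Rightarrow> nat \<Rightarrow> nat \<Rightarrow> real" where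
  "geometric_point n k x i v = (\<Sum>T\<in>opp n k. x T * barycentre T i v)"

text \<open>Dropping the normalisation \<open>sum x (opp n k) = 1\<close> allows inductions that remove the top
  element of a chain.\<close>

definition chain_weights :: "nat \<Rightarrow> nat \<Rightarrow> (nat set list \<Rightarrow> real) \<Rightarrow> bool" where
  "chain_weights n k x \<longleftrightarrow> (\<forall>T. 0 \<le> x T) \<and> (\<forall>T. T \<notin> opp n k \<longrightarrow> x T = 0) \<and>
     (\<forall>S T. x S \<noteq> 0 \<longrightarrow> x T \<noteq> 0 \<longrightarrow> opp_le S T \<or> opp_le T S)"

lemma topspace_opp_space:
  "x \<in> topspace (order_space (opp n k) opp_le) \<longleftrightarrow> chain_weights n k x \<and> sum x (opp n k) = 1"
  unfolding topspace_order_space[OF finite_opp] chain_weights_def by blast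

lemma
  assumes "chain_weights n k x"
  shows chain_weights_nonneg: "0 \<le> x T"
    and chain_weights_opp: "x T \<noteq> 0 \<Longrightarrow> T \<in> opp n k"
    and chain_weights_chain: "x S \<noteq> 0 \<Longrightarrow> x T \<noteq> 0 \<Longrightarrow> opp_le S T \<or> opp_le T S"
  using assms by (auto simp: chain_weights_def)

lemma chain_weights_finite: "chain_weights n k x \<Longrightarrow> finite {T. x T \<noteq> 0}"
  by (rule finite_subset[OF _ finite_opp[of n k]]) (auto dest: chain_weights_opp)

lemma chain_weights_top:
  assumes "chain_weights n k x" "x T \<noteq> 0"
  obtains S where "x S \<noteq> 0" "\<And>T. x T \<noteq> 0 \<Longrightarrow> opp_le T S"
  using finite_chain_top[of "{T. x T \<noteq> 0}"] chain_weights_finite[OF assms(1)]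
    chain_weights_chain[OF assms(1)] assms(2) that by blast

lemma chain_weights_remove:
  assumes "chain_weights n k x"
  shows "chain_weights n k (x(S := 0))"
  using assms by (auto simp: chain_weights_def)

lemma barycentre_nonneg: "0 \<le> barycentre T i v"
  by (simp add: barycentre_def)

lemma opp_part_finite: "T \<in> opp n k \<Longrightarrow> i < k \<Longrightarrow> finite (T ! i)"
  by (rule finite_subset[OF opp_subset finite_atLeastAtMost])

lemma opp_part_card: "T \<in> opp n k \<Longrightarrow> i < k \<Longrightarrow> card (T ! i) > 0"
  using opp_part_finite opp_nonempty by (simp add: card_gt_0_iff)

lemma sum_barycentre:
  assumes "T \<in> opp n k" "i < k"
  shows "(\<Sum>v=1..n. barycentre T i v) = 1"
proof -
  have "(\<Sum>v=1..n. barycentre T i v) = (\<Sum>v\<in>T ! i. 1 / card (T ! i))"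
    unfolding barycentre_def using opp_subset[OF assms]
    by (subst sum.inter_restrict[symmetric]) (auto intro: sum.cong simp: Int_absorb1)
  then show ?thesis using opp_part_card[OF assms] by simp
qed

lemma sum_geometric_point:
  assumes "i < k"
  shows "(\<Sum>v=1..n. geometric_point n k x i v) = sum x (opp n k)"
proof -
  have "(\<Sum>v=1..n. geometric_point n k x i v) = (\<Sum>T\<in>opp n k. x T * (\<Sum>v=1..n. barycentre T i v))"
    unfolding geometric_point_def sum_distrib_left by (rule sum.swap)
  also have "\<dots> = sum x (opp n k)"
    by (rule sum.cong) (use sum_barycentre[OF _ assms] in auto)
  finally show ?thesis .
qed

lemma geometric_point_nonneg: "chain_weights n k x \<Longrightarrow> 0 \<le> geometric_point n k x i v"
  unfolding geometric_point_def
  by (intro sum_nonneg mult_nonneg_nonneg barycentre_nonneg) (auto simp: chain_weights_def)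

lemma geometric_point_nonzero_iff:
  assumes x: "chain_weights n k x" and i: "i < k"
  shows "geometric_point n k x i v \<noteq> 0 \<longleftrightarrow> (\<exists>T. x T \<noteq> 0 \<and> v \<in> T ! i)"
proof -
  have "geometric_point n k x i v = 0 \<longleftrightarrow> (\<forall>T\<in>opp n k. x T * barycentre T i v = 0)"
    unfolding geometric_point_def
    by (intro sum_nonneg_eq_0_iff finite_opp mult_nonneg_nonneg barycentre_nonneg chain_weights_nonneg[OF x])
  then show ?thesis
    using opp_part_card[OF _ i] chain_weights_opp[OF x] unfolding barycentre_def
    by (smt (verit, best) divide_eq_0_iff mult_eq_0_iff of_nat_0_eq_iff less_irrefl)
qed

text \<open>The parts of all smaller chain elements are contained in those of the top
  \<open>S\<close>, so \<open>S\<close> names the open cell of the image and can be read off from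
  it.\<close>

lemma geometric_point_support:
  assumes x: "chain_weights n k x" and i: "i < k" and S: "x S \<noteq> 0" "\<And>T. x T \<noteq> 0 \<Longrightarrow> opp_le T S"
  shows "geometric_point n k x i v \<noteq> 0 \<longleftrightarrow> v \<in> S ! i"
proof -
  have "v \<in> S ! i" if "x T \<noteq> 0" "v \<in> T ! i" for T
    using S(2)[OF that(1)] that(2) i opp_length[OF chain_weights_opp[OF x that(1)]]
    by (auto simp: opp_le_iff)
  then show ?thesis using geometric_point_nonzero_iff[OF x i] S(1) by blast
qed

lemma geometric_point_remove:
  assumes "S \<in> opp n k"
  shows "geometric_point n k x i v = geometric_point n k (x(S := 0)) i v + x S * barycentre S i v"
proof -
  have "(\<Sum>T\<in>opp n k - {S}. x T * barycentre T i v) = (\<Sum>T\<in>opp n k - {S}. (x(S := 0)) T * barycentre T i v)"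
    by (rule sum.cong) auto
  then show ?thesis
    unfolding geometric_point_def
    using sum.remove[OF finite_opp assms, of "\<lambda>T. x T * barycentre T i v"]
      sum.remove[OF finite_opp assms, of "\<lambda>T. (x(S := 0)) T * barycentre T i v"] by simp
qed

text \<open>The other weights contribute nonnegatively. Together with
  \<open>weight_eq_geometric_point\<close> this exhibits the weight of the top of a chain as the
  minimum of the coordinates of the image, each scaled by the size of its part.\<close>

lemma weight_le_geometric_point:
  assumes x: "chain_weights n k x" and S: "S \<in> opp n k" and i: "i < k" and v: "v \<in> S ! i"
  shows "x S \<le> card (S ! i) * geometric_point n k x i v"
proof -
  have "x S * barycentre S i v \<le> geometric_point n k x i v"
    using geometric_point_remove[OF S, of x i v] geometric_point_nonneg[OF chain_weights_remove[OF x]] by simp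
  then show ?thesis using opp_part_card[OF S i] v by (simp add: barycentre_def field_simps)
qed

text \<open>The largest other element of the chain lies strictly below \<open>S\<close>, so some
  part of \<open>S\<close> has a vertex that no other chain element contains there. The coordinate
  of this vertex comes from \<open>S\<close> alone.\<close>

lemma weight_eq_geometric_point:
  assumes x: "chain_weights n k x" and S: "S \<in> opp n k" and k: "k > 0"
    and top: "\<And>T. x T \<noteq> 0 \<Longrightarrow> opp_le T S"
  obtains i v where "i < k" "v \<in> S ! i" "x S = card (S ! i) * geometric_point n k x i v"
proof -
  let ?x = "x(S := 0)"
  have x': "chain_weights n k ?x" by (rule chain_weights_remove[OF x])
  have "\<exists>i<k. \<exists>v\<in>S ! i. \<forall>T. ?x T \<noteq> 0 \<longrightarrow> v \<notin> T ! i"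
  proof (cases "\<exists>T. ?x T \<noteq> 0")
    case False
    then show ?thesis using opp_nonempty[OF S k] k by blast
  next
    case True
    then obtain T where T: "?x T \<noteq> 0" "\<And>U. ?x U \<noteq> 0 \<Longrightarrow> opp_le U T"
      using chain_weights_top[OF x'] by metis
    then have "T \<noteq> S" "opp_le T S" using top[of T] by (auto split: if_splits)
    then have "\<not> opp_le S T" using opp_le_antisym by blast
    then obtain i v where i: "i < k" "v \<in> S ! i" "v \<notin> T ! i"
      using \<open>opp_le T S\<close> opp_length[OF S] by (auto simp: opp_le_iff)
    have "v \<notin> U ! i" if "?x U \<noteq> 0" for U
      using T(2)[OF that] i opp_length[OF chain_weights_opp[OF x' that]] by (auto simp: opp_le_iff)
    then show ?thesis using i by blast
  qed
  then obtain i v where i: "i < k" "v \<in> S ! i" and "\<And>T. ?x T \<noteq> 0 \<Longrightarrow> v \<notin> T ! i" by blast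
  then have "geometric_point n k ?x i v = 0"
    using geometric_point_nonzero_iff[OF x' i(1)] by blast
  then have "geometric_point n k x i v = x S * barycentre S i v"
    using geometric_point_remove[OF S, of x i v] by simp
  then show thesis using that[OF i] i opp_part_card[OF S i(1)] by (simp add: barycentre_def)
qed

text \<open>The top is peeled off: the supports of the image determine the top of the chain, the
  minimum formula determines its weight, and what is left has a smaller support.\<close>

lemma geometric_point_inject:
  assumes "chain_weights n k x" "chain_weights n k x'" "k > 0"
    and "\<And>i v. i < k \<Longrightarrow> geometric_point n k x i v = geometric_point n k x' i v"
  shows "x = x'"
  using assms
proof (induction "card {T. x T \<noteq> 0}" arbitrary: x x' rule: less_induct)
  case less
  note x = less.prems(1) and x' = less.prems(2) and k = less.prems(3) and eq = less.prems(4)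
  show ?case
  proof (cases "\<exists>T. x T \<noteq> 0")
    case False
    then have "geometric_point n k x' i v = 0" if "i < k" for i v
      using eq[OF that] geometric_point_nonzero_iff[OF x that] by metis
    then have "\<forall>T. x' T \<noteq> 0 \<longrightarrow> T ! 0 = {}"
      using geometric_point_nonzero_iff[OF x' k] k by blast
    then have "\<forall>T. x' T = 0" using chain_weights_opp[OF x'] opp_nonempty k by blast
    then show ?thesis using False by auto
  next
    case True
    then obtain S where S: "x S \<noteq> 0" "\<And>T. x T \<noteq> 0 \<Longrightarrow> opp_le T S"
      using chain_weights_top[OF x] by metis
    have SP: "S \<in> opp n k" by (rule chain_weights_opp[OF x S(1)])
    obtain v where "v \<in> S ! 0" using opp_nonempty[OF SP k] by blast
    then have "geometric_point n k x' 0 v \<noteq> 0" using geometric_point_support[OF x k S] eq[OF k] by simp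
    then obtain T where "x' T \<noteq> 0" using geometric_point_nonzero_iff[OF x' k] by blast
    then obtain S' where S': "x' S' \<noteq> 0" "\<And>T. x' T \<noteq> 0 \<Longrightarrow> opp_le T S'"
      using chain_weights_top[OF x'] by metis
    have SP': "S' \<in> opp n k" by (rule chain_weights_opp[OF x' S'(1)])
    have "S ! i = S' ! i" if "i < k" for i
      using geometric_point_support[OF x that S] geometric_point_support[OF x' that S'] eq[OF that] by auto
    then have SS: "S' = S" using opp_length[OF SP] opp_length[OF SP'] by (intro nth_equalityI) auto
    have "x S = x' S"
    proof (rule antisym)
      obtain i v where "i < k" "v \<in> S ! i" "x' S = card (S ! i) * geometric_point n k x' i v"
        by (rule weight_eq_geometric_point[OF x' SP k]) (use S' SS in auto)
      then show "x S \<le> x' S" using weight_le_geometric_point[OF x SP] eq by metis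
      obtain i v where "i < k" "v \<in> S ! i" "x S = card (S ! i) * geometric_point n k x i v"
        by (rule weight_eq_geometric_point[OF x SP k]) (use S in auto)
      then show "x' S \<le> x S" using weight_le_geometric_point[OF x' SP] eq by metis
    qed
    have "x(S := 0) = x'(S := 0)"
    proof (rule less.hyps)
      have "{T. (x(S := 0)) T \<noteq> 0} \<subset> {T. x T \<noteq> 0}" using S(1) by auto
      then show "card {T. (x(S := 0)) T \<noteq> 0} < card {T. x T \<noteq> 0}"
        by (rule psubset_card_mono[OF chain_weights_finite[OF x]])
      show "geometric_point n k (x(S := 0)) i v = geometric_point n k (x'(S := 0)) i v" if "i < k" for i v
        using geometric_point_remove[OF SP, of x i v] geometric_point_remove[OF SP, of x' i v]
          eq[OF that, of v] \<open>x S = x' S\<close> by simp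
    qed (use chain_weights_remove x x' k in auto)
    then show ?thesis using \<open>x S = x' S\<close> by (metis fun_upd_triv fun_upd_upd)
  qed
qed

text \<open>A greedy inverse. The supports of \<open>y\<close> form a partition \<open>S\<close>,
  and as large a multiple of its barycentre as possible is subtracted, which kills at least one
  coordinate. The total \<open>c\<close> is arbitrary because it shrinks in every round, and the
  claim on supports keeps all later partitions below \<open>S\<close>.\<close>

lemma geometric_point_surj:
  fixes y :: "nat \<Rightarrow> nat \<Rightarrow> real"
  assumes "k > 0" "c > 0" "\<And>i v. i < k \<Longrightarrow> 0 \<le> y i v" "\<And>i v. i < k \<Longrightarrow> v \<notin> {1..n} \<Longrightarrow> y i v = 0"
    and "\<And>i. i < k \<Longrightarrow> (\<Sum>v=1..n. y i v) = c"
    and "\<And>i j v. i < k \<Longrightarrow> j < k \<Longrightarrow> y i v \<noteq> 0 \<Longrightarrow> y j v \<noteq> 0 \<Longrightarrow> i = j"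
  shows "\<exists>x. chain_weights n k x \<and> (\<forall>i<k. \<forall>v. geometric_point n k x i v = y i v) \<and>
    (\<forall>T. x T \<noteq> 0 \<longrightarrow> (\<forall>i<k. \<forall>v\<in>T ! i. y i v \<noteq> 0))"
  using assms
proof (induction "card {(i, v). i < k \<and> y i v \<noteq> 0}" arbitrary: y c rule: less_induct)
  case less
  note k = less.prems(1) and c = less.prems(2) and nn = less.prems(3) and out = less.prems(4)
    and sum = less.prems(5) and disj = less.prems(6)
  define S where "S = map (\<lambda>i. {v. y i v \<noteq> 0}) [0..<k]"
  have nth: "S ! i = {v. y i v \<noteq> 0}" if "i < k" for i using that by (simp add: S_def)
  have SP: "S \<in> opp n k"
  proof (rule oppI)
    show "length S = k" by (simp add: S_def)
    show "S ! i \<noteq> {}" if "i < k" for i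
    proof
      assume "S ! i = {}"
      then have "(\<Sum>v=1..n. y i v) = 0" using nth[OF that] by (intro sum.neutral) auto
      then show False using sum[OF that] c by simp
    qed
    show "S ! i \<subseteq> {1..n}" if "i < k" for i using nth[OF that] out[OF that] by blast
    show "i = j" if "i < k" "j < k" "v \<in> S ! i" "v \<in> S ! j" for i j v
      using that nth disj by auto
  qed
  let ?I = "{(i, v). i < k \<and> y i v \<noteq> 0}"
  have finI: "finite ?I"
    by (rule finite_subset[of _ "{..<k} \<times> {1..n}"]) (use out in blast, auto)
  have neI: "?I \<noteq> {}" using opp_nonempty[OF SP k] nth[OF k] k by auto
  \<comment> \<open>The largest multiple that leaves no coordinate negative: at a vertex of the part
    \<open>i\<close> the barycentre has coordinate \<open>1 / card (S ! i)\<close>.\<close>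
  define t where "t = Min ((\<lambda>(i, v). card (S ! i) * y i v) ` ?I)"
  have t_le: "t \<le> card (S ! i) * y i v" if "i < k" "y i v \<noteq> 0" for i v
    unfolding t_def using finI that by (intro Min_le) auto
  have "t \<in> (\<lambda>(i, v). card (S ! i) * y i v) ` ?I"
    unfolding t_def using finI neI by (intro Min_in) auto
  then obtain i0 v0 where min: "i0 < k" "y i0 v0 \<noteq> 0" "t = card (S ! i0) * y i0 v0" by auto
  have t0: "t > 0"
    using min nn[OF min(1), of v0] opp_part_card[OF SP min(1)] by simp
  define y' where "y' i v = y i v - t * barycentre S i v" for i v
  have nn': "0 \<le> y' i v" if "i < k" for i v
  proof (cases "y i v = 0")
    case True
    then show ?thesis using nth[OF that] by (simp add: y'_def barycentre_def)
  next
    case False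
    then show ?thesis using t_le[OF that False] opp_part_card[OF SP that] nth[OF that]
      by (simp add: y'_def barycentre_def field_simps)
  qed
  have sum': "(\<Sum>v=1..n. y' i v) = c - t" if "i < k" for i
    using sum[OF that] sum_barycentre[OF SP that]
    by (simp add: y'_def sum_subtractf flip: sum_distrib_left)
  have supp': "y i v \<noteq> 0" if "i < k" "y' i v \<noteq> 0" for i v
  proof
    assume y0: "y i v = 0"
    then have "v \<notin> S ! i" using nth[OF that(1)] by simp
    then have "y' i v = 0" using y0 by (simp add: y'_def barycentre_def)
    then show False using that(2) by simp
  qed
  have out': "y' i v = 0" if "i < k" "v \<notin> {1..n}" for i v
    using supp'[OF that(1)] out[OF that] by blast
  have v0: "y' i0 v0 = 0"
    using min nth[OF min(1)] opp_part_card[OF SP min(1)] by (simp add: y'_def barycentre_def)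
  have ct: "0 \<le> c - t" using sum'[OF k] nn'[OF k] by (metis sum_nonneg)
  have "\<exists>x. chain_weights n k x \<and> (\<forall>i<k. \<forall>v. geometric_point n k x i v = y' i v) \<and>
    (\<forall>T. x T \<noteq> 0 \<longrightarrow> (\<forall>i<k. \<forall>v\<in>T ! i. y' i v \<noteq> 0))"
  proof (cases "c - t = 0")
    case True
    have "y' i v = 0" if "i < k" for i v
    proof (cases "v \<in> {1..n}")
      case in_range: True
      have "\<forall>v\<in>{1..n}. y' i v = 0"
        using sum'[OF that] True nn'[OF that] sum_nonneg_eq_0_iff[of "{1..n}" "y' i"] by simp
      then show ?thesis using in_range by blast
    qed (rule out'[OF that])
    then show ?thesis
      by (intro exI[of _ "\<lambda>_. 0"]) (auto simp: chain_weights_def geometric_point_def)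
  next
    case False
    show ?thesis
    proof (rule less.hyps)
      have "{(i, v). i < k \<and> y' i v \<noteq> 0} \<subseteq> ?I" using supp' by auto
      moreover have "(i0, v0) \<in> ?I" "(i0, v0) \<notin> {(i, v). i < k \<and> y' i v \<noteq> 0}"
        using min(1,2) v0 by auto
      ultimately have "{(i, v). i < k \<and> y' i v \<noteq> 0} \<subset> ?I" by blast
      then show "card {(i, v). i < k \<and> y' i v \<noteq> 0} < card ?I" by (rule psubset_card_mono[OF finI])
      show "c - t > 0" using False ct by simp
      show "i = j" if "i < k" "j < k" "y' i v \<noteq> 0" "y' j v \<noteq> 0" for i j v
        by (rule disj[OF that(1,2) supp'[OF that(1,3)] supp'[OF that(2,4)]])
    qed (use k nn' out' sum' in blast)+
  qed
  then obtain x where x: "chain_weights n k x" "\<And>i v. i < k \<Longrightarrow> geometric_point n k x i v = y' i v"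
    "\<And>T i v. x T \<noteq> 0 \<Longrightarrow> i < k \<Longrightarrow> v \<in> T ! i \<Longrightarrow> y' i v \<noteq> 0" by blast
  \<comment> \<open>The killed coordinate belongs to a vertex of \<open>S\<close>, so
    \<open>S\<close> does not occur in the recursive solution and its weight is free to be set to
    \<open>t\<close>.\<close>
  have xS: "x S = 0"
    using x(3)[of S i0 v0] v0 min nth[OF min(1)] by auto
  have le: "opp_le T S" if "x T \<noteq> 0" for T
    unfolding opp_le_iff
    using opp_length[OF chain_weights_opp[OF x(1) that]] opp_length[OF SP] nth supp' x(3)[OF that] by auto
  let ?x = "x(S := t)"
  have "chain_weights n k ?x"
    unfolding chain_weights_def
    using chain_weights_nonneg[OF x(1)] chain_weights_opp[OF x(1)] chain_weights_chain[OF x(1)] le t0 SP opp_le_refl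
    by (auto simp: less_imp_le)
  moreover have "geometric_point n k ?x i v = y i v" if "i < k" for i v
  proof -
    have "?x(S := 0) = x" using xS by auto
    then show ?thesis
      using geometric_point_remove[OF SP, of ?x i v] x(2)[OF that, of v] by (simp add: y'_def)
  qed
  moreover have "y i v \<noteq> 0" if "?x T \<noteq> 0" "i < k" "v \<in> T ! i" for T i v
    using that x(3)[of T i v] supp' nth by (auto split: if_splits)
  ultimately show ?case by blast
qed

text \<open>The source is compact and the target Hausdorff, so a continuous bijection
  suffices.\<close>

lemma homeomorphic_map_barycentric_subdivision:
  assumes k: "k > 0"
  shows "homeomorphic_map (order_space (opp n k) opp_le) (discretized_configuration_space k (full_simplex {1..n}))
    (\<lambda>x. \<lambda>i\<in>{..<k}. geometric_point n k x i)" (is "homeomorphic_map ?X ?D ?f")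
proof (rule continuous_imp_homeomorphic_map)
  show "compact_space ?X" by (rule compact_order_space[OF finite_opp])
  show "Hausdorff_space ?D"
    unfolding discretized_configuration_space_def full_simplex_eq
    by (intro Hausdorff_space_subtopology) (simp add: Hausdorff_space_product_topology Hausdorff_order_space)
  have cont: "continuous_map ?X euclideanreal (\<lambda>x. geometric_point n k x i v)" for i v
    unfolding geometric_point_def by (intro continuous_intros finite_opp) auto
  have simplex: "geometric_point n k x i \<in> topspace (realization (full_simplex {1..n}))"
    if x: "x \<in> topspace ?X" and i: "i < k" for x i
    unfolding topspace_full_simplex[OF finite_atLeastAtMost]
  proof (intro conjI allI impI)
    have cw: "chain_weights n k x" and s: "sum x (opp n k) = 1" using x by (auto simp: topspace_opp_space)
    show "0 \<le> geometric_point n k x i v" for v by (rule geometric_point_nonneg[OF cw])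
    show "sum (geometric_point n k x i) {1..n} = 1" using sum_geometric_point[OF i] s by metis
    show "geometric_point n k x i v = 0" if "v \<notin> {1..n}" for v
      using geometric_point_nonzero_iff[OF cw i] chain_weights_opp[OF cw] opp_subset[OF _ i] that by blast
  qed
  have inD: "?f x \<in> topspace ?D" if x: "x \<in> topspace ?X" for x
    unfolding topspace_discretized_configuration_space[OF finite_atLeastAtMost]
  proof (intro conjI allI impI)
    have cw: "chain_weights n k x" using x by (simp add: topspace_opp_space)
    show "i = j" if ij: "i < k" "j < k" and v: "?f x i v \<noteq> 0" "?f x j v \<noteq> 0" for i j v
    proof -
      obtain T where "x T \<noteq> 0" "v \<in> T ! i"
        using v(1) ij geometric_point_nonzero_iff[OF cw ij(1)] by auto
      then obtain S where S: "x S \<noteq> 0" "\<And>T. x T \<noteq> 0 \<Longrightarrow> opp_le T S"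
        using chain_weights_top[OF cw] by metis
      show ?thesis
        using v ij geometric_point_support[OF cw ij(1) S] geometric_point_support[OF cw ij(2) S]
          opp_disjoint[OF chain_weights_opp[OF cw S(1)] ij] by auto
    qed
  qed (use simplex[OF x] in auto)
  show "continuous_map ?X ?D ?f"
    unfolding discretized_configuration_space_def continuous_map_in_subtopology
  proof
    show "continuous_map ?X (product_topology (\<lambda>_. realization (full_simplex {1..n})) {..<k}) ?f"
      unfolding continuous_map_componentwise continuous_map_into_full_simplex
      using cont simplex by auto
    show "?f \<in> topspace ?X \<rightarrow> (\<Union>\<sigma>\<in>{\<sigma>. (\<forall>i<k. \<sigma> i \<in> full_simplex {1..n}) \<and> (\<forall>i<k. \<forall>j<k. i \<noteq> j \<longrightarrow>
        (realization (full_simplex {1..n}) closure_of open_cell (full_simplex {1..n}) (\<sigma> i)) \<inter>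
        (realization (full_simplex {1..n}) closure_of open_cell (full_simplex {1..n}) (\<sigma> j)) = {})}.
        \<Pi>\<^sub>E i\<in>{..<k}. open_cell (full_simplex {1..n}) (\<sigma> i))"
      using inD unfolding discretized_configuration_space_def topspace_subtopology by blast
  qed
  show "inj_on ?f (topspace ?X)"
  proof (rule inj_onI)
    fix x x' assume "x \<in> topspace ?X" "x' \<in> topspace ?X" and eq: "?f x = ?f x'"
    then have cw: "chain_weights n k x" "chain_weights n k x'" by (auto simp: topspace_opp_space)
    have "geometric_point n k x i v = geometric_point n k x' i v" if "i < k" for i v
      using fun_cong[OF eq, of i] that by simp
    then show "x = x'" by (rule geometric_point_inject[OF cw k])
  qed
  show "?f ` topspace ?X = topspace ?D"
  proof (intro equalityI subsetI)
    fix y assume "y \<in> ?f ` topspace ?X"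
    then show "y \<in> topspace ?D" using inD by blast
  next
    fix y assume y: "y \<in> topspace ?D"
    note y' = y[unfolded topspace_discretized_configuration_space[OF finite_atLeastAtMost]
        topspace_full_simplex[OF finite_atLeastAtMost]]
    have "\<exists>x. chain_weights n k x \<and> (\<forall>i<k. \<forall>v. geometric_point n k x i v = y i v) \<and>
        (\<forall>T. x T \<noteq> 0 \<longrightarrow> (\<forall>i<k. \<forall>v\<in>T ! i. y i v \<noteq> 0))"
      by (rule geometric_point_surj[OF k zero_less_one]) (use y' in blast)+
    then obtain x where x: "chain_weights n k x" "\<And>i v. i < k \<Longrightarrow> geometric_point n k x i v = y i v"
      by blast
    have "sum x (opp n k) = 1"
      using sum_geometric_point[OF k, of n x] x(2)[OF k] y' k by simp
    then have "x \<in> topspace ?X" using x(1) by (simp add: topspace_opp_space)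
    moreover have "?f x = y"
      using x(2) y' by (auto simp: fun_eq_iff extensional_def)
    ultimately show "y \<in> ?f ` topspace ?X" by blast
  qed
qed

section \<open>Collapsing the contractible subspace\<close>

text \<open>The classical equivalence of a space with its quotient by a contractible subspace, with
  \<open>W\<close> as a Hausdorff model of the quotient. The end of \<open>H\<close> is constant on
  \<open>A\<close> and descends to a homotopy inverse \<open>G\<close>; the whole homotopy descends
  as well because it keeps \<open>A\<close> inside \<open>A\<close>.\<close>

lemma homotopy_equivalent_collapse:
  assumes X: "compact_space X" and W: "Hausdorff_space W" and F: "continuous_map X W F"
    and surj: "F ` topspace X = topspace W"
    and fibre: "\<And>x y. x \<in> topspace X \<Longrightarrow> y \<in> topspace X \<Longrightarrow> F x = F y \<Longrightarrow> x \<noteq> y \<Longrightarrow> x \<in> A \<and> y \<in> A"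
    and const: "\<And>x y. x \<in> A \<Longrightarrow> y \<in> A \<Longrightarrow> F x = F y"
    and H: "continuous_map (prod_topology (top_of_set {0..1::real}) X) X H"
    and H0: "\<And>x. x \<in> topspace X \<Longrightarrow> H (0, x) = x"
    and HA: "\<And>t x. t \<in> {0..1} \<Longrightarrow> x \<in> A \<Longrightarrow> H (t, x) \<in> A"
    and H1: "\<And>x. x \<in> A \<Longrightarrow> H (1, x) = a"
  shows "X homotopy_equivalent_space W"
proof -
  let ?I = "top_of_set {0..1::real}"
  have cont1: "continuous_map X X (\<lambda>x. H (1, x))"
    by (rule continuous_map_compose[where f = "\<lambda>x. (1, x)", OF _ H, unfolded o_def])
      (auto intro!: continuous_map_pairedI continuous_map_id[unfolded id_def])
  have quot: "quotient_map X W F"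
    by (rule continuous_imp_quotient_map[OF F X W surj])
  obtain G where G: "continuous_map W X G" "\<And>x. x \<in> topspace X \<Longrightarrow> G (F x) = H (1, x)"
    by (rule quotient_map_lift_exists[OF quot cont1]) (use fibre H1 in metis)+
  have contF: "continuous_map (prod_topology ?I X) (prod_topology ?I W) (\<lambda>p. (fst p, F (snd p)))"
    by (intro continuous_map_pairedI continuous_map_fst
        continuous_map_compose[OF continuous_map_snd F, unfolded o_def])
  \<comment> \<open>Compactness of the cylinder makes the product with the interval a quotient map
    again, so the descended homotopy is jointly continuous.\<close>
  have quotI: "quotient_map (prod_topology ?I X) (prod_topology ?I W) (\<lambda>p. (fst p, F (snd p)))"
  proof (rule continuous_imp_quotient_map[OF contF])
    show "compact_space (prod_topology ?I X)"
      using X by (simp add: compact_space_prod_topology compact_space_subtopology)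
    show "Hausdorff_space (prod_topology ?I W)"
      using W by (simp add: Hausdorff_space_prod_topology Hausdorff_space_subtopology)
    show "(\<lambda>p. (fst p, F (snd p))) ` topspace (prod_topology ?I X) = topspace (prod_topology ?I W)"
      using surj by (force simp: image_iff)
  qed
  have contFH: "continuous_map (prod_topology ?I X) W (\<lambda>p. F (H p))"
    using continuous_map_compose[OF H F] by (simp add: o_def)
  have eqFH: "F (H p) = F (H p')"
    if "p \<in> topspace (prod_topology ?I X)" "p' \<in> topspace (prod_topology ?I X)"
      "(fst p, F (snd p)) = (fst p', F (snd p'))" for p p'
  proof (cases "snd p = snd p'")
    case True
    then have "p = p'" using that(3) by (simp add: prod_eq_iff)
    then show ?thesis by simp
  next
    case False
    then have A: "snd p \<in> A" "snd p' \<in> A" using fibre[of "snd p" "snd p'"] that by auto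
    have t: "fst p \<in> {0..1}" "fst p = fst p'" using that by auto
    have "H p \<in> A" using HA[OF t(1) A(1)] by simp
    moreover have "H p' \<in> A" using HA[OF t(1) A(2)] t(2) by simp
    ultimately show ?thesis by (rule const)
  qed
  obtain K where K: "continuous_map (prod_topology ?I W) W K"
    "\<And>p. p \<in> topspace (prod_topology ?I X) \<Longrightarrow> K (fst p, F (snd p)) = F (H p)"
    by (rule quotient_map_lift_exists[OF quotI contFH eqFH]) (assumption | blast)+
  have K': "K (t, F x) = F (H (t, x))" if "t \<in> {0..1}" "x \<in> topspace X" for t x
    using K(2)[of "(t, x)"] that by simp
  have "homotopic_with (\<lambda>h. True) X X id (G \<circ> F)"
    unfolding homotopic_with_true_iff using H H0 G(2) by (intro exI[of _ H]) auto
  moreover have "homotopic_with (\<lambda>h. True) W W id (F \<circ> G)"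
    unfolding homotopic_with_true_iff
  proof (intro exI[of _ K] conjI ballI)
    fix w assume "w \<in> topspace W"
    then obtain x where x: "x \<in> topspace X" "w = F x" using surj by blast
    show "K (0, w) = id w" using K'[of 0 x] H0 x by simp
    show "K (1, w) = (F \<circ> G) w" using K'[of 1 x] G(2) x by simp
  qed (rule K(1))
  ultimately have "homotopic_with (\<lambda>h. True) X X (G \<circ> F) id" "homotopic_with (\<lambda>h. True) W W (F \<circ> G) id"
    by (simp_all add: homotopic_with_symD)
  then show ?thesis
    unfolding homotopy_equivalent_space_def using F G(1) by blast
qed

section \<open>The top-dimensional cells\<close>

abbreviation sphere_base :: "nat \<Rightarrow> real" where
  "sphere_base \<equiv> (\<lambda>i. if i = 0 then 1 else 0)"

lemma topspace_nsphere:
  "z \<in> topspace (nsphere d) \<longleftrightarrow> (z 0)\<^sup>2 + (\<Sum>l=1..d. (z l)\<^sup>2) = 1 \<and> (\<forall>l>d. z l = 0)"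
proof -
  have "(\<Sum>l\<le>d. (z l)\<^sup>2) = (z 0)\<^sup>2 + (\<Sum>l=1..d. (z l)\<^sup>2)"
    by (simp add: atMost_atLeast0 sum.atLeast_Suc_atMost)
  then show ?thesis by (simp add: nsphere)
qed

lemma continuous_map_into_nsphere:
  assumes "\<And>l. continuous_map X euclideanreal (\<lambda>x. f x l)" "f \<in> topspace X \<rightarrow> topspace (nsphere d)"
  shows "continuous_map X (nsphere d) f"
  using assms unfolding nsphere
  by (auto simp: continuous_map_in_subtopology continuous_map_componentwise_UNIV)

text \<open>\<open>S\<close> indexes a cell of top dimension, a product of simplices. In every part \<open>i\<close> a vertex
  \<open>u i\<close> is singled out; the barycentric coordinates of the remaining vertices, enumerated by \<open>e\<close>,
  parametrize the cell.\<close>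

locale top_cell =
  fixes n k :: nat and S :: "nat set list" and u part e :: "nat \<Rightarrow> nat"
  assumes S: "S \<in> opp n k" and k: "k > 0"
    and u: "\<And>i. i < k \<Longrightarrow> u i \<in> S ! i"
    and part_less: "\<And>v. v \<in> {1..n} \<Longrightarrow> part v < k"
    and part_mem: "\<And>v. v \<in> {1..n} \<Longrightarrow> v \<in> S ! part v"
    and e: "bij_betw e {1..n - k} ({1..n} - u ` {..<k})"
begin

abbreviation "X \<equiv> order_space (opp n k) opp_le"

text \<open>Displacement from the barycentre of the cell \<open>S\<close>; since \<open>part\<close>
  names the factor of a vertex, one function covers all factors.\<close>

definition dev :: "(nat set list \<Rightarrow> real) \<Rightarrow> nat \<Rightarrow> real" where
  "dev x v = geometric_point n k x (part v) v - 1 / card (S ! part v)"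

definition off_weight :: "(nat set list \<Rightarrow> real) \<Rightarrow> real" where
  "off_weight x = (\<Sum>T | T \<in> opp n k \<and> \<not> opp_le T S. x T)"

definition dev_norm :: "(nat set list \<Rightarrow> real) \<Rightarrow> real" where
  "dev_norm x = (\<Sum>l=1..n - k. (dev x (e l))\<^sup>2)"

text \<open>On the open cell, \<open>dev x / x S\<close> ranges over the Euclidean space of dimension \<open>n - k\<close>, and
  \<open>cell_map\<close> is its composition with the inverse stereographic projection. The summand
  \<open>off_weight\<close>, which vanishes there, keeps the denominator positive outside the closed cell.\<close>

definition cell_map :: "(nat set list \<Rightarrow> real) \<Rightarrow> nat \<Rightarrow> real" where
  "cell_map x l =
     (if l = 0 then (dev_norm x + off_weight x - (x S)\<^sup>2) / (dev_norm x + off_weight x + (x S)\<^sup>2)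
      else if l \<le> n - k then 2 * dev x (e l) * x S / (dev_norm x + off_weight x + (x S)\<^sup>2) else 0)"

section \<open>Linear relations and weights in a top-dimensional cell\<close>

lemma part_eq: "i < k \<Longrightarrow> v \<in> S ! i \<Longrightarrow> part v = i"
  using opp_disjoint[OF S] opp_subset[OF S] part_less part_mem by blast

lemma exhaustive: "exhaustive n k S"
  unfolding exhaustive_def using part_less part_mem by blast

lemma u_range: "i < k \<Longrightarrow> u i \<in> {1..n}"
  using u opp_subset[OF S] by blast

lemma e_range: "l \<in> {1..n - k} \<Longrightarrow> e l \<in> {1..n}"
  using e unfolding bij_betw_def by blast

lemma vertex_cases:
  assumes "v \<in> {1..n}"
  obtains l where "l \<in> {1..n - k}" "v = e l" | i where "i < k" "v = u i"
proof (cases "v \<in> u ` {..<k}")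
  case False
  then have "v \<in> e ` {1..n - k}" using assms e unfolding bij_betw_def by blast
  then show thesis using that(1) by blast
qed (use that(2) in blast)

lemma chain: "x \<in> topspace X \<Longrightarrow> chain_weights n k x"
  and total: "x \<in> topspace X \<Longrightarrow> sum x (opp n k) = 1"
  by (simp_all add: topspace_opp_space)

lemma off_weight_nonneg: "x \<in> topspace X \<Longrightarrow> 0 \<le> off_weight x"
  unfolding off_weight_def using chain_weights_nonneg[OF chain] by (intro sum_nonneg) auto

lemma off_weight_eq_0_iff:
  assumes "x \<in> topspace X"
  shows "off_weight x = 0 \<longleftrightarrow> (\<forall>T. x T \<noteq> 0 \<longrightarrow> opp_le T S)"
proof -
  have "off_weight x = 0 \<longleftrightarrow> (\<forall>T\<in>{T. T \<in> opp n k \<and> \<not> opp_le T S}. x T = 0)"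
    unfolding off_weight_def
    by (rule sum_nonneg_eq_0_iff) (use finite_opp chain_weights_nonneg[OF chain[OF assms]] in auto)
  then show ?thesis using chain_weights_opp[OF chain[OF assms]] by blast
qed

lemma support_le:
  assumes x: "x \<in> topspace X" and "x S \<noteq> 0" "x T \<noteq> 0"
  shows "opp_le T S"
  using chain_weights_chain[OF chain[OF x] assms(3,2)]
    exhaustive_maximal[OF exhaustive S chain_weights_opp[OF chain[OF x] assms(3)]] opp_le_refl by blast

lemma off_weight_eq_0: "x \<in> topspace X \<Longrightarrow> x S \<noteq> 0 \<Longrightarrow> off_weight x = 0"
  using off_weight_eq_0_iff support_le by blast

lemma dev_norm_nonneg: "0 \<le> dev_norm x"
  unfolding dev_norm_def by (intro sum_nonneg) auto

lemma geometric_point_off_part: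
  assumes x: "x \<in> topspace X" and le: "\<And>T. x T \<noteq> 0 \<Longrightarrow> opp_le T S" and i: "i < k" and "v \<notin> S ! i"
  shows "geometric_point n k x i v = 0"
proof (rule ccontr)
  assume "geometric_point n k x i v \<noteq> 0"
  then obtain T where "x T \<noteq> 0" "v \<in> T ! i" using geometric_point_nonzero_iff[OF chain[OF x] i] by blast
  then show False
    using le[of T] assms(4) i opp_length[OF chain_weights_opp[OF chain[OF x]], of T] by (auto simp: opp_le_iff)
qed

text \<open>In every factor the point and the barycentre both have total 1. One displacement per
  part thus depends on the others, which leaves \<open>n - k\<close> free ones.\<close>

lemma sum_dev_part:
  assumes x: "x \<in> topspace X" and le: "\<And>T. x T \<noteq> 0 \<Longrightarrow> opp_le T S" and i: "i < k"
  shows "(\<Sum>v\<in>S ! i. dev x v) = 0"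
proof -
  have "(\<Sum>v\<in>S ! i. geometric_point n k x i v) = (\<Sum>v=1..n. geometric_point n k x i v)"
    by (rule sum.mono_neutral_left)
      (use opp_subset[OF S i] geometric_point_off_part[OF x le i] in auto)
  also have "\<dots> = 1" using sum_geometric_point[OF i] total[OF x] by metis
  finally have "(\<Sum>v\<in>S ! i. geometric_point n k x i v) = 1" .
  moreover have "(\<Sum>v\<in>S ! i. dev x v) = (\<Sum>v\<in>S ! i. geometric_point n k x i v - 1 / card (S ! i))"
    by (rule sum.cong) (auto simp: dev_def part_eq[OF i])
  ultimately show ?thesis
    using opp_part_card[OF S i] by (simp add: sum_subtractf)
qed

lemma dev_u:
  assumes x: "x \<in> topspace X" and le: "\<And>T. x T \<noteq> 0 \<Longrightarrow> opp_le T S" and i: "i < k"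
  shows "dev x (u i) = - (\<Sum>v\<in>S ! i - {u i}. dev x v)"
  using sum_dev_part[OF assms] sum.remove[OF opp_part_finite[OF S i] u[OF i], of "dev x"] by simp

lemma part_rest:
  assumes "i < k" "v \<in> S ! i - {u i}"
  obtains l where "l \<in> {1..n - k}" "v = e l"
proof (rule vertex_cases[of v])
  show "v \<in> {1..n}" using opp_subset[OF S assms(1)] assms(2) by blast
  fix j assume j: "j < k" "v = u j"
  then have "j = i" using opp_disjoint[OF S j(1) assms(1) u[OF j(1)]] assms(2) by blast
  then show thesis using j assms(2) by blast
qed (use that in blast)

text \<open>The dependent displacements obey the same linear relations as \<open>r\<close>, so
  proportionality on the free vertices spreads to all. It is applied with \<open>r = 0\<close> to
  recognise the barycentre, and with the displacement of a second point.\<close>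

lemma dev_proportional:
  assumes x: "x \<in> topspace X" "\<And>T. x T \<noteq> 0 \<Longrightarrow> opp_le T S"
    and y: "\<And>i. i < k \<Longrightarrow> r (u i) = - (\<Sum>v\<in>S ! i - {u i}. r v)"
    and eq: "\<And>l. l \<in> {1..n - k} \<Longrightarrow> dev x (e l) = c * r (e l)" and v: "v \<in> {1..n}"
  shows "dev x v = c * r v"
  using v
proof (cases rule: vertex_cases)
  case (1 l)
  then show ?thesis using eq by blast
next
  case (2 i)
  have "(\<Sum>v\<in>S ! i - {u i}. dev x v) = (\<Sum>v\<in>S ! i - {u i}. c * r v)"
    by (rule sum.cong[OF refl]) (use part_rest[OF 2(1)] eq in metis)
  then show ?thesis using dev_u[OF x 2(1)] y[OF 2(1)] 2(2) by (simp add: sum_distrib_left)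
qed

text \<open>One half of the minimum formula for the weight of \<open>S\<close>, now centred at the
  barycentre, where the weight is 1; \<open>weight_eq_dev\<close> is the other half.\<close>

lemma weight_le_dev:
  assumes "x \<in> topspace X" "v \<in> {1..n}"
  shows "x S \<le> 1 + card (S ! part v) * dev x v"
  using weight_le_geometric_point[OF chain[OF assms(1)] S part_less[OF assms(2)] part_mem[OF assms(2)]]
    opp_part_card[OF S part_less[OF assms(2)]] by (simp add: dev_def algebra_simps)

lemma weight_eq_dev:
  assumes x: "x \<in> topspace X" and le: "\<And>T. x T \<noteq> 0 \<Longrightarrow> opp_le T S"
  obtains v where "v \<in> {1..n}" "x S = 1 + card (S ! part v) * dev x v"
proof (rule weight_eq_geometric_point[OF chain[OF x] S k le])
  fix i v assume iv: "i < k" "v \<in> S ! i" "x S = card (S ! i) * geometric_point n k x i v"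
  have "x S = 1 + card (S ! part v) * dev x v"
    using iv(3) part_eq[OF iv(1,2)] opp_part_card[OF S iv(1)] by (simp add: dev_def algebra_simps)
  then show thesis using that iv opp_subset[OF S iv(1)] by blast
qed

text \<open>If all three terms vanish, the point lies in the closed cell and has no displacement. It
  is then the barycentre, where the weight of \<open>S\<close> is 1 and not 0.\<close>

lemma denominator_pos:
  assumes x: "x \<in> topspace X"
  shows "0 < dev_norm x + off_weight x + (x S)\<^sup>2"
proof (rule ccontr)
  assume "\<not> ?thesis"
  then have zero: "dev_norm x = 0" "off_weight x = 0" "x S = 0"
    using dev_norm_nonneg[of x] off_weight_nonneg[OF x] zero_le_power2[of "x S"]
    by (smt (verit) power_eq_0_iff)+
  have le: "\<And>T. x T \<noteq> 0 \<Longrightarrow> opp_le T S" using zero(2) off_weight_eq_0_iff[OF x] by blast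
  have "\<forall>l\<in>{1..n - k}. (dev x (e l))\<^sup>2 = 0"
    using zero(1) unfolding dev_norm_def by (subst (asm) sum_nonneg_eq_0_iff) auto
  \<comment> \<open>The right-hand side is \<open>c * r v\<close> with \<open>c = 0\<close> and
    \<open>r = 0\<close>.\<close>
  then have "dev x v = 0 * 0" if "v \<in> {1..n}" for v
    by (intro dev_proportional[where r = "\<lambda>_. 0", OF x le _ _ that]) auto
  moreover obtain v where "v \<in> {1..n}" "x S = 1 + card (S ! part v) * dev x v"
    by (rule weight_eq_dev[OF x le])
  ultimately show False using zero(3) by simp
qed

text \<open>Stereographic projection rests on \<open>(N - t^2)^2 + 4 t^2 N = (N + t^2)^2\<close>.
  The summand \<open>q = off_weight x\<close> adds only an error \<open>4 q t^2\<close>, which is 0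
  because \<open>q\<close> vanishes wherever \<open>t = x S\<close> does not.\<close>

lemma cell_map_in_nsphere:
  assumes x: "x \<in> topspace X"
  shows "cell_map x \<in> topspace (nsphere (n - k))"
  unfolding topspace_nsphere
proof
  let ?N = "dev_norm x" and ?q = "off_weight x" and ?t = "x S"
  let ?D = "?N + ?q + ?t\<^sup>2"
  have D: "?D > 0" by (rule denominator_pos[OF x])
  have qt: "?q * ?t\<^sup>2 = 0" using off_weight_eq_0[OF x] by (cases "?t = 0") auto
  have "(\<Sum>l=1..n - k. (cell_map x l)\<^sup>2) = (\<Sum>l=1..n - k. (4 * ?t\<^sup>2 / ?D\<^sup>2) * (dev x (e l))\<^sup>2)"
    by (rule sum.cong) (auto simp: cell_map_def power_divide power_mult_distrib)
  also have "\<dots> = 4 * ?t\<^sup>2 / ?D\<^sup>2 * ?N" unfolding dev_norm_def sum_distrib_left ..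
  also have "\<dots> = 4 * ?t\<^sup>2 * ?N / ?D\<^sup>2" by simp
  finally have "(cell_map x 0)\<^sup>2 + (\<Sum>l=1..n - k. (cell_map x l)\<^sup>2) = ((?N + ?q - ?t\<^sup>2)\<^sup>2 + 4 * ?t\<^sup>2 * ?N) / ?D\<^sup>2"
    by (simp add: cell_map_def power_divide add_divide_distrib)
  also have "(?N + ?q - ?t\<^sup>2)\<^sup>2 + 4 * ?t\<^sup>2 * ?N = ?D\<^sup>2 - 4 * (?q * ?t\<^sup>2)"
    by (simp add: power2_eq_square algebra_simps)
  finally show "(cell_map x 0)\<^sup>2 + (\<Sum>l=1..n - k. (cell_map x l)\<^sup>2) = 1" using D qt by simp
qed (simp add: cell_map_def)

lemma continuous_map_cell_map: "continuous_map X (nsphere (n - k)) cell_map"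
proof (rule continuous_map_into_nsphere)
  have dev: "continuous_map X euclideanreal (\<lambda>x. dev x v)" for v
    unfolding dev_def geometric_point_def by (intro continuous_intros finite_opp) auto
  have off: "continuous_map X euclideanreal off_weight"
    unfolding off_weight_def using finite_opp by (intro continuous_intros) auto
  have norm: "continuous_map X euclideanreal dev_norm"
    unfolding dev_norm_def by (intro continuous_intros dev) auto
  have nz: "\<And>x. x \<in> topspace X \<Longrightarrow> dev_norm x + off_weight x + (x S)\<^sup>2 \<noteq> 0"
    using denominator_pos by fastforce
  show "continuous_map X euclideanreal (\<lambda>x. cell_map x l)" for l
  proof -
    consider "l = 0" | "l \<noteq> 0" "l \<le> n - k" | "l \<noteq> 0" "\<not> l \<le> n - k" by blast
    then show ?thesis
      by cases (simp_all add: cell_map_def, (intro continuous_intros dev off norm nz; assumption)+)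
  qed
qed (use cell_map_in_nsphere in auto)

lemma cell_map_eq_base_iff:
  assumes x: "x \<in> topspace X"
  shows "cell_map x = sphere_base \<longleftrightarrow> x S = 0"
proof
  assume "cell_map x = sphere_base"
  then have "cell_map x 0 = 1" by simp
  then show "x S = 0" using denominator_pos[OF x] by (simp add: cell_map_def)
next
  assume "x S = 0"
  then show "cell_map x = sphere_base" using denominator_pos[OF x] by (auto simp: cell_map_def)
qed

text \<open>Stereographic projection from the base point undoes the map and recovers the quotient of
  displacement and weight.\<close>

lemma cell_map_coordinate:
  assumes x: "x \<in> topspace X" "x S \<noteq> 0" and l: "l \<in> {1..n - k}"
  shows "dev x (e l) = x S * (cell_map x l / (1 - cell_map x 0))"
proof -
  let ?N = "dev_norm x" and ?t = "x S"
  have D: "?N + ?t\<^sup>2 > 0" and q: "off_weight x = 0"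
    using denominator_pos[OF x(1)] off_weight_eq_0[OF x] by auto
  have "1 - cell_map x 0 = 2 * ?t\<^sup>2 / (?N + ?t\<^sup>2)"
    using D q by (simp add: cell_map_def field_simps)
  moreover have "cell_map x l = 2 * dev x (e l) * ?t / (?N + ?t\<^sup>2)"
    using l q by (simp add: cell_map_def)
  ultimately show ?thesis using D x(2) by (simp add: power2_eq_square)
qed

text \<open>Equal images put both points on one ray from the barycentre. At a vertex where the
  minimum for \<open>x\<close> is attained, the bound for \<open>y\<close> reads
  \<open>y S \<le> 1 + (y S / x S) * (x S - 1)\<close>, that is, \<open>y S / x S \<le> 1\<close>.
  Exchanging the points gives equality.\<close>

lemma cell_map_inject_aux:
  assumes x: "x \<in> topspace X" "x S \<noteq> 0" and y: "y \<in> topspace X" "y S \<noteq> 0"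
    and eq: "cell_map x = cell_map y"
  shows "y S \<le> x S" and "v \<in> {1..n} \<Longrightarrow> dev y v = (y S / x S) * dev x v"
proof -
  have pos: "x S > 0" "y S > 0"
    using x y chain_weights_nonneg[OF chain] by (metis less_eq_real_def)+
  have lex: "\<And>T. x T \<noteq> 0 \<Longrightarrow> opp_le T S" and ley: "\<And>T. y T \<noteq> 0 \<Longrightarrow> opp_le T S"
    using support_le x y by blast+
  show ratio: "dev y v = (y S / x S) * dev x v" if "v \<in> {1..n}" for v
  proof (rule dev_proportional[OF y(1) ley dev_u[OF x(1) lex] _ that])
    show "dev y (e l) = (y S / x S) * dev x (e l)" if "l \<in> {1..n - k}" for l
      using cell_map_coordinate[OF x that] cell_map_coordinate[OF y that] eq pos by simp
  qed
  obtain v where v: "v \<in> {1..n}" "x S = 1 + card (S ! part v) * dev x v"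
    by (rule weight_eq_dev[OF x(1) lex])
  have "y S \<le> 1 + card (S ! part v) * dev y v" by (rule weight_le_dev[OF y(1) v(1)])
  also have "\<dots> = 1 + (y S / x S) * (card (S ! part v) * dev x v)" using ratio[OF v(1)] by simp
  also have "\<dots> = 1 + (y S / x S) * (x S - 1)" using v(2) by simp
  also have "\<dots> = 1 + y S - y S / x S" using pos by (simp add: field_simps)
  finally show "y S \<le> x S" using pos by (simp add: field_simps)
qed

lemma cell_map_inject:
  assumes x: "x \<in> topspace X" "x S \<noteq> 0" and y: "y \<in> topspace X" "y S \<noteq> 0"
    and eq: "cell_map x = cell_map y"
  shows "x = y"
proof (rule geometric_point_inject[OF chain chain k])
  have S_eq: "y S = x S"
    using cell_map_inject_aux(1)[OF x y eq] cell_map_inject_aux(1)[OF y x eq[symmetric]] by simp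
  fix i v assume i: "i < k"
  show "geometric_point n k x i v = geometric_point n k y i v"
  proof (cases "v \<in> S ! i")
    case True
    then have "v \<in> {1..n}" using opp_subset[OF S i] by blast
    then have "dev y v = dev x v" using cell_map_inject_aux(2)[OF x y eq] S_eq x(2) by simp
    then show ?thesis using part_eq[OF i True] by (simp add: dev_def)
  next
    case False
    then show ?thesis
      using geometric_point_off_part[OF x(1) support_le[OF x] i] geometric_point_off_part[OF y(1) support_le[OF y] i]
      by simp
  qed
qed (use x y in auto)

text \<open>Sum 0 in every part makes \<open>r\<close> a direction within the cell. On the ray from
  the barycentre in this direction, a point is sought whose distance parameter equals its weight of
  \<open>S\<close>.\<close>

lemma dev_surj:
  fixes r :: "nat \<Rightarrow> real"
  assumes r: "\<And>i. i < k \<Longrightarrow> (\<Sum>v\<in>S ! i. r v) = 0"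
  obtains x where "x \<in> topspace X" "x S > 0" "\<And>v. v \<in> {1..n} \<Longrightarrow> dev x v = x S * r v"
proof -
  define g where "g = Max ((\<lambda>v. - (card (S ! part v) * r v)) ` {1..n})"
  have g_ge: "- (card (S ! part v) * r v) \<le> g" if "v \<in> {1..n}" for v
    unfolding g_def using that by (intro Max_ge) auto
  have ne: "{1..n} \<noteq> {}" using u_range[OF k] by blast
  have "g \<in> (\<lambda>v. - (card (S ! part v) * r v)) ` {1..n}"
    unfolding g_def using ne by (intro Max_in) auto
  then obtain v0 where v0: "v0 \<in> {1..n}" "g = - (card (S ! part v0) * r v0)" by blast
  \<comment> \<open>In a part with sum 0 some entry is at most 0.\<close>
  have g0: "0 \<le> g"
  proof (rule ccontr)
    assume "\<not> 0 \<le> g"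
    then have "r v > 0" if "v \<in> S ! 0" for v
      using g_ge[of v] that opp_subset[OF S k] part_eq[OF k that] opp_part_card[OF S k]
      by (smt (verit) mult_nonneg_nonpos of_nat_0_le_iff subsetD)
    then have "(\<Sum>v\<in>S ! 0. r v) > 0"
      using opp_part_finite[OF S k] opp_nonempty[OF S k] by (intro sum_pos) auto
    then show False using r[OF k] by simp
  qed
  \<comment> \<open>At parameter \<open>s\<close> the minimum formula gives the weight
    \<open>1 - s * g\<close>; equating it with \<open>s\<close> yields this value.\<close>
  define s where "s = 1 / (1 + g)"
  have s0: "s > 0" and sg: "1 - s * g = s" using g0 by (auto simp: s_def field_simps)
  define y where "y i v = (if v \<in> S ! i then 1 / card (S ! i) + s * r v else 0)" for i v
  have s_le: "s \<le> 1 + card (S ! part v) * (s * r v)" if "v \<in> {1..n}" for v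
  proof -
    have "s * (- (card (S ! part v) * r v)) \<le> s * g" using g_ge[OF that] s0 by (intro mult_left_mono) auto
    then show ?thesis using sg by (simp add: algebra_simps)
  qed
  have y_pos: "y i v > 0" if "i < k" "v \<in> S ! i" for i v
  proof -
    have "v \<in> {1..n}" using that opp_subset[OF S] by blast
    then have "0 < 1 + card (S ! i) * (s * r v)" using s_le[of v] s0 part_eq[OF that] by simp
    then have "0 < card (S ! i) * y i v" using that opp_part_card[OF S that(1)] by (simp add: y_def algebra_simps)
    then show ?thesis by (simp add: zero_less_mult_iff)
  qed
  have y_iff: "y i v \<noteq> 0 \<longleftrightarrow> v \<in> S ! i" if "i < k" for i v
    using y_pos[OF that, of v] by (cases "v \<in> S ! i") (auto simp: y_def)
  have sum_y: "(\<Sum>v=1..n. y i v) = 1" if i: "i < k" for i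
  proof -
    have "(\<Sum>v=1..n. y i v) = (\<Sum>v\<in>S ! i. y i v)"
      by (rule sum.mono_neutral_right) (use opp_subset[OF S i] y_iff[OF i] in auto)
    also have "\<dots> = (\<Sum>v\<in>S ! i. 1 / card (S ! i) + s * r v)" by (rule sum.cong) (auto simp: y_def)
    also have "\<dots> = 1" using r[OF i] opp_part_card[OF S i] by (simp add: sum.distrib flip: sum_distrib_left)
    finally show ?thesis .
  qed
  have "\<exists>x. chain_weights n k x \<and> (\<forall>i<k. \<forall>v. geometric_point n k x i v = y i v) \<and>
    (\<forall>T. x T \<noteq> 0 \<longrightarrow> (\<forall>i<k. \<forall>v\<in>T ! i. y i v \<noteq> 0))"
  proof (rule geometric_point_surj[OF k zero_less_one])
    show "0 \<le> y i v" if "i < k" for i v using y_pos[OF that, of v] by (cases "v \<in> S ! i") (auto simp: y_def)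
    show "y i v = 0" if "i < k" "v \<notin> {1..n}" for i v using y_iff[OF that(1)] that(2) opp_subset[OF S that(1)] by blast
    show "i = j" if "i < k" "j < k" "y i v \<noteq> 0" "y j v \<noteq> 0" for i j v
      using that y_iff opp_disjoint[OF S that(1,2)] by blast
  qed (rule sum_y)
  then obtain x where x: "chain_weights n k x" "\<And>i v. i < k \<Longrightarrow> geometric_point n k x i v = y i v"
    and supp: "\<And>T i v. x T \<noteq> 0 \<Longrightarrow> i < k \<Longrightarrow> v \<in> T ! i \<Longrightarrow> y i v \<noteq> 0" by blast
  have "sum x (opp n k) = 1" using sum_geometric_point[OF k, of n x] x(2)[OF k] sum_y[OF k] by simp
  then have xX: "x \<in> topspace X" using x(1) by (simp add: topspace_opp_space)
  have le: "opp_le T S" if "x T \<noteq> 0" for T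
    unfolding opp_le_iff
    using opp_length[OF S] opp_length[OF chain_weights_opp[OF x(1) that]] supp[OF that] y_iff by auto
  have dev: "dev x v = s * r v" if "v \<in> {1..n}" for v
    using part_less[OF that] part_mem[OF that] x(2) by (simp add: dev_def y_def)
  have "x S = s"
  proof (rule antisym)
    show "x S \<le> s" using weight_le_dev[OF xX v0(1)] dev[OF v0(1)] v0(2) sg by (simp add: algebra_simps)
    obtain v where "v \<in> {1..n}" "x S = 1 + card (S ! part v) * dev x v" by (rule weight_eq_dev[OF xX le])
    then show "s \<le> x S" using s_le dev by simp
  qed
  then show thesis using that[OF xX] s0 dev by simp
qed

text \<open>Projecting \<open>z\<close> from the base point prescribes the quotient of displacement
  and weight on the free vertices, and the zero-sum condition extends it to the vertices
  \<open>u i\<close>. The coordinate 0 comes out right because, with \<open>t = x S\<close>, the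
  sphere equation gives \<open>dev_norm x = t^2 (1 + z 0) / (1 - z 0)\<close>.\<close>

lemma cell_map_surj:
  assumes z: "z \<in> topspace (nsphere (n - k))" "z \<noteq> sphere_base"
  obtains x where "x \<in> topspace X" "x S \<noteq> 0" "cell_map x = z"
proof -
  have zz: "(z 0)\<^sup>2 + (\<Sum>l=1..n - k. (z l)\<^sup>2) = 1" "\<And>l. l > n - k \<Longrightarrow> z l = 0"
    using z(1) by (auto simp: topspace_nsphere)
  have z0: "z 0 \<noteq> 1"
  proof
    assume one: "z 0 = 1"
    then have "(\<Sum>l=1..n - k. (z l)\<^sup>2) = 0" using zz(1) by simp
    then have "\<forall>l\<in>{1..n - k}. (z l)\<^sup>2 = 0" by (subst (asm) sum_nonneg_eq_0_iff) auto
    then have "z l = (if l = 0 then 1 else 0)" for l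
      using one zz(2)[of l] by (cases "l = 0"; cases "l \<le> n - k") auto
    then show False using z(2) by blast
  qed
  define p where "p v = z (inv_into {1..n - k} e v) / (1 - z 0)" for v
  define r where "r v = (if v \<in> u ` {..<k} then - (\<Sum>w\<in>S ! part v - {v}. p w) else p v)" for v
  have pe: "p (e l) = z l / (1 - z 0)" if "l \<in> {1..n - k}" for l
    using e that by (simp add: p_def bij_betw_def)
  have re: "r (e l) = p (e l)" if "l \<in> {1..n - k}" for l
  proof -
    have "e l \<notin> u ` {..<k}" using e that unfolding bij_betw_def by blast
    then show ?thesis by (simp add: r_def)
  qed
  have "(\<Sum>v\<in>S ! i. r v) = 0" if i: "i < k" for i
  proof -
    have "(\<Sum>v\<in>S ! i - {u i}. r v) = (\<Sum>v\<in>S ! i - {u i}. p v)"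
      by (rule sum.cong[OF refl]) (use part_rest[OF i] re in metis)
    moreover have "r (u i) = - (\<Sum>v\<in>S ! i - {u i}. p v)"
      using i part_eq[OF i u[OF i]] by (simp add: r_def)
    ultimately show ?thesis
      using sum.remove[OF opp_part_finite[OF S i] u[OF i], of r] by simp
  qed
  then obtain x where x: "x \<in> topspace X" "x S > 0" "\<And>v. v \<in> {1..n} \<Longrightarrow> dev x v = x S * r v"
    using dev_surj by blast
  let ?t = "x S"
  have q: "off_weight x = 0" using off_weight_eq_0 x by simp
  have dev: "dev x (e l) = ?t * (z l / (1 - z 0))" if "l \<in> {1..n - k}" for l
    using x(3)[OF e_range[OF that]] re[OF that] pe[OF that] by simp
  have "dev_norm x = (\<Sum>l=1..n - k. (?t / (1 - z 0))\<^sup>2 * (z l)\<^sup>2)"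
    unfolding dev_norm_def by (rule sum.cong) (auto simp: dev power_mult_distrib power_divide)
  also have "\<dots> = (?t / (1 - z 0))\<^sup>2 * (1 - (z 0)\<^sup>2)"
    using zz(1) by (simp flip: sum_distrib_left)
  also have "\<dots> = ?t\<^sup>2 * (1 + z 0) / (1 - z 0)"
  proof -
    have "1 - (z 0)\<^sup>2 = (1 - z 0) * (1 + z 0)" by (simp add: power2_eq_square algebra_simps)
    moreover have "(?t / a)\<^sup>2 * (a * b) = ?t\<^sup>2 * b / a" if "a \<noteq> 0" for a b
      using that by (simp add: power2_eq_square)
    ultimately show ?thesis using z0 by simp
  qed
  finally have N: "dev_norm x = ?t\<^sup>2 * (1 + z 0) / (1 - z 0)" .
  have D: "dev_norm x + ?t\<^sup>2 = 2 * ?t\<^sup>2 / (1 - z 0)" and E: "dev_norm x - ?t\<^sup>2 = 2 * ?t\<^sup>2 * z 0 / (1 - z 0)"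
    using z0 by (simp_all add: N field_simps)
  have "cell_map x l = z l" for l
  proof -
    consider "l = 0" | "l \<noteq> 0" "l \<le> n - k" | "l > n - k" by linarith
    then show ?thesis
    proof cases
      case 1
      then show ?thesis using q D E x(2) z0 by (simp add: cell_map_def)
    next
      case 2
      then show ?thesis using q D dev[of l] x(2) z0 by (simp add: cell_map_def power2_eq_square)
    next
      case 3
      then show ?thesis using zz(2) by (simp add: cell_map_def)
    qed
  qed
  then have "cell_map x = z" by blast
  then show thesis using that x by auto
qed

end

text \<open>The choices fixed in the locale exist for every exhaustive \<open>S\<close>. The open
  cell is where \<open>x S\<close> is positive; everything else is collapsed to the base point. For
  \<open>n = k\<close> the cell is a point and goes to the antipode of the base point.\<close>

lemma top_cell_map_exists:
  assumes S: "S \<in> opp n k" and ex: "exhaustive n k S" and k: "k > 0"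
  obtains f where "continuous_map (order_space (opp n k) opp_le) (nsphere (n - k)) f"
    "\<And>x. x \<in> topspace (order_space (opp n k) opp_le) \<Longrightarrow> f x = sphere_base \<longleftrightarrow> x S = 0"
    "\<And>x y. x \<in> topspace (order_space (opp n k) opp_le) \<Longrightarrow> y \<in> topspace (order_space (opp n k) opp_le) \<Longrightarrow>
      x S \<noteq> 0 \<Longrightarrow> y S \<noteq> 0 \<Longrightarrow> f x = f y \<Longrightarrow> x = y"
    "\<And>z. z \<in> topspace (nsphere (n - k)) \<Longrightarrow> z \<noteq> sphere_base \<Longrightarrow>
      \<exists>x\<in>topspace (order_space (opp n k) opp_le). x S \<noteq> 0 \<and> f x = z"
proof -
  obtain u where u: "\<And>i. i < k \<Longrightarrow> u i \<in> S ! i"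
    using that[of "\<lambda>i. SOME v. v \<in> S ! i"] opp_nonempty[OF S] by (simp add: some_in_eq)
  obtain part where part: "\<And>v. v \<in> {1..n} \<Longrightarrow> part v < k \<and> v \<in> S ! part v"
    using ex unfolding exhaustive_def by metis
  have "inj_on u {..<k}"
    using opp_disjoint[OF S] u by (intro inj_onI) (metis lessThan_iff)
  then have "card (u ` {..<k}) = k" by (simp add: card_image)
  moreover have "u ` {..<k} \<subseteq> {1..n}" using u opp_subset[OF S] by blast
  ultimately have "card ({1..n} - u ` {..<k}) = n - k" by (simp add: card_Diff_subset)
  then obtain e where e: "bij_betw e {1..n - k} ({1..n} - u ` {..<k})"
    using ex_bij_betw_nat_finite_1[of "{1..n} - u ` {..<k}"] by auto
  interpret top_cell n k S u part e
    using S k u part e by unfold_locales auto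
  show thesis
  proof (rule that[OF continuous_map_cell_map])
    show "\<exists>x\<in>topspace X. x S \<noteq> 0 \<and> cell_map x = z"
      if "z \<in> topspace (nsphere (n - k))" "z \<noteq> sphere_base" for z
      using cell_map_surj[OF that] by metis
  qed (rule cell_map_eq_base_iff cell_map_inject; assumption)+
qed

text \<open>The maps of the removed cells combine into one map to a product of spheres. Distinct
  maximal elements cannot share a chain, so at most one coordinate leaves the base point and the
  image is the wedge; the fibre over the wedge point is the contractible complex of
  \<open>Q\<close>.\<close>

lemma order_space_homotopy_equivalent_wedge:
  assumes k: "k > 0" and Q: "Q \<subseteq> opp n k" "Q \<noteq> {}" and contr: "contractible_space (order_space Q opp_le)"
    and full: "\<And>S. S \<in> opp n k - Q \<Longrightarrow> exhaustive n k S"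
  shows "order_space (opp n k) opp_le homotopy_equivalent_space
    wedge_of_spheres (card (opp n k - Q)) (n - k)"
proof -
  let ?X = "order_space (opp n k) opp_le" and ?A = "order_space Q opp_le"
  let ?M = "opp n k - Q" and ?d = "n - k"
  define m where "m = card ?M"
  have finQ: "finite Q" using Q(1) finite_opp finite_subset by metis
  obtain S where "bij_betw S {0..<m} ?M"
    using ex_bij_betw_nat_finite[of ?M] finite_opp unfolding m_def by auto
  then have S: "bij_betw S {..<m} ?M" by (simp add: atLeast0LessThan)
  have SM: "S j \<in> ?M" if "j < m" for j using S that by (auto simp: bij_betw_def)
  \<comment> \<open>The properties are bundled into one predicate so that maps for all cells can be
    chosen at once.\<close>
  define good where "good j f \<longleftrightarrow> continuous_map ?X (nsphere ?d) f \<and>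
      (\<forall>x\<in>topspace ?X. f x = sphere_base \<longleftrightarrow> x (S j) = 0) \<and>
      (\<forall>x\<in>topspace ?X. \<forall>y\<in>topspace ?X. x (S j) \<noteq> 0 \<longrightarrow> y (S j) \<noteq> 0 \<longrightarrow> f x = f y \<longrightarrow> x = y) \<and>
      (\<forall>z\<in>topspace (nsphere ?d). z \<noteq> sphere_base \<longrightarrow> (\<exists>x\<in>topspace ?X. x (S j) \<noteq> 0 \<and> f x = z))"
    for j f
  have "\<exists>f. good j f" if "j < m" for j
    unfolding good_def
    by (rule top_cell_map_exists[OF _ full[OF SM[OF that]] k]) (use SM[OF that] in blast)+
  then have "\<exists>f. \<forall>j. j < m \<longrightarrow> good j (f j)"
    by (intro choice) blast
  then obtain f where "\<And>j. j < m \<Longrightarrow> good j (f j)" by blast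
  then have f: "\<And>j. j < m \<Longrightarrow> continuous_map ?X (nsphere ?d) (f j)"
    "\<And>j x. j < m \<Longrightarrow> x \<in> topspace ?X \<Longrightarrow> f j x = sphere_base \<longleftrightarrow> x (S j) = 0"
    "\<And>j x y. j < m \<Longrightarrow> x \<in> topspace ?X \<Longrightarrow> y \<in> topspace ?X \<Longrightarrow> x (S j) \<noteq> 0 \<Longrightarrow> y (S j) \<noteq> 0 \<Longrightarrow>
      f j x = f j y \<Longrightarrow> x = y"
    "\<And>j z. j < m \<Longrightarrow> z \<in> topspace (nsphere ?d) \<Longrightarrow> z \<noteq> sphere_base \<Longrightarrow>
      \<exists>x\<in>topspace ?X. x (S j) \<noteq> 0 \<and> f j x = z"
    unfolding good_def by blast+
  define F where "F x = (\<lambda>j\<in>{..<m}. f j x)" for x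
  let ?W = "wedge_of_spheres m ?d"
  have one: "i = j" if x: "x \<in> topspace ?X" and ij: "i < m" "j < m" and ne: "x (S i) \<noteq> 0" "x (S j) \<noteq> 0" for x i j
  proof -
    have P: "S i \<in> opp n k" "S j \<in> opp n k" using SM ij by auto
    have "opp_le (S i) (S j) \<or> opp_le (S j) (S i)" by (rule order_space_chain[OF x finite_opp ne])
    then have "S i = S j"
      using exhaustive_maximal[OF full[OF SM[OF ij(1)]] P] exhaustive_maximal[OF full[OF SM[OF ij(2)]] P(2,1)] by auto
    then show ?thesis using S ij by (auto simp: bij_betw_def inj_on_def)
  qed
  have A_iff: "x \<in> topspace ?A \<longleftrightarrow> (\<forall>j<m. x (S j) = 0)" if "x \<in> topspace ?X" for x
  proof -
    have "?M = S ` {..<m}" using S by (simp add: bij_betw_def)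
    then show ?thesis using that order_space_subset[OF finite_opp Q(1), of opp_le] by auto
  qed
  obtain a where a: "a \<in> topspace ?A"
  proof -
    obtain v where "v \<in> Q" using Q(2) by blast
    then have "(\<lambda>w. if w = v then 1 else 0) \<in> topspace ?A"
      using finQ by (auto simp: topspace_order_space opp_le_refl)
    then show thesis using that by blast
  qed
  have AX: "topspace ?A \<subseteq> topspace ?X" by (rule order_space_mono[OF finite_opp Q(1)])
  have contF: "continuous_map ?X ?W F"
    unfolding wedge_of_spheres_def wedge_of_copies_def continuous_map_in_subtopology
  proof
    show "continuous_map ?X (product_topology (\<lambda>_. nsphere ?d) {..<m}) F"
      unfolding continuous_map_componentwise F_def using f(1) by auto
    show "F \<in> topspace ?X \<rightarrow> {g. \<forall>i<m. \<forall>j<m. g i \<noteq> sphere_base \<and> g j \<noteq> sphere_base \<longrightarrow> i = j}"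
      using f(2) one by (auto simp: F_def)
  qed
  have WE: "w \<in> extensional {..<m} \<and> (\<forall>i<m. w i \<in> topspace (nsphere ?d)) \<and>
      (\<forall>i<m. \<forall>j<m. w i \<noteq> sphere_base \<and> w j \<noteq> sphere_base \<longrightarrow> i = j)" if "w \<in> topspace ?W" for w
    using that unfolding wedge_of_spheres_def wedge_of_copies_def by (auto simp: PiE_iff)
  have FA: "F x = (\<lambda>j\<in>{..<m}. sphere_base)" if "x \<in> topspace ?A" for x
    unfolding F_def
  proof (rule restrict_ext)
    fix j assume "j \<in> {..<m}"
    then show "f j x = sphere_base" using f(2)[of j x] that A_iff[of x] AX by blast
  qed
  have surj: "F ` topspace ?X = topspace ?W"
  proof (intro equalityI subsetI)
    fix w assume "w \<in> F ` topspace ?X"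
    then show "w \<in> topspace ?W" using continuous_map_image_subset_topspace[OF contF] by blast
  next
    fix w assume "w \<in> topspace ?W"
    note w = WE[OF this]
    show "w \<in> F ` topspace ?X"
    proof (cases "\<forall>j<m. w j = sphere_base")
      \<comment> \<open>The wedge point is the image of the nonempty contractible part, which also
        settles \<open>m = 0\<close>.\<close>
      case True
      then have "w = F a" using w FA[OF a] by (auto simp: fun_eq_iff extensional_def)
      then show ?thesis using a AX by blast
    next
      case False
      then obtain j where j: "j < m" "w j \<noteq> sphere_base" by blast
      then obtain x where x: "x \<in> topspace ?X" "x (S j) \<noteq> 0" "f j x = w j" using f(4) w by blast
      have "f i x = w i" if "i < m" for i
      proof (cases "i = j")
        case False
        then have "w i = sphere_base" using w j that by blast
        moreover have "x (S i) = 0" using one[OF x(1) that j(1) _ x(2)] False by blast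
        then have "f i x = sphere_base" using f(2)[OF that x(1)] by blast
        ultimately show ?thesis by simp
      qed (use x in simp)
      then have "w = F x" using w by (auto simp: fun_eq_iff extensional_def F_def)
      then show ?thesis using x by blast
    qed
  qed
  obtain ca where ca: "continuous_map (prod_topology (top_of_set {0..1::real}) ?A) ?A ca"
    "\<And>x. x \<in> topspace ?A \<Longrightarrow> ca (0, x) = x" "\<And>x. x \<in> topspace ?A \<Longrightarrow> ca (1, x) = a"
    using contr a unfolding contractible_space_alt homotopic_with_true_iff by auto
  have caX: "continuous_map (prod_topology (top_of_set {0..1::real}) ?A) ?X ca"
    using ca(1) AX by (auto simp: continuous_map_into_order_space)
  obtain H where H: "continuous_map (prod_topology (top_of_set {0..1::real}) ?X) ?X H"
    "\<And>x. x \<in> topspace ?X \<Longrightarrow> H (0, x) = x"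
    "\<And>x t. x \<in> topspace ?A \<Longrightarrow> t \<in> {0..1} \<Longrightarrow> H (t, x) = ca (t, x)"
    by (rule order_space_homotopy_extension[OF finite_opp Q(1) _ caX, where f = "\<lambda>x. x"])
      (use ca in \<open>auto intro: continuous_map_id[unfolded id_def]\<close>)
  have caA: "ca (t, x) \<in> topspace ?A" if "t \<in> {0..1}" "x \<in> topspace ?A" for t x
    using ca(1) that by (auto simp: continuous_map_def Pi_iff)
  have "?X homotopy_equivalent_space ?W"
  proof (rule homotopy_equivalent_collapse[OF compact_order_space[OF finite_opp] _ contF surj, where A = "topspace ?A" and H = H and a = a])
    show "Hausdorff_space ?W"
      unfolding wedge_of_spheres_def wedge_of_copies_def nsphere
      by (intro Hausdorff_space_subtopology) (simp add: Hausdorff_space_product_topology Hausdorff_space_subtopology)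
    show "x \<in> topspace ?A \<and> y \<in> topspace ?A"
      if x: "x \<in> topspace ?X" and y: "y \<in> topspace ?X" and eq: "F x = F y" and ne: "x \<noteq> y" for x y
    proof -
      have "x (S j) = 0 \<and> y (S j) = 0" if j: "j < m" for j
      proof -
        have "f j x = f j y" using fun_cong[OF eq, of j] j by (simp add: F_def)
        then show ?thesis using f(2)[OF j x] f(2)[OF j y] f(3)[OF j x y] ne by metis
      qed
      then show ?thesis using A_iff[OF x] A_iff[OF y] by blast
    qed
    show "H (1, x) = a" if "x \<in> topspace ?A" for x using H(3)[OF that, of 1] ca(3)[OF that] by simp
  qed (use FA H caA in simp_all)
  then show ?thesis by (simp add: m_def)
qed

theorem theorem1p3:
  fixes n k :: nat
  assumes "n \<ge> 2" and "2 \<le> k" and "k \<le> n"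
  shows "(\<exists>m :: nat.
            int m = (\<Sum>i = 0..k. (-1) ^ (i + k + 1) * int (k choose (i + 1)) * int i ^ n) \<and>
            realization (order_complex (ordered_partial_partitions n k) opp_le)
              homotopy_equivalent_space wedge_of_spheres m (n - k)) \<and>
         euler_characteristic
             (realization (order_complex (ordered_partial_partitions n k) opp_le)) =
           euler_characteristic
             (discretized_configuration_space k (full_simplex {1..n}))"
proof
  have k: "k > 0" "1 \<le> k" using assms by auto
  obtain Q where "Q \<subseteq> opp n k" "Q \<noteq> {}" "contractible_space (order_space Q opp_le)"
    "\<forall>S\<in>opp n k - Q. exhaustive n k S" and card: "int (card (opp n k - Q)) = sphere_count n k"
    using contractible_core_exists[OF k(2) assms(3)] by blast
  then have "order_space (opp n k) opp_le homotopy_equivalent_space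
      wedge_of_spheres (card (opp n k - Q)) (n - k)"
    by (intro order_space_homotopy_equivalent_wedge[OF k(1)]) auto
  then show "\<exists>m :: nat.
      int m = (\<Sum>i = 0..k. (-1) ^ (i + k + 1) * int (k choose (i + 1)) * int i ^ n) \<and>
      realization (order_complex (ordered_partial_partitions n k) opp_le)
        homotopy_equivalent_space wedge_of_spheres m (n - k)"
    using card unfolding sphere_count_def by blast
  show "euler_characteristic (realization (order_complex (ordered_partial_partitions n k) opp_le)) =
      euler_characteristic (discretized_configuration_space k (full_simplex {1..n}))"
    by (intro euler_characteristic_homotopy_invariant homeomorphic_imp_homotopy_equivalent_space
        homeomorphic_map_imp_homeomorphic_space[OF homeomorphic_map_barycentric_subdivision[OF k(1)]])
qed

end
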